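(* Let $\beta\in(0,1]$, $R>0$, let $p\ge 1$ be a real number, let $(r_n)_{n\ge1}$ be a sequence of positive reals, and put $$r_n^*=n^{-\frac{\beta+1/(2p)}{\beta+1}},\qquad \mathcal{G}_n=\{g\in \mathcal{C}^\beta(R):\|g\|_p\ge r_n\}.$$ Consider the problem of testing $H_0:g=0$ versus $H_1:g\in\mathcal{G}_n$. Then the following holds as $n\to\infty$: (a) If $r_n/r^*_n\to \infty$, then the tests $\psi_{n,p} = \mathbf{1}\big( \hat F_p \ge r^p_n/2\big)$ satisfy $$\mathbb{E}_0[\psi_{n,p}] + \sup_{g \in\mathcal{G}_n}\mathbb{E}_g[1-\psi_{n,p}]\to 0.$$ (b) If $r_n/r^*_n\to 0$, then $$\inf_{\psi_n}\Big(\mathbb{E}_0[\psi_n] + \sup_{g \in\mathcal{G}_n}\mathbb{E}_g[1-\psi_n ]\Big)\to 1,$$ where the infimum is taken over all tests $\psi_n$ in the PPP model with intensity $\lambda_g(x,y)=n\mathbf{1}(y\ge g(x))$.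
   Context: Model (PPP model): for each $n\in\mathbb{N}$ one observes the support points $(X_j,Y_j)_{j\ge1}$ of a Poisson point process on $[0,1]\times\mathbb{R}$ with intensity function $\lambda_g(x,y)=n\mathbf{1}(y\ge g(x))$, $x\in[0,1]$, $y\in\mathbb{R}$, where $g$ is an unknown support boundary curve. $\mathbb{E}_g$ denotes expectation under this law, and $\mathbb{E}_0$ is the case $g=0$. A test is a measurable function of the observations with values in $[0,1]$. Hölder ball: $\mathcal{C}^\beta(R)=\{g:[0,1]\to\mathbb{R}: |g(x)-g(y)|\le R|x-y|^\beta\ \forall x,y\in[0,1]\}$. $\|\cdot\|_p$ is the norm of $L^p([0,1])$. The maximum-likelihood estimator over $\mathcal{C}^\beta(R)$ is $\hat g^{MLE}(x)=\min_{k\ge 1}\big(Y_k+R|x-X_k|^{\beta}\big)$, $x\in[0,1]$, and the estimator $\hat F_p$ of $\|g\|_p^p$ is $$\hat F_p=\int_0^1|\hat{g}^{MLE}(x)|^p\,dx-\frac{1}{n}\sum_{j\ge 1}p|Y_j|^{p-1}\operatorname{sgn}(Y_j)\mathbf{1}\big(\hat{g}^{MLE}(X_j)\ge Y_j\big).$$ *)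

theory Defs
  imports "HOL-Probability.Probability"
begin

text \<open>
  Functions on \<open>[0,1]\<close> are represented by functions on \<open>\<real>\<close>, whose values outside
  \<open>{0..1}\<close> are unconstrained and never enter any of the definitions below.
\<close>

definition holder_ball :: "real \<Rightarrow> real \<Rightarrow> (real \<Rightarrow> real) set" where
  "holder_ball \<beta> R =
     {g. \<forall>x\<in>{0..1}. \<forall>y\<in>{0..1}. \<bar>g x - g y\<bar> \<le> R * \<bar>x - y\<bar> powr \<beta>}"

definition Lp_norm :: "real \<Rightarrow> (real \<Rightarrow> real) \<Rightarrow> real" where
  "Lp_norm p g = (LBINT x:{0..1}. \<bar>g x\<bar> powr p) powr (1 / p)"


section \<open>Point configurations and Poisson point processes\<close>

text \<open>
  An observation is the set of support points \<open>(X\<^sub>j, Y\<^sub>j)\<close>. A process with intensity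
  \<open>n 1(y \<ge> g(x))\<close>, \<open>g\<close> bounded, almost surely has only finitely many points below any
  horizontal line, and no multiple points; so configurations are taken to be sets with that
  finiteness property.
\<close>

type_synonym config = "(real \<times> real) set"

definition configs :: "config set" where
  "configs = {\<omega>. \<omega> \<subseteq> {0..1} \<times> UNIV \<and> (\<forall>c. finite {z \<in> \<omega>. snd z \<le> c})}"

definition num_points :: "(real \<times> real) set \<Rightarrow> config \<Rightarrow> ennreal" where
  "num_points B \<omega> = emeasure (count_space UNIV) (\<omega> \<inter> B)"

text \<open>The usual \<open>\<sigma>\<close>-algebra for point processes: the smallest one making all counts
  of Borel sets measurable.\<close>

definition config_space :: "config measure" where
  "config_space = sigma configs
     {{\<omega> \<in> configs. num_points B \<omega> \<in> A} | A B. A \<in> sets borel \<and> B \<in> sets borel}"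

text \<open>
  The Poisson probabilities are written out because \<^const>\<open>poisson_pmf\<close> is only specified for
  a positive rate, whereas sets of intensity zero must be included here.
\<close>

definition poisson_process_law :: "(real \<times> real) measure \<Rightarrow> config measure \<Rightarrow> bool" where
  "poisson_process_law \<Lambda> P \<longleftrightarrow>
     prob_space P \<and> sets P = sets config_space \<and>
     (\<forall>B\<in>sets borel. emeasure \<Lambda> B < \<infinity> \<longrightarrow>
        (\<forall>k::nat. measure P {\<omega> \<in> space P. num_points B \<omega> = of_nat k} =
           exp (- measure \<Lambda> B) * measure \<Lambda> B ^ k / fact k)) \<and>
     (\<forall>(B :: nat \<Rightarrow> (real \<times> real) set) m.
        (\<forall>i<m. B i \<in> sets borel) \<and> disjoint_family_on B {..<m} \<longrightarrow>
        prob_space.indep_vars P (\<lambda>_. borel) (\<lambda>i. num_points (B i)) {..<m})"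

definition boundary_intensity :: "nat \<Rightarrow> (real \<Rightarrow> real) \<Rightarrow> (real \<times> real) measure" where
  "boundary_intensity n g =
     density lborel (\<lambda>(x, y). ennreal (real n * of_bool (x \<in> {0..1} \<and> g x \<le> y)))"


section \<open>Estimators and tests\<close>

text \<open>The infimum is attained for every nonempty configuration, by finiteness below every level.\<close>

definition mle :: "real \<Rightarrow> real \<Rightarrow> config \<Rightarrow> real \<Rightarrow> real" where
  "mle \<beta> R \<omega> x = (INF (u, y)\<in>\<omega>. y + R * \<bar>x - u\<bar> powr \<beta>)"

text \<open>The sum is finite for every configuration, since \<^const>\<open>mle\<close> is bounded above on
  \<open>[0,1]\<close>. At \<open>p = 1\<close> the library value \<open>0 powr 0 = 0\<close> does no harm, as \<open>sgn 0 = 0\<close>.\<close>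

definition F_hat :: "nat \<Rightarrow> real \<Rightarrow> real \<Rightarrow> real \<Rightarrow> config \<Rightarrow> real" where
  "F_hat n \<beta> R p \<omega> =
     (LBINT x:{0..1}. \<bar>mle \<beta> R \<omega> x\<bar> powr p)
     - 1 / real n * (\<Sum>(x, y) \<in> {(x, y) \<in> \<omega>. mle \<beta> R \<omega> x \<ge> y}.
                       p * \<bar>y\<bar> powr (p - 1) * sgn y)"

definition tests :: "(config \<Rightarrow> real) set" where
  "tests = {\<psi> \<in> borel_measurable config_space. \<forall>\<omega>\<in>space config_space. 0 \<le> \<psi> \<omega> \<and> \<psi> \<omega> \<le> 1}"

definition plugin_test ::
  "nat \<Rightarrow> real \<Rightarrow> real \<Rightarrow> real \<Rightarrow> real \<Rightarrow> config \<Rightarrow> real" where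
  "plugin_test n \<beta> R p \<rho> \<omega> = of_bool (F_hat n \<beta> R p \<omega> \<ge> \<rho> powr p / 2)"

definition testing_error ::
  "((real \<Rightarrow> real) \<Rightarrow> config measure) \<Rightarrow> (real \<Rightarrow> real) set \<Rightarrow> (config \<Rightarrow> real) \<Rightarrow> real" where
  "testing_error P \<G> \<psi> =
     (LINT \<omega>|P (\<lambda>_. 0). \<psi> \<omega>) + (SUP g\<in>\<G>. LINT \<omega>|P g. 1 - \<psi> \<omega>)"

definition alternatives :: "real \<Rightarrow> real \<Rightarrow> real \<Rightarrow> real \<Rightarrow> (real \<Rightarrow> real) set" where
  "alternatives \<beta> R p \<rho> = {g \<in> holder_ball \<beta> R. Lp_norm p g \<ge> \<rho>}"

definition critical_rate :: "real \<Rightarrow> real \<Rightarrow> nat \<Rightarrow> real" where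
  "critical_rate \<beta> p n = real n powr (- ((\<beta> + 1 / (2 * p)) / (\<beta> + 1)))"

end

theory Submission
  imports Defs
begin

text \<open>
  A point lies on the graph of the maximum-likelihood estimator, or below it, iff no point of the
  configuration lies strictly below it in the sense of the cone with profile \<open>R \<bar>u\<bar> powr \<beta>\<close>. Hence
  \<open>F_hat\<close> deviates from \<open>\<parallel>g\<parallel>\<^sub>p powr p\<close> by \<open>1 / n\<close> times a compensated sum over the explored points. By
  the Mecke formula this sum is centred, and the off-diagonal part of its variance vanishes because
  of two points only one can lie in the cone of the other. Void probabilities bound what remains by
  \<open>h (\<integral>\<bar>g\<bar> powr (2 p) + h powr (2 \<beta> p))\<close> up to a constant, where \<open>h = n powr (- 1 / (\<beta> + 1))\<close>, and
  Chebyshev's inequality yields (a).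

  For (b), the law with a nonnegative boundary \<open>g\<close> is the law with boundary \<open>0\<close>, conditioned on there
  being no point between \<open>0\<close> and \<open>g\<close>. Take \<open>K\<close> blocks of \<open>M\<close> cells of width about \<open>h\<close> and place one
  bump in a uniformly chosen cell of every block. The likelihood ratio of this mixture has second
  moment at most \<open>exp (c K / M)\<close>, and below the critical rate \<open>K\<close> can be chosen such that
  \<open>K / M\<close> is about \<open>K\<^sup>2 h\<close> and tends to \<open>0\<close>.
\<close>

section \<open>The space of configurations\<close>

text \<open>Void events of sets bounded in height form a pi-system that generates the configuration
  space. The Mecke formula and the density used in (b) are verified on them and extended from there.
  The intensity is infinite, so cancellations are made below a finite level and limits in the level
  come last.

  The bandwidth solves \<open>n * h * h powr \<beta> = 1\<close>: a box of width \<open>h\<close>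
  and height \<open>h powr \<beta>\<close> holds one point on average. This is the resolution of the
  estimator and the size of a bump that can be hidden at bounded cost.

  In (a) the variance contains \<open>\<integral>\<bar>g\<bar> powr (2 p)\<close>, which is
  unbounded over the alternatives. It is compared with the squared signal: a Hoelder function with a
  high peak has a wide one, so the signal grows with the peak.

  In (b) the norm dictates \<open>K\<close>: the integral of the \<open>p\<close>-th power of
  \<open>K\<close> bumps is of order \<open>K * h powr (\<beta> p + 1)\<close>. Making this
  \<open>r powr p\<close> gives \<open>K * sqrt h\<close> the order of the \<open>p\<close>-th power
  of \<open>r\<close> over the critical rate, up to rounding. Independent choices in the blocks turn
  the second moment into a product.\<close>

definition void_event :: "(real \<times> real) set \<Rightarrow> config set" where
  "void_event B = {\<omega> \<in> configs. \<omega> \<inter> B = {}}"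

lemma space_config_space [simp]: "space config_space = configs"
  unfolding config_space_def by (rule space_measure_of) auto

lemma sets_config_space:
  "sets config_space = sigma_sets configs
     {{\<omega> \<in> configs. num_points B \<omega> \<in> A} | A B. A \<in> sets borel \<and> B \<in> sets borel}"
  unfolding config_space_def by (rule sets_measure_of) auto

text \<open>Sums over the points of a configuration are written as integrals against
  \<open>count_space \<omega>\<close> throughout, so that the limit theorems for nonnegative
  integrals apply to them.\<close>

lemma num_points_eq_nn_integral:
  "num_points B \<omega> = (\<integral>\<^sup>+z. indicator B z \<partial>count_space \<omega>)"
proof -
  have "(\<integral>\<^sup>+z. indicator B z \<partial>count_space \<omega>)
      = (\<integral>\<^sup>+z. indicator B z * indicator \<omega> z \<partial>count_space UNIV)"
    by (simp add: nn_integral_count_space_indicator)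
  also have "\<dots> = (\<integral>\<^sup>+z. indicator (\<omega> \<inter> B) z \<partial>count_space UNIV)"
    by (intro nn_integral_cong) (auto split: split_indicator)
  finally show ?thesis
    by (simp add: num_points_def)
qed

lemma num_points_eq_0_iff: "num_points B \<omega> = 0 \<longleftrightarrow> \<omega> \<inter> B = {}"
  by (cases "finite (\<omega> \<inter> B)") (auto simp: num_points_def emeasure_count_space)

lemma measurable_num_points [measurable]:
  assumes "B \<in> sets borel"
  shows "num_points B \<in> borel_measurable config_space"
proof (rule measurableI)
  fix A :: "ennreal set" assume "A \<in> sets borel"
  then have "{\<omega> \<in> configs. num_points B \<omega> \<in> A} \<in> sets config_space"
    unfolding sets_config_space using assms by (intro sigma_sets.Basic) auto
  then show "num_points B -` A \<inter> space config_space \<in> sets config_space"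
    by (simp add: vimage_def Int_def conj_commute)
qed auto

lemma sets_void_event [measurable]:
  assumes "B \<in> sets borel"
  shows "void_event B \<in> sets config_space"
proof -
  have "{\<omega> \<in> space config_space. num_points B \<omega> = 0} \<in> sets config_space"
    using assms by measurable
  then show ?thesis
    by (simp add: void_event_def num_points_eq_0_iff)
qed

lemma void_event_Int: "void_event A \<inter> void_event B = void_event (A \<union> B)"
  by (auto simp: void_event_def)

lemma num_points_cases:
  obtains j where "num_points B \<omega> = of_nat j" | "num_points B \<omega> = \<infinity>"
  by (cases "finite (\<omega> \<inter> B)") (auto simp: num_points_def emeasure_count_space)

lemma of_nat_le_num_points_iff:
  "of_nat j \<le> num_points B \<omega> \<longleftrightarrow> (\<exists>F\<subseteq>\<omega> \<inter> B. finite F \<and> card F = j)"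
proof (cases "finite (\<omega> \<inter> B)")
  case True
  then have "of_nat j \<le> num_points B \<omega> \<longleftrightarrow> j \<le> card (\<omega> \<inter> B)"
    by (simp add: num_points_def emeasure_count_space)
  also have "\<dots> \<longleftrightarrow> (\<exists>F\<subseteq>\<omega> \<inter> B. finite F \<and> card F = j)"
    using True by (metis card_mono obtain_subset_with_card_n)
  finally show ?thesis .
next
  case False
  then show ?thesis
    using infinite_arbitrarily_large[OF False, of j]
    by (auto simp: num_points_def emeasure_count_space)
qed

text \<open>A point of a finite set is separated from the others by a member of any basis, so
  counts can be recovered from void events by peeling off one point at a time.\<close>

lemma Suc_le_num_points_iff:
  assumes "topological_basis \<B>"
  shows "of_nat (Suc j) \<le> num_points B \<omega> \<longleftrightarrow>
    (\<exists>c\<in>\<B>. \<omega> \<inter> (B \<inter> c) \<noteq> {} \<and> of_nat j \<le> num_points (B - c) \<omega>)"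
proof
  assume "of_nat (Suc j) \<le> num_points B \<omega>"
  then obtain F where F: "F \<subseteq> \<omega> \<inter> B" "finite F" "card F = Suc j"
    unfolding of_nat_le_num_points_iff by blast
  then obtain z G where G: "F = insert z G" "z \<notin> G" "card G = j"
    by (metis card_Suc_eq)
  have "open (- G)"
    using F G by (simp add: open_Compl finite_imp_closed)
  then obtain c where c: "c \<in> \<B>" "z \<in> c" "c \<subseteq> - G"
    using topological_basisE[OF assms, of "- G" z] G by auto
  show "\<exists>c\<in>\<B>. \<omega> \<inter> (B \<inter> c) \<noteq> {} \<and> of_nat j \<le> num_points (B - c) \<omega>"
  proof (intro bexI[OF _ c(1)] conjI)
    show "\<omega> \<inter> (B \<inter> c) \<noteq> {}"
      using c F G by auto
    have "G \<subseteq> \<omega> \<inter> (B - c)" "finite G"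
      using c F G by auto
    then show "of_nat j \<le> num_points (B - c) \<omega>"
      unfolding of_nat_le_num_points_iff using G by blast
  qed
next
  assume "\<exists>c\<in>\<B>. \<omega> \<inter> (B \<inter> c) \<noteq> {} \<and> of_nat j \<le> num_points (B - c) \<omega>"
  then obtain c z G where *: "c \<in> \<B>" "z \<in> \<omega> \<inter> (B \<inter> c)"
    "G \<subseteq> \<omega> \<inter> (B - c)" "finite G" "card G = j"
    unfolding of_nat_le_num_points_iff by blast
  moreover from * have "z \<notin> G"
    by auto
  ultimately have "insert z G \<subseteq> \<omega> \<inter> B" "finite (insert z G)" "card (insert z G) = Suc j"
    by auto
  then show "of_nat (Suc j) \<le> num_points B \<omega>"
    unfolding of_nat_le_num_points_iff by blast
qed

text \<open>Peeling off points yields measurability of the events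
  \<open>of_nat j \<le> num_points B \<omega>\<close>; this representation passes it on to the count
  itself, including the value infinity.\<close>

lemma num_points_eq_SUP:
  "num_points B \<omega> = (SUP j. of_nat j * indicator {\<omega>. of_nat j \<le> num_points B \<omega>} \<omega>)"
proof (rule antisym)
  show "(SUP j. of_nat j * indicator {\<omega>. of_nat j \<le> num_points B \<omega>} \<omega>) \<le> num_points B \<omega>"
    by (intro SUP_least) (auto split: split_indicator)
  show "num_points B \<omega> \<le> (SUP j. of_nat j * indicator {\<omega>. of_nat j \<le> num_points B \<omega>} \<omega>)"
  proof (cases B \<omega> rule: num_points_cases)
    case (1 j)
    then show ?thesis
      by (intro SUP_upper2[of j]) auto
  next
    case 2
    then show ?thesis
      by (simp add: ennreal_SUP_of_nat_eq_top)
  qed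
qed

text \<open>The bound \<open>c\<close> is there because the law prescribes Poisson counts only on
  sets of finite intensity, and the region above a boundary has finite intensity only up to a
  level.\<close>

definition bounded_voids :: "config set set" where
  "bounded_voids = {void_event B | B c. B \<in> sets borel \<and> B \<subseteq> UNIV \<times> {..c}}"

lemma bounded_voids_subset: "bounded_voids \<subseteq> Pow configs"
  by (auto simp: bounded_voids_def void_event_def)

lemma Int_stable_bounded_voids: "Int_stable bounded_voids"
proof (rule Int_stableI)
  fix a b assume "a \<in> bounded_voids" "b \<in> bounded_voids"
  then obtain A B c d where *: "A \<in> sets borel" "A \<subseteq> UNIV \<times> {..c}" "a = void_event A"
    "B \<in> sets borel" "B \<subseteq> UNIV \<times> {..d}" "b = void_event B"
    unfolding bounded_voids_def by blast
  have "A \<union> B \<subseteq> UNIV \<times> {..max c d}"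
    using * by fastforce
  then show "a \<inter> b \<in> bounded_voids"
    unfolding bounded_voids_def using *
    by (intro CollectI exI[of _ "A \<union> B"] exI[of _ "max c d"]) (simp add: void_event_Int)
qed

lemma configs_in_bounded_voids: "configs \<in> bounded_voids"
  unfolding bounded_voids_def by (rule CollectI, rule exI[of _ "{}"]) (auto simp: void_event_def)

text \<open>The measurable core of Renyi's theorem that void probabilities determine a simple point
  process: configurations are sets, so points can be counted by separating them. Later identities
  between laws need to be checked on \<open>bounded_voids\<close> only.\<close>

lemma sets_config_space_voids: "sets config_space = sigma_sets configs bounded_voids"
proof (rule antisym)
  show "sigma_sets configs bounded_voids \<subseteq> sets config_space"
    unfolding space_config_space[symmetric]
    by (rule sets.sigma_sets_subset) (auto simp: bounded_voids_def)
next
  define M where "M = sigma configs bounded_voids"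
  have sp: "space M = configs" and se: "sets M = sigma_sets configs bounded_voids"
    using bounded_voids_subset by (auto simp: M_def)
  have void: "void_event B \<in> sets M" if B: "B \<in> sets borel" for B
  proof -
    \<comment> \<open>Every point has finite height, so avoiding \<open>B\<close> means avoiding all
      its truncations at integer levels.\<close>
    have "void_event B = (\<Inter>c::nat. void_event (B \<inter> UNIV \<times> {..real c}))"
    proof (intro antisym subsetI)
      fix \<omega> assume w: "\<omega> \<in> (\<Inter>c::nat. void_event (B \<inter> UNIV \<times> {..real c}))"
      have "z \<notin> B" if "z \<in> \<omega>" for z
      proof -
        obtain c :: nat where "snd z \<le> real c"
          using real_arch_simple by blast
        moreover have "\<omega> \<inter> (B \<inter> UNIV \<times> {..real c}) = {}"
          using w by (auto simp: void_event_def)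
        ultimately show ?thesis
          using that by (cases z) auto
      qed
      then show "\<omega> \<in> void_event B"
        using w by (auto simp: void_event_def)
    qed (auto simp: void_event_def)
    moreover have "void_event (B \<inter> UNIV \<times> {..real c}) \<in> sets M" for c :: nat
    proof -
      have "UNIV \<times> {..real c} \<in> sets (borel :: (real \<times> real) measure)"
        by (simp add: borel_closed closed_Times)
      then show ?thesis
        unfolding se bounded_voids_def using B by (intro sigma_sets.Basic) auto
    qed
    ultimately show ?thesis
      by auto
  qed
  obtain \<B> :: "(real \<times> real) set set" where \<B>: "countable \<B>" "topological_basis \<B>"
    using ex_countable_basis by blast
  have ge: "{\<omega> \<in> configs. of_nat j \<le> num_points B \<omega>} \<in> sets M" if "B \<in> sets borel" for B j
    using that
  proof (induction j arbitrary: B)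
    case 0
    then show ?case
      using sets.top[of M] by (simp add: sp)
  next
    case (Suc j)
    \<comment> \<open>Countability of the basis turns the existential choice of a separating set
      into a countable union of events.\<close>
    have "{\<omega> \<in> configs. of_nat (Suc j) \<le> num_points B \<omega>} =
      (\<Union>c\<in>\<B>. (configs - void_event (B \<inter> c)) \<inter> {\<omega> \<in> configs. of_nat j \<le> num_points (B - c) \<omega>})"
      unfolding Suc_le_num_points_iff[OF \<B>(2)] by (auto simp: void_event_def)
    also have "\<dots> \<in> sets M"
    proof (intro sets.countable_UN'' \<B>(1) sets.Int)
      fix c assume "c \<in> \<B>"
      then have "c \<in> sets borel"
        using \<B>(2) topological_basis_open borel_open by metis
      then show "configs - void_event (B \<inter> c) \<in> sets M"
        "{\<omega> \<in> configs. of_nat j \<le> num_points (B - c) \<omega>} \<in> sets M"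
        using Suc void[of "B \<inter> c"] sets.compl_sets[of "void_event (B \<inter> c)" M]
        by (auto simp: sp)
    qed
    finally show ?case .
  qed
  have meas: "num_points B \<in> borel_measurable M" if "B \<in> sets borel" for B
  proof -
    have "(\<lambda>\<omega>. indicator {\<omega>. of_nat j \<le> num_points B \<omega>} \<omega> :: ennreal) \<in> borel_measurable M" for j
      by (rule borel_measurable_indicator') (use ge[OF that] in \<open>simp add: sp\<close>)
    then have "(\<lambda>\<omega>. of_nat j * indicator {\<omega>. of_nat j \<le> num_points B \<omega>} \<omega> :: ennreal)
        \<in> borel_measurable M" for j
      by (intro borel_measurable_times_ennreal) auto
    then have "(\<lambda>\<omega>. SUP j. of_nat j * indicator {\<omega>. of_nat j \<le> num_points B \<omega>} \<omega> :: ennreal)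
        \<in> borel_measurable M"
      by (intro borel_measurable_SUP) auto
    then show ?thesis
      by (subst num_points_eq_SUP[abs_def])
  qed
  have "sigma_sets (space M) {{\<omega> \<in> space M. num_points B \<omega> \<in> A} | A B.
      A \<in> sets borel \<and> B \<in> sets borel} \<subseteq> sets M"
  proof (rule sets.sigma_sets_subset, safe)
    fix A :: "ennreal set" and B :: "(real \<times> real) set"
    assume "A \<in> sets borel" "B \<in> sets borel"
    then have "num_points B -` A \<inter> space M \<in> sets M"
      using meas by (intro measurable_sets)
    then show "{\<omega> \<in> space M. num_points B \<omega> \<in> A} \<in> sets M"
      by (simp add: vimage_def Int_def conj_commute)
  qed
  then show "sets config_space \<subseteq> sigma_sets configs bounded_voids"
    by (simp add: sets_config_space se sp)
qed

section \<open>Truncation by height and measurability of sums over points\<close>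

abbreviation below :: "real \<Rightarrow> (real \<times> real) set" where
  "below c \<equiv> UNIV \<times> {..c}"

lemma sets_below [measurable]: "below c \<in> sets borel"
  by (simp add: borel_closed closed_Times)

lemma finite_below_config: "\<omega> \<in> configs \<Longrightarrow> finite (\<omega> \<inter> below c)"
  by (rule finite_subset[of _ "{z \<in> \<omega>. snd z \<le> c}"]) (auto simp: configs_def)

lemma num_points_below_finite: "\<omega> \<in> configs \<Longrightarrow> num_points (below c) \<omega> < \<infinity>"
  using finite_below_config[of \<omega> c] by (simp add: num_points_def emeasure_count_space of_nat_less_top)

lemma num_points_mono: "A \<subseteq> B \<Longrightarrow> num_points A \<omega> \<le> num_points B \<omega>"
  unfolding num_points_def by (intro emeasure_mono) auto

lemma SUP_indicator_below: "(SUP c::nat. indicator (below (real c)) z) = (1 :: ennreal)"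
proof (rule antisym)
  obtain c :: nat where "snd z \<le> real c"
    using real_arch_simple by blast
  then show "(1 :: ennreal) \<le> (SUP c::nat. indicator (below (real c)) z)"
    by (intro SUP_upper2[of c]) (auto simp: mem_Times_iff)
qed (intro SUP_least, auto split: split_indicator)

lemma incseq_indicator_below:
  "incseq (\<lambda>(c::nat) z. f z * (indicator (below (real c)) z :: ennreal))"
  by (intro monoI le_funI mult_left_mono) (auto split: split_indicator intro: order_trans)

text \<open>The sets \<open>below c\<close> exhaust the plane along the integers. This carries over
  to all heights what is proved where intensities and counts are finite.\<close>

lemma nn_integral_SUP_below:
  assumes "\<And>c. (\<lambda>z. f z * indicator (below c) z) \<in> borel_measurable M"
  shows "(\<integral>\<^sup>+z. f z \<partial>M) = (SUP c::nat. \<integral>\<^sup>+z. f z * indicator (below (real c)) z \<partial>M)"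
proof -
  have "(\<integral>\<^sup>+z. f z \<partial>M) = (\<integral>\<^sup>+z. (SUP c::nat. f z * indicator (below (real c)) z) \<partial>M)"
    by (simp add: SUP_mult_left_ennreal[symmetric] SUP_indicator_below)
  also have "\<dots> = (SUP c::nat. \<integral>\<^sup>+z. f z * indicator (below (real c)) z \<partial>M)"
    by (rule nn_integral_monotone_convergence_SUP[OF incseq_indicator_below assms])
  finally show ?thesis .
qed

text \<open>A monotone class argument: for a rectangle the sum is an indicator times a count. The
  truncation serves the complement step, where a difference in \<open>ennreal\<close> is taken and
  must not be infinity minus infinity.\<close>

lemma measurable_nn_integral_points_below:
  fixes f :: "'a \<times> (real \<times> real) \<Rightarrow> ennreal"
  assumes T: "T \<in> measurable M config_space" and f: "f \<in> borel_measurable (M \<Otimes>\<^sub>M borel)"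
  shows "(\<lambda>m. \<integral>\<^sup>+z. f (m, z) * indicator (below c) z \<partial>count_space (T m)) \<in> borel_measurable M"
  using f
proof (induction f rule: borel_measurable_induct)
  case (cong f g)
  have "(\<integral>\<^sup>+z. f (m, z) * indicator (below c) z \<partial>count_space (T m))
      = (\<integral>\<^sup>+z. g (m, z) * indicator (below c) z \<partial>count_space (T m))" if "m \<in> space M" for m
    using cong(3) that by (simp add: space_pair_measure)
  then show ?case
    using cong(4) by (simp cong: measurable_cong)
next
  case (set S)
  have Tc: "T m \<in> configs" if "m \<in> space M" for m
    using measurable_space[OF T that] by simp
  have S: "S \<in> sigma_sets (space M \<times> UNIV) {a \<times> b | a b. a \<in> sets M \<and> b \<in> sets borel}"
    using set by (simp add: sets_pair_measure)
  show ?case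
  proof (rule sigma_sets_induct_disjoint[OF _ _ S])
    show "Int_stable {a \<times> b | a b. a \<in> sets M \<and> b \<in> sets borel}"
      by (rule Int_stable_pair_measure_generator)
    show "{a \<times> b | a b. a \<in> sets M \<and> b \<in> sets borel} \<subseteq> Pow (space M \<times> UNIV)"
      using sets.sets_into_space by blast
  next
    fix S :: "('a \<times> (real \<times> real)) set" assume "S \<in> {a \<times> b | a b. a \<in> sets M \<and> b \<in> sets borel}"
    then obtain a b where [measurable]: "a \<in> sets M" "b \<in> sets borel" and S: "S = a \<times> b"
      by auto
    have "(\<integral>\<^sup>+z. indicator S (m, z) * indicator (below c) z \<partial>count_space (T m))
        = indicator a m * num_points (b \<inter> below c) (T m)" for m :: 'a
      unfolding num_points_eq_nn_integral
      by (subst nn_integral_cmult[symmetric])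
         (auto intro!: nn_integral_cong simp: S split: split_indicator)
    moreover have "(\<lambda>m. num_points (b \<inter> below c) (T m)) \<in> borel_measurable M"
      by (rule measurable_compose[OF T]) measurable
    ultimately show "(\<lambda>m. \<integral>\<^sup>+z. indicator S (m, z) * indicator (below c) z \<partial>count_space (T m))
        \<in> borel_measurable M"
      by simp
  next
    fix S :: "('a \<times> (real \<times> real)) set"
    let ?N = "\<lambda>S m. \<integral>\<^sup>+z. indicator S (m, z) * indicator (below c) z \<partial>count_space (T m)"
    assume S: "?N S \<in> borel_measurable M"
    \<comment> \<open>The truncated total count is finite for every configuration, hence the sum
      over \<open>S\<close> may be subtracted from it.\<close>
    have "?N (space M \<times> UNIV - S) m = num_points (below c) (T m) - ?N S m" if "m \<in> space M" for m
    proof -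
      have "?N S m + ?N (space M \<times> UNIV - S) m = num_points (below c) (T m)"
        unfolding num_points_eq_nn_integral using that
        by (subst nn_integral_add[symmetric])
           (auto intro!: nn_integral_cong split: split_indicator)
      moreover have "num_points (below c) (T m) < \<infinity>"
        by (rule num_points_below_finite[OF Tc[OF that]])
      ultimately have "?N S m + ?N (space M \<times> UNIV - S) m \<noteq> \<infinity>"
        by simp
      then have "?N S m \<noteq> \<infinity>"
        by (auto simp: ennreal_add_eq_top)
      then have "(?N S m + ?N (space M \<times> UNIV - S) m) - ?N S m = ?N (space M \<times> UNIV - S) m"
        by (intro ennreal_add_diff_cancel_left) simp
      then show ?thesis
        using \<open>?N S m + ?N (space M \<times> UNIV - S) m = num_points (below c) (T m)\<close> by simp
    qed
    moreover have "(\<lambda>m. num_points (below c) (T m)) \<in> borel_measurable M"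
      by (rule measurable_compose[OF T]) measurable
    ultimately show "?N (space M \<times> UNIV - S) \<in> borel_measurable M"
      using S by (simp cong: measurable_cong)
  next
    fix A :: "nat \<Rightarrow> ('a \<times> (real \<times> real)) set"
    let ?N = "\<lambda>S m. \<integral>\<^sup>+z. indicator S (m, z) * indicator (below c) z \<partial>count_space (T m)"
    assume A: "disjoint_family A" "\<And>i. ?N (A i) \<in> borel_measurable M"
    have "?N (\<Union>i. A i) m = (\<Sum>i. ?N (A i) m)" for m
      by (simp add: suminf_indicator[OF A(1), symmetric] nn_integral_suminf[symmetric])
    then show "?N (\<Union>i. A i) \<in> borel_measurable M"
      using A(2) by simp
  qed simp
next
  case (mult u k)
  then show ?case
    by (simp add: mult.assoc nn_integral_cmult)
next
  case (add u v)
  then show ?case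
    by (simp add: distrib_right nn_integral_add)
next
  case (seq U)
  have "(\<integral>\<^sup>+z. (SUP i. U i) (m, z) * indicator (below c) z \<partial>count_space (T m))
      = (SUP i. \<integral>\<^sup>+z. U i (m, z) * indicator (below c) z \<partial>count_space (T m))" for m
  proof -
    have "incseq (\<lambda>i z. U i (m, z) * indicator (below c) z :: ennreal)"
      using \<open>incseq U\<close> by (auto simp: mono_def le_fun_def intro!: mult_right_mono)
    from nn_integral_monotone_convergence_SUP[OF this, of "count_space (T m)"] show ?thesis
      by (simp add: SUP_mult_right_ennreal image_comp)
  qed
  then show ?case
    using seq.IH by simp
qed

lemma measurable_nn_integral_points:
  fixes f :: "'a \<times> (real \<times> real) \<Rightarrow> ennreal"
  assumes T: "T \<in> measurable M config_space" and f: "f \<in> borel_measurable (M \<Otimes>\<^sub>M borel)"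
  shows "(\<lambda>m. \<integral>\<^sup>+z. f (m, z) \<partial>count_space (T m)) \<in> borel_measurable M"
  by (subst nn_integral_SUP_below)
     (auto intro!: borel_measurable_SUP measurable_nn_integral_points_below[OF T f])

text \<open>Void events generate the target, so their preimages suffice.\<close>

lemma measurable_into_config_space:
  assumes "\<And>m. m \<in> space M \<Longrightarrow> T m \<in> configs"
    and "\<And>A. A \<in> sets borel \<Longrightarrow> {m \<in> space M. T m \<inter> A = {}} \<in> sets M"
  shows "T \<in> measurable M config_space"
proof (rule measurable_sigma_sets[OF sets_config_space_voids bounded_voids_subset])
  show "T \<in> space M \<rightarrow> configs"
    using assms(1) by auto
  fix y assume "y \<in> bounded_voids"
  then obtain A where A: "A \<in> sets borel" "y = void_event A"
    by (auto simp: bounded_voids_def)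
  have "T -` y \<inter> space M = {m \<in> space M. T m \<inter> A = {}}"
    using assms(1) by (auto simp: A(2) void_event_def)
  then show "T -` y \<inter> space M \<in> sets M"
    using assms(2)[OF A(1)] by simp
qed

section \<open>Inserting a point into a configuration\<close>

abbreviation strip :: "(real \<times> real) set" where
  "strip \<equiv> {0..1} \<times> UNIV"

lemma sets_strip [measurable]: "strip \<in> sets borel"
  by (simp add: borel_closed closed_Times)

text \<open>The case distinction keeps the result in \<open>configs\<close> for every
  \<open>z\<close> in the plane, so that insertion is a measurable map on a full product space. Off
  the strip the intensities vanish, and almost everywhere this is plain insertion.\<close>

definition add_point :: "real \<times> real \<Rightarrow> config \<Rightarrow> config" where
  "add_point z \<omega> = (if z \<in> strip then insert z \<omega> else \<omega>)"

lemma add_point_configs: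
  assumes "\<omega> \<in> configs"
  shows "add_point z \<omega> \<in> configs"
proof -
  have "finite {z' \<in> insert z \<omega>. snd z' \<le> c}" for c
    by (rule finite_subset[of _ "insert z {z' \<in> \<omega>. snd z' \<le> c}"]) (use assms in \<open>auto simp: configs_def\<close>)
  then show ?thesis
    using assms by (auto simp: configs_def add_point_def)
qed

lemma add_point_Int_empty_iff:
  "add_point z \<omega> \<inter> A = {} \<longleftrightarrow> \<omega> \<inter> A = {} \<and> z \<notin> strip \<inter> A"
  by (auto simp: add_point_def)

lemma measurable_add_point:
  "(\<lambda>(\<omega>, z). add_point z \<omega>) \<in> measurable (config_space \<Otimes>\<^sub>M borel) config_space"
proof (rule measurable_into_config_space)
  fix m :: "config \<times> (real \<times> real)"
  assume "m \<in> space (config_space \<Otimes>\<^sub>M borel)"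
  then show "(case m of (\<omega>, z) \<Rightarrow> add_point z \<omega>) \<in> configs"
    by (auto simp: space_pair_measure add_point_configs)
next
  fix A :: "(real \<times> real) set" assume A [measurable]: "A \<in> sets borel"
  have "{m \<in> space (config_space \<Otimes>\<^sub>M borel). (case m of (\<omega>, z) \<Rightarrow> add_point z \<omega>) \<inter> A = {}}
      = void_event A \<times> (- (strip \<inter> A))"
    unfolding void_event_def case_prod_beta add_point_Int_empty_iff by (auto simp: space_pair_measure)
  also have "\<dots> \<in> sets (config_space \<Otimes>\<^sub>M borel)"
    by (intro pair_measureI sets_void_event A borel_comp sets.Int sets_strip)
  finally show "{m \<in> space (config_space \<Otimes>\<^sub>M borel). (case m of (\<omega>, z) \<Rightarrow> add_point z \<omega>) \<inter> A = {}}
      \<in> sets (config_space \<Otimes>\<^sub>M borel)" .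
qed

section \<open>The Mecke formula\<close>

lemma poisson_mean_sums:
  fixes l :: real
  shows "(\<lambda>k. real k * (exp (- l) * l ^ k / fact k)) sums l"
proof -
  have "(\<lambda>k. l * exp (- l) * (l ^ k /\<^sub>R fact k)) sums (l * exp (- l) * exp l)"
    by (intro sums_mult exp_converges)
  also have "l * exp (- l) * exp l = l"
    by (simp add: exp_minus)
  also have "(\<lambda>k. l * exp (- l) * (l ^ k /\<^sub>R fact k))
      = (\<lambda>k. real (Suc k) * (exp (- l) * l ^ Suc k / fact (Suc k)))"
    by (rule ext) (simp add: divide_simps del: of_nat_Suc)
  finally show ?thesis
    using sums_Suc_iff[of "\<lambda>k. real k * (exp (- l) * l ^ k / fact k)" l] by simp
qed

lemma measurable_add_point_pair:
  "(\<lambda>(\<omega>, z). (add_point z \<omega>, z)) \<in> measurable (config_space \<Otimes>\<^sub>M borel) (config_space \<Otimes>\<^sub>M borel)"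
proof -
  have "(\<lambda>x. (case x of (\<omega>, z) \<Rightarrow> add_point z \<omega>, snd x))
      \<in> measurable (config_space \<Otimes>\<^sub>M borel) (config_space \<Otimes>\<^sub>M borel)"
    by (intro measurable_Pair measurable_add_point measurable_snd)
  then show ?thesis
    by (simp add: case_prod_beta)
qed

text \<open>The Mecke formula will be verified on these rectangles; \<open>configs\<close> itself is
  a bounded void event, which makes the family exhaust the product.\<close>

lemma sets_config_pair:
  "sets (config_space \<Otimes>\<^sub>M (borel :: (real \<times> real) measure))
    = sigma_sets (configs \<times> UNIV) {E \<times> B | E B. E \<in> bounded_voids \<and> B \<in> sets borel}"
proof -
  have "sets (config_space \<Otimes>\<^sub>M (borel :: (real \<times> real) measure))
      = sets (sigma (configs \<times> UNIV) {E \<times> B | E B. E \<in> bounded_voids \<and> B \<in> sets borel})"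
    unfolding space_config_space[symmetric] space_borel[symmetric]
    using bounded_voids_subset configs_in_bounded_voids sets_config_space_voids
    by (intro sets_pair_eq[where Ca="{configs}" and Cb="{UNIV}"])
       (auto simp: sets.sigma_sets_eq[of borel, simplified])
  also have "\<dots> = sigma_sets (configs \<times> UNIV) {E \<times> B | E B. E \<in> bounded_voids \<and> B \<in> sets borel}"
    using bounded_voids_subset by (intro sets_measure_of) auto
  finally show ?thesis .
qed

text \<open>\<open>finite_below\<close> gives sigma-finiteness and lets sums below a level be
  cancelled; \<open>off_strip\<close> matches the fact that configurations lie in the strip.\<close>

locale poisson_process =
  fixes \<Lambda> :: "(real \<times> real) measure" and P :: "config measure"
  assumes law: "poisson_process_law \<Lambda> P"
    and sets_intensity [measurable_cong]: "sets \<Lambda> = sets borel"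
    and finite_below: "emeasure \<Lambda> (below c) < \<infinity>"
    and off_strip: "emeasure \<Lambda> (- strip) = 0"
begin

sublocale prob_space P
  using law by (simp add: poisson_process_law_def)

lemma sets_P [measurable_cong]: "sets P = sets config_space"
  using law by (simp add: poisson_process_law_def)

lemma space_P: "space P = configs"
  using sets_eq_imp_space_eq[OF sets_P] by simp

lemma space_intensity: "space \<Lambda> = UNIV"
  using sets_eq_imp_space_eq[OF sets_intensity] by simp

sublocale intensity: sigma_finite_measure \<Lambda>
proof
  have "z \<in> (\<Union>c::nat. below (real c))" for z :: "real \<times> real"
    using real_arch_simple[of "snd z"] by (auto simp: mem_Times_iff)
  then show "\<exists>A. countable A \<and> A \<subseteq> sets \<Lambda> \<and> \<Union>A = space \<Lambda> \<and> (\<forall>a\<in>A. emeasure \<Lambda> a \<noteq> \<infinity>)"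
    using finite_below
    by (intro exI[of _ "range (\<lambda>c::nat. below (real c))"])
       (auto simp: space_intensity sets_intensity less_top[symmetric])
qed

sublocale pair: pair_sigma_finite P \<Lambda> ..

sublocale intensity_pair: pair_sigma_finite \<Lambda> \<Lambda> ..

lemma AE_strip: "AE z in \<Lambda>. z \<in> strip"
proof (rule AE_I'[of "- strip"])
  show "- strip \<in> null_sets \<Lambda>"
    by (intro null_setsI off_strip) (simp only: sets_intensity borel_comp sets_strip)
qed blast

lemma finite_intensity:
  assumes "B \<subseteq> below c"
  shows "emeasure \<Lambda> B < \<infinity>"
proof -
  have "emeasure \<Lambda> B \<le> emeasure \<Lambda> (below c)"
    using assms by (intro emeasure_mono) (auto simp: sets_intensity)
  then show ?thesis
    using finite_below[of c] by (rule le_less_trans)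
qed

lemma prob_num_points:
  assumes "B \<in> sets borel" "B \<subseteq> below c"
  shows "prob {\<omega> \<in> configs. num_points B \<omega> = of_nat k}
    = exp (- measure \<Lambda> B) * measure \<Lambda> B ^ k / fact k"
  using law assms finite_intensity[OF assms(2)] by (simp add: poisson_process_law_def space_P)

lemma void_probability:
  assumes "B \<in> sets borel" "B \<subseteq> below c"
  shows "prob (void_event B) = exp (- measure \<Lambda> B)"
  using prob_num_points[OF assms, of 0] by (simp add: num_points_eq_0_iff void_event_def)

text \<open>Independence on disjoint sets enters the development here, for two sets of which one is
  only asked to be empty.\<close>

lemma prob_num_points_Int_void:
  assumes A: "A \<in> sets borel" and B: "B \<in> sets borel" and disj: "A \<inter> B = {}"
  shows "prob ({\<omega> \<in> configs. num_points B \<omega> = of_nat k} \<inter> void_event A)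
    = prob {\<omega> \<in> configs. num_points B \<omega> = of_nat k} * prob (void_event A)"
proof -
  \<comment> \<open>The law speaks of finite families indexed by an initial segment of the naturals;
    index 0 carries the void set and index 1 the counted one.\<close>
  define D where "D = (\<lambda>i::nat. if i = 0 then A else B)"
  have "indep_vars (\<lambda>_. borel) (\<lambda>i. num_points (D i)) {..<2}"
    by (rule law[unfolded poisson_process_law_def, THEN conjunct2, THEN conjunct2, THEN conjunct2,
          THEN spec, of D, THEN spec, of 2, THEN mp])
       (use A B disj in \<open>auto simp: D_def disjoint_family_on_def less_2_cases_iff\<close>)
  from indep_varsD_finite[OF this, of "\<lambda>i. if i = 0 then {0} else {of_nat k}"]
  have "prob (num_points A -` {0} \<inter> configs \<inter> (num_points B -` {of_nat k} \<inter> configs))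
      = prob (num_points A -` {0} \<inter> configs) * prob (num_points B -` {of_nat k} \<inter> configs)"
    by (simp add: D_def space_P lessThan_Suc numeral_2_eq_2 Int_ac mult.commute)
  moreover have "num_points A -` {0} \<inter> configs = void_event A"
    by (auto simp: void_event_def num_points_eq_0_iff)
  moreover have "num_points B -` {of_nat k} \<inter> configs = {\<omega> \<in> configs. num_points B \<omega> = of_nat k}"
    by auto
  ultimately show ?thesis
    by (simp add: Int_commute mult.commute)
qed

text \<open>This is the Mecke formula for the product of a void event with a set disjoint from the
  avoided one. Independence splits off the void event and the Poisson mean remains.\<close>

lemma nn_integral_num_points_void:
  assumes A [measurable]: "A \<in> sets borel" and B [measurable]: "B \<in> sets borel"
    and "B \<subseteq> below c" and disj: "A \<inter> B = {}"
  shows "(\<integral>\<^sup>+\<omega>. num_points B \<omega> * indicator (void_event A) \<omega> \<partial>P)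
    = emeasure \<Lambda> B * emeasure P (void_event A)"
proof -
  let ?E = "\<lambda>k. {\<omega> \<in> configs. num_points B \<omega> = of_nat k}"
  have E [measurable]: "?E k \<in> sets config_space" for k
  proof -
    have "{\<omega> \<in> space config_space. num_points B \<omega> = of_nat k} \<in> sets config_space"
      by measurable
    then show ?thesis by simp
  qed
  \<comment> \<open>The count is finite because \<open>B\<close> is bounded in height, so exactly
    one term of the series over its possible values survives.\<close>
  have "num_points B \<omega> * indicator (void_event A) \<omega>
      = (\<Sum>k. of_nat k * indicator (?E k \<inter> void_event A) \<omega>)" if w: "\<omega> \<in> configs" for \<omega>
  proof -
    have "num_points B \<omega> < \<infinity>"
      using num_points_mono[OF \<open>B \<subseteq> below c\<close>] num_points_below_finite[OF w] by (rule le_less_trans)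
    then obtain j where j: "num_points B \<omega> = of_nat j"
      by (cases B \<omega> rule: num_points_cases) auto
    have "(\<Sum>k. of_nat k * indicator (?E k \<inter> void_event A) \<omega> :: ennreal)
        = (\<Sum>k\<in>{j}. of_nat k * indicator (?E k \<inter> void_event A) \<omega>)"
      by (rule suminf_finite) (auto simp: j split: split_indicator)
    then show ?thesis
      using w by (simp add: j indicator_def)
  qed
  then have "(\<integral>\<^sup>+\<omega>. num_points B \<omega> * indicator (void_event A) \<omega> \<partial>P)
      = (\<integral>\<^sup>+\<omega>. (\<Sum>k. of_nat k * indicator (?E k \<inter> void_event A) \<omega>) \<partial>P)"
    by (intro nn_integral_cong) (simp add: space_P)
  also have "\<dots> = (\<Sum>k. of_nat k * emeasure P (?E k \<inter> void_event A))"
    by (simp add: nn_integral_suminf nn_integral_cmult sets_P)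
  also have "\<dots> = (\<Sum>k. ennreal (real k * (exp (- measure \<Lambda> B) * measure \<Lambda> B ^ k / fact k))
      * emeasure P (void_event A))"
  proof (rule suminf_cong)
    fix k
    have "of_nat k = ennreal (real k)"
      by (rule ennreal_of_nat_eq_real_of_nat)
    moreover have "emeasure P (?E k \<inter> void_event A)
        = ennreal (exp (- measure \<Lambda> B) * measure \<Lambda> B ^ k / fact k) * emeasure P (void_event A)"
      unfolding emeasure_eq_measure prob_num_points_Int_void[OF A B disj]
        prob_num_points[OF B \<open>B \<subseteq> below c\<close>] by (intro ennreal_mult) auto
    ultimately show "of_nat k * emeasure P (?E k \<inter> void_event A)
        = ennreal (real k * (exp (- measure \<Lambda> B) * measure \<Lambda> B ^ k / fact k))
          * emeasure P (void_event A)"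
      by (simp only: mult.assoc ennreal_mult'[OF of_nat_0_le_iff])
  qed
  also have "\<dots> = (\<Sum>k. ennreal (real k * (exp (- measure \<Lambda> B) * measure \<Lambda> B ^ k / fact k)))
      * emeasure P (void_event A)"
    by simp
  also have "(\<Sum>k. ennreal (real k * (exp (- measure \<Lambda> B) * measure \<Lambda> B ^ k / fact k)))
      = ennreal (measure \<Lambda> B)"
    by (intro suminf_ennreal_eq poisson_mean_sums) simp
  also have "\<dots> = emeasure \<Lambda> B"
    using finite_intensity[OF \<open>B \<subseteq> below c\<close>] by (intro emeasure_eq_ennreal_measure[symmetric]) auto
  finally show ?thesis .
qed

lemma measurable_nn_integral_add_point:
  assumes "f \<in> borel_measurable (config_space \<Otimes>\<^sub>M borel)"
  shows "(\<lambda>z. \<integral>\<^sup>+\<omega>. f (add_point z \<omega>, z) \<partial>P) \<in> borel_measurable borel"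
proof -
  have "(\<lambda>x. f (case x of (\<omega>, z) \<Rightarrow> (add_point z \<omega>, z))) \<in> borel_measurable (config_space \<Otimes>\<^sub>M borel)"
    by (rule measurable_compose[OF measurable_add_point_pair assms])
  then have "(\<lambda>x. f (add_point (snd x) (fst x), snd x)) \<in> borel_measurable (P \<Otimes>\<^sub>M borel)"
    by (simp add: case_prod_beta cong: measurable_cong_sets sets_pair_measure_cong[OF sets_P refl])
  from measurable_compose[OF measurable_pair_swap'[of borel P] this]
  have "(\<lambda>(z, \<omega>). f (add_point z \<omega>, z)) \<in> borel_measurable (borel \<Otimes>\<^sub>M P)"
    by (simp add: case_prod_beta)
  then show ?thesis
    by (rule sigma_finite_measure.borel_measurable_nn_integral[OF prob_space_imp_sigma_finite[OF prob_space_axioms]])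
qed

lemma measurable_add_point_section:
  fixes f :: "config \<times> (real \<times> real) \<Rightarrow> ennreal"
  assumes "f \<in> borel_measurable (config_space \<Otimes>\<^sub>M borel)"
  shows "(\<lambda>\<omega>. f (add_point z \<omega>, z)) \<in> borel_measurable P"
proof -
  have "(\<lambda>x. f (case x of (\<omega>, z) \<Rightarrow> (add_point z \<omega>, z))) \<in> borel_measurable (config_space \<Otimes>\<^sub>M borel)"
    by (rule measurable_compose[OF measurable_add_point_pair assms])
  from measurable_compose[OF measurable_Pair2'[of z borel config_space] this] show ?thesis
    by (simp cong: measurable_cong_sets[OF sets_P])
qed

lemma measurable_below_section:
  assumes "f \<in> borel_measurable borel"
  shows "(\<lambda>z. f z * indicator (below c) z :: ennreal) \<in> borel_measurable \<Lambda>"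
  unfolding measurable_cong_sets[OF sets_intensity refl] using assms sets_below
  by (intro borel_measurable_times_ennreal borel_measurable_indicator)

text \<open>A monotone class argument started on rectangles \<open>void_event A \<times> B\<close>.
  Truncation keeps both sides finite, which the complement step needs.\<close>

lemma mecke_below:
  assumes "f \<in> borel_measurable (config_space \<Otimes>\<^sub>M borel)"
  shows "(\<integral>\<^sup>+\<omega>. \<integral>\<^sup>+z. f (\<omega>, z) * indicator (below c) z \<partial>count_space \<omega> \<partial>P)
    = (\<integral>\<^sup>+z. (\<integral>\<^sup>+\<omega>. f (add_point z \<omega>, z) \<partial>P) * indicator (below c) z \<partial>\<Lambda>)"
  using assms
proof (induction f rule: borel_measurable_induct)
  case (cong f g)
  have "f (\<omega>, z) = g (\<omega>, z)" if "\<omega> \<in> configs" for \<omega> z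
    using cong(3) that by (simp add: space_pair_measure)
  then have "(\<integral>\<^sup>+\<omega>. \<integral>\<^sup>+z. f (\<omega>, z) * indicator (below c) z \<partial>count_space \<omega> \<partial>P)
      = (\<integral>\<^sup>+\<omega>. \<integral>\<^sup>+z. g (\<omega>, z) * indicator (below c) z \<partial>count_space \<omega> \<partial>P)"
    "(\<integral>\<^sup>+z. (\<integral>\<^sup>+\<omega>. f (add_point z \<omega>, z) \<partial>P) * indicator (below c) z \<partial>\<Lambda>)
      = (\<integral>\<^sup>+z. (\<integral>\<^sup>+\<omega>. g (add_point z \<omega>, z) \<partial>P) * indicator (below c) z \<partial>\<Lambda>)"
    by (auto intro!: nn_integral_cong arg_cong2[where f="(*)"] simp: space_P add_point_configs)
  then show ?case
    using cong(4) by simp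
next
  case (set S)
  let ?G = "{E \<times> B | E B. E \<in> bounded_voids \<and> B \<in> sets borel} :: (config \<times> (real \<times> real)) set set"
  let ?L = "\<lambda>S. \<integral>\<^sup>+\<omega>. \<integral>\<^sup>+z. indicator S (\<omega>, z) * indicator (below c) z \<partial>count_space \<omega> \<partial>P"
  let ?R = "\<lambda>S. \<integral>\<^sup>+z. (\<integral>\<^sup>+\<omega>. indicator S (add_point z \<omega>, z) \<partial>P) * indicator (below c) z \<partial>\<Lambda>"
  have S: "S \<in> sigma_sets (configs \<times> UNIV) ?G"
    using set by (simp add: sets_config_pair)
  have rect: "?L (E \<times> B) = ?R (E \<times> B)" if E: "E \<in> bounded_voids" and B [measurable]: "B \<in> sets borel"
    for E B
  proof -
    obtain A d where A [measurable]: "A \<in> sets borel" and E: "E = void_event A" and "A \<subseteq> below d"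
      using E by (auto simp: bounded_voids_def)
    \<comment> \<open>On the event that \<open>A\<close> is void no point lies in \<open>A\<close>,
      so \<open>B\<close> may be replaced by \<open>B - A\<close>. This produces the disjointness
      required for independence; on the other side \<open>A\<close> is removed because inserting
      \<open>z\<close> into \<open>A\<close> would destroy the void.\<close>
    have "?L (E \<times> B) = (\<integral>\<^sup>+\<omega>. num_points ((B \<inter> below c) - A) \<omega> * indicator (void_event A) \<omega> \<partial>P)"
    proof (rule nn_integral_cong)
      fix \<omega> assume "\<omega> \<in> space P"
      show "(\<integral>\<^sup>+z. indicator (E \<times> B) (\<omega>, z) * indicator (below c) z \<partial>count_space \<omega>)
          = num_points ((B \<inter> below c) - A) \<omega> * indicator (void_event A) \<omega>"
      proof (cases "\<omega> \<in> void_event A")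
        case True
        then have "z \<notin> A" if "z \<in> \<omega>" for z
          using that by (auto simp: void_event_def)
        then have "(\<integral>\<^sup>+z. indicator (E \<times> B) (\<omega>, z) * indicator (below c) z \<partial>count_space \<omega>)
            = (\<integral>\<^sup>+z. indicator ((B \<inter> below c) - A) z \<partial>count_space \<omega>)"
          using True by (intro nn_integral_cong) (simp add: E indicator_def)
        then show ?thesis
          using True by (simp add: num_points_eq_nn_integral)
      qed (simp add: E)
    qed
    also have "\<dots> = emeasure \<Lambda> ((B \<inter> below c) - A) * emeasure P (void_event A)"
      by (rule nn_integral_num_points_void[where c=c]) (measurable, blast+)
    also have "\<dots> = (\<integral>\<^sup>+z. indicator ((B \<inter> below c) - A) z * emeasure P (void_event A) \<partial>\<Lambda>)"
    proof (subst nn_integral_multc)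
      have B': "(B \<inter> below c) - A \<in> sets \<Lambda>"
        unfolding sets_intensity by measurable
      then show "indicator ((B \<inter> below c) - A) \<in> borel_measurable \<Lambda>"
        by (rule borel_measurable_indicator)
      show "emeasure \<Lambda> ((B \<inter> below c) - A) * emeasure P (void_event A)
          = (\<integral>\<^sup>+z. indicator ((B \<inter> below c) - A) z \<partial>\<Lambda>) * emeasure P (void_event A)"
        by (simp only: nn_integral_indicator[OF B'])
    qed
    also have "\<dots> = ?R (E \<times> B)"
    proof (rule nn_integral_cong_AE, use AE_strip in eventually_elim)
      fix z assume z: "z \<in> strip"
      have "(\<integral>\<^sup>+\<omega>. indicator (E \<times> B) (add_point z \<omega>, z) \<partial>P)
          = (\<integral>\<^sup>+\<omega>. indicator (B - A) z * indicator (void_event A) \<omega> \<partial>P)"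
      proof (rule nn_integral_cong)
        fix \<omega> assume w: "\<omega> \<in> space P"
        show "(indicator (E \<times> B) (add_point z \<omega>, z) :: ennreal)
            = indicator (B - A) z * indicator (void_event A) \<omega>"
        proof -
          have "add_point z \<omega> \<in> E \<longleftrightarrow> \<omega> \<in> void_event A \<and> z \<notin> A"
            using w z add_point_Int_empty_iff[of z \<omega> A]
            by (simp only: E void_event_def mem_Collect_eq space_P add_point_configs Int_iff) blast
          then show ?thesis
            by (auto simp: indicator_def)
        qed
      qed
      also have "\<dots> = indicator (B - A) z * emeasure P (void_event A)"
        by (subst nn_integral_cmult) (auto simp: sets_P)
      finally show "indicator ((B \<inter> below c) - A) z * emeasure P (void_event A)
          = (\<integral>\<^sup>+\<omega>. indicator (E \<times> B) (add_point z \<omega>, z) \<partial>P) * indicator (below c) z"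
        by (auto split: split_indicator)
    qed
    finally show ?thesis .
  qed
  have meas: "(indicator S :: _ \<Rightarrow> ennreal) \<in> borel_measurable (config_space \<Otimes>\<^sub>M borel)"
    if "S \<in> sigma_sets (configs \<times> UNIV) ?G" for S
    using that unfolding sets_config_pair[symmetric] by (rule borel_measurable_indicator)
  note mR = measurable_below_section[OF measurable_nn_integral_add_point[OF meas]]
  have mL: "(\<lambda>\<omega>. \<integral>\<^sup>+z. indicator S (\<omega>, z) * indicator (below c) z \<partial>count_space \<omega>)
      \<in> borel_measurable P" if "S \<in> sigma_sets (configs \<times> UNIV) ?G" for S
    using measurable_nn_integral_points_below[OF measurable_ident[unfolded id_def] meas[OF that]]
    by (simp cong: measurable_cong_sets[OF sets_P])
  show ?case
  proof (rule sigma_sets_induct_disjoint[OF _ _ S])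
    show "Int_stable ?G"
    proof (rule Int_stableI, clarify)
      fix E F :: "config set" and B D :: "(real \<times> real) set"
      assume "E \<in> bounded_voids" "F \<in> bounded_voids" "B \<in> sets borel" "D \<in> sets borel"
      then show "\<exists>E' B'. E \<times> B \<inter> F \<times> D = E' \<times> B' \<and> E' \<in> bounded_voids \<and> B' \<in> sets borel"
        using Int_stable_bounded_voids
        by (intro exI[of _ "E \<inter> F"] exI[of _ "B \<inter> D"]) (auto simp: Int_stable_def)
    qed
    show "?G \<subseteq> Pow (configs \<times> UNIV)"
      using bounded_voids_subset by auto
    show "?L S = ?R S" if "S \<in> ?G" for S
      using rect that by blast
    show "?L {} = ?R {}"
      by simp
  next
    fix S assume S: "S \<in> sigma_sets (configs \<times> UNIV) ?G" and eq: "?L S = ?R S"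
    let ?S' = "configs \<times> UNIV - S"
    have S': "?S' \<in> sigma_sets (configs \<times> UNIV) ?G"
      using S by (rule sigma_sets.Compl)
    have split: "(indicator (configs \<times> UNIV) (\<omega>, z) :: ennreal) = indicator S (\<omega>, z) + indicator ?S' (\<omega>, z)"
      if "\<omega> \<in> configs" for \<omega> z
      using that by (simp add: indicator_def)
    have "?L S + ?L ?S' = ?L (configs \<times> UNIV)"
      using mL[OF S] mL[OF S']
      by (subst nn_integral_add[symmetric])
         (auto intro!: nn_integral_cong simp: space_P nn_integral_add[symmetric]
           split: split_indicator)
    also have "\<dots> = ?R (configs \<times> UNIV)"
      by (rule rect[OF configs_in_bounded_voids]) simp
    also have "\<dots> = (\<integral>\<^sup>+z. (\<integral>\<^sup>+\<omega>. indicator S (add_point z \<omega>, z) + indicator ?S' (add_point z \<omega>, z) \<partial>P)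
        * indicator (below c) z \<partial>\<Lambda>)"
      by (intro nn_integral_cong arg_cong2[where f="(*)"] refl)
         (simp only: split space_P add_point_configs)
    also have "\<dots> = (\<integral>\<^sup>+z. (\<integral>\<^sup>+\<omega>. indicator S (add_point z \<omega>, z) \<partial>P) * indicator (below c) z
        + (\<integral>\<^sup>+\<omega>. indicator ?S' (add_point z \<omega>, z) \<partial>P) * indicator (below c) z \<partial>\<Lambda>)"
    proof (intro nn_integral_cong)
      fix z
      from measurable_add_point_section[OF meas[OF S]] measurable_add_point_section[OF meas[OF S']]
      show "(\<integral>\<^sup>+\<omega>. indicator S (add_point z \<omega>, z) + indicator ?S' (add_point z \<omega>, z) \<partial>P)
          * indicator (below c) z
        = (\<integral>\<^sup>+\<omega>. indicator S (add_point z \<omega>, z) \<partial>P) * indicator (below c) z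
        + (\<integral>\<^sup>+\<omega>. indicator ?S' (add_point z \<omega>, z) \<partial>P) * indicator (below c) z"
        by (subst nn_integral_add) (auto simp: distrib_right)
    qed
    also have "\<dots> = ?R S + ?R ?S'"
      by (intro nn_integral_add mR S S')
    finally have sum_eq: "?L S + ?L ?S' = ?R S + ?R ?S'" .
    \<comment> \<open>Probabilities are at most 1, so the integral is at most the intensity of
      \<open>below c\<close>. Being finite, it can be cancelled from the identity for the whole
      space.\<close>
    have "?R S \<le> (\<integral>\<^sup>+z. indicator (below c) z \<partial>\<Lambda>)"
    proof (intro nn_integral_mono)
      fix z
      have "(\<integral>\<^sup>+\<omega>. indicator S (add_point z \<omega>, z) \<partial>P) \<le> (\<integral>\<^sup>+\<omega>. 1 \<partial>P)"
        by (intro nn_integral_mono) (auto split: split_indicator)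
      then show "(\<integral>\<^sup>+\<omega>. indicator S (add_point z \<omega>, z) \<partial>P) * indicator (below c) z \<le> indicator (below c) z"
        by (auto simp: emeasure_space_1 split: split_indicator)
    qed
    also have "\<dots> = emeasure \<Lambda> (below c)"
      by (simp add: sets_intensity)
    also have "\<dots> < \<infinity>"
      by (rule finite_below)
    finally have "?R S \<noteq> \<infinity>"
      by simp
    then show "?L ?S' = ?R ?S'"
      using sum_eq unfolding eq by (simp add: ennreal_add_left_cancel)
  next
    fix A :: "nat \<Rightarrow> (config \<times> (real \<times> real)) set"
    assume A: "disjoint_family A" "range A \<subseteq> sigma_sets (configs \<times> UNIV) ?G"
      and eq: "\<And>i. ?L (A i) = ?R (A i)"
    have A_i: "A i \<in> sigma_sets (configs \<times> UNIV) ?G" for i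
      using A by auto
    have "?L (\<Union>i. A i) = (\<integral>\<^sup>+\<omega>. (\<Sum>i. \<integral>\<^sup>+z. indicator (A i) (\<omega>, z) * indicator (below c) z \<partial>count_space \<omega>) \<partial>P)"
      by (simp add: suminf_indicator[OF A(1), symmetric] nn_integral_suminf[symmetric])
    also have "\<dots> = (\<Sum>i. ?L (A i))"
      by (intro nn_integral_suminf mL A_i)
    also have "\<dots> = (\<Sum>i. ?R (A i))"
      by (simp add: eq)
    also have "\<dots> = (\<integral>\<^sup>+z. (\<Sum>i. (\<integral>\<^sup>+\<omega>. indicator (A i) (add_point z \<omega>, z) \<partial>P) * indicator (below c) z) \<partial>\<Lambda>)"
      by (intro nn_integral_suminf[symmetric] mR A_i)
    also have "\<dots> = ?R (\<Union>i. A i)"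
    proof (intro nn_integral_cong)
      fix z
      show "(\<Sum>i. (\<integral>\<^sup>+\<omega>. indicator (A i) (add_point z \<omega>, z) \<partial>P) * indicator (below c) z)
          = (\<integral>\<^sup>+\<omega>. indicator (\<Union>i. A i) (add_point z \<omega>, z) \<partial>P) * indicator (below c) z"
        using measurable_add_point_section[OF meas[OF A_i]]
        by (simp add: suminf_indicator[OF A(1), symmetric] nn_integral_suminf)
    qed
    finally show "?L (\<Union>i. A i) = ?R (\<Union>i. A i)" .
  qed
next
  case (mult u k)
  note m = measurable_nn_integral_points_below[OF measurable_ident[unfolded id_def] mult.hyps(2)]
    measurable_nn_integral_add_point[OF mult.hyps(2)] measurable_add_point_section[OF mult.hyps(2)]
  have "(\<lambda>\<omega>. \<integral>\<^sup>+z. u (\<omega>, z) * indicator (below c) z \<partial>count_space \<omega>) \<in> borel_measurable P"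
    using m(1) by (simp cong: measurable_cong_sets[OF sets_P])
  moreover have "(\<lambda>z. (\<integral>\<^sup>+\<omega>. u (add_point z \<omega>, z) \<partial>P) * indicator (below c) z) \<in> borel_measurable \<Lambda>"
    by (rule measurable_below_section[OF m(2)])
  ultimately show ?case
    using mult.IH by (simp add: mult.assoc nn_integral_cmult m(3))
next
  case (add u v)
  note mu = measurable_nn_integral_points_below[OF measurable_ident[unfolded id_def] add.hyps(1)]
    measurable_nn_integral_add_point[OF add.hyps(1)] measurable_add_point_section[OF add.hyps(1)]
  note mv = measurable_nn_integral_points_below[OF measurable_ident[unfolded id_def] add.hyps(3)]
    measurable_nn_integral_add_point[OF add.hyps(3)] measurable_add_point_section[OF add.hyps(3)]
  have "(\<lambda>\<omega>. \<integral>\<^sup>+z. u (\<omega>, z) * indicator (below c) z \<partial>count_space \<omega>) \<in> borel_measurable P"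
    "(\<lambda>\<omega>. \<integral>\<^sup>+z. v (\<omega>, z) * indicator (below c) z \<partial>count_space \<omega>) \<in> borel_measurable P"
    using mu(1) mv(1) by (simp_all cong: measurable_cong_sets[OF sets_P])
  moreover have "(\<lambda>z. (\<integral>\<^sup>+\<omega>. u (add_point z \<omega>, z) \<partial>P) * indicator (below c) z) \<in> borel_measurable \<Lambda>"
    "(\<lambda>z. (\<integral>\<^sup>+\<omega>. v (add_point z \<omega>, z) \<partial>P) * indicator (below c) z) \<in> borel_measurable \<Lambda>"
    by (rule measurable_below_section[OF mu(2)], rule measurable_below_section[OF mv(2)])
  ultimately show ?case
    using add.IH by (simp add: distrib_right nn_integral_add mu(3) mv(3))
next
  case (seq U)
  have U: "incseq U" and mU: "\<And>i. U i \<in> borel_measurable (config_space \<Otimes>\<^sub>M borel)"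
    by fact+
  have mono: "U i x \<le> U j x" if "i \<le> j" for i j x
    by (rule le_funD[OF monoD[OF U that]])
  have m1: "(\<lambda>\<omega>. \<integral>\<^sup>+z. U i (\<omega>, z) * indicator (below c) z \<partial>count_space \<omega>) \<in> borel_measurable P" for i
    using measurable_nn_integral_points_below[OF measurable_ident[unfolded id_def] mU]
    by (simp cong: measurable_cong_sets[OF sets_P])
  note m2 = measurable_below_section[OF measurable_nn_integral_add_point[OF mU]]
  have "(\<integral>\<^sup>+\<omega>. \<integral>\<^sup>+z. (SUP i. U i) (\<omega>, z) * indicator (below c) z \<partial>count_space \<omega> \<partial>P)
      = (\<integral>\<^sup>+\<omega>. (SUP i. \<integral>\<^sup>+z. U i (\<omega>, z) * indicator (below c) z \<partial>count_space \<omega>) \<partial>P)"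
  proof (intro nn_integral_cong)
    fix \<omega>
    have "incseq (\<lambda>i z. U i (\<omega>, z) * indicator (below c) z)"
      by (auto simp: mono mono_def le_fun_def intro!: mult_right_mono)
    from nn_integral_monotone_convergence_SUP[OF this, of "count_space \<omega>"]
    show "(\<integral>\<^sup>+z. (SUP i. U i) (\<omega>, z) * indicator (below c) z \<partial>count_space \<omega>)
        = (SUP i. \<integral>\<^sup>+z. U i (\<omega>, z) * indicator (below c) z \<partial>count_space \<omega>)"
      by (simp add: SUP_mult_right_ennreal image_comp)
  qed
  also have "\<dots> = (SUP i. \<integral>\<^sup>+\<omega>. \<integral>\<^sup>+z. U i (\<omega>, z) * indicator (below c) z \<partial>count_space \<omega> \<partial>P)"
    by (intro nn_integral_monotone_convergence_SUP m1)
      (auto simp: mono mono_def le_fun_def intro!: nn_integral_mono mult_right_mono)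
  also have "\<dots> = (SUP i. \<integral>\<^sup>+z. (\<integral>\<^sup>+\<omega>. U i (add_point z \<omega>, z) \<partial>P) * indicator (below c) z \<partial>\<Lambda>)"
    using seq.IH by simp
  also have "\<dots> = (\<integral>\<^sup>+z. (SUP i. (\<integral>\<^sup>+\<omega>. U i (add_point z \<omega>, z) \<partial>P) * indicator (below c) z) \<partial>\<Lambda>)"
    by (intro nn_integral_monotone_convergence_SUP[symmetric] m2)
      (auto simp: mono mono_def le_fun_def intro!: nn_integral_mono mult_right_mono)
  also have "\<dots> = (\<integral>\<^sup>+z. (\<integral>\<^sup>+\<omega>. (SUP i. U i) (add_point z \<omega>, z) \<partial>P) * indicator (below c) z \<partial>\<Lambda>)"
  proof (intro nn_integral_cong)
    fix z
    have "incseq (\<lambda>i \<omega>. U i (add_point z \<omega>, z))"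
      by (auto simp: mono mono_def le_fun_def)
    from nn_integral_monotone_convergence_SUP[OF this measurable_add_point_section[OF mU]]
    show "(SUP i. (\<integral>\<^sup>+\<omega>. U i (add_point z \<omega>, z) \<partial>P) * indicator (below c) z)
        = (\<integral>\<^sup>+\<omega>. (SUP i. U i) (add_point z \<omega>, z) \<partial>P) * indicator (below c) z"
      by (simp add: SUP_mult_right_ennreal image_comp)
  qed
  finally show ?case .
qed

text \<open>Monotone convergence in the level removes the truncation on both sides.\<close>

theorem mecke:
  assumes f: "f \<in> borel_measurable (config_space \<Otimes>\<^sub>M borel)"
  shows "(\<integral>\<^sup>+\<omega>. \<integral>\<^sup>+z. f (\<omega>, z) \<partial>count_space \<omega> \<partial>P) = (\<integral>\<^sup>+z. \<integral>\<^sup>+\<omega>. f (add_point z \<omega>, z) \<partial>P \<partial>\<Lambda>)"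
proof -
  note [measurable] = measurable_nn_integral_points_below[OF measurable_ident[unfolded id_def] f]
    measurable_nn_integral_add_point[OF f]
  have "(\<integral>\<^sup>+\<omega>. \<integral>\<^sup>+z. f (\<omega>, z) \<partial>count_space \<omega> \<partial>P)
      = (\<integral>\<^sup>+\<omega>. (SUP c::nat. \<integral>\<^sup>+z. f (\<omega>, z) * indicator (below (real c)) z \<partial>count_space \<omega>) \<partial>P)"
    by (intro nn_integral_cong nn_integral_SUP_below) simp
  also have "\<dots> = (SUP c::nat. \<integral>\<^sup>+\<omega>. \<integral>\<^sup>+z. f (\<omega>, z) * indicator (below (real c)) z \<partial>count_space \<omega> \<partial>P)"
    by (intro nn_integral_monotone_convergence_SUP)
      (auto simp: mono_def le_fun_def intro!: nn_integral_mono mult_left_mono split: split_indicator)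
  also have "\<dots> = (SUP c::nat. \<integral>\<^sup>+z. (\<integral>\<^sup>+\<omega>. f (add_point z \<omega>, z) \<partial>P) * indicator (below (real c)) z \<partial>\<Lambda>)"
    by (simp add: mecke_below[OF f])
  also have "\<dots> = (\<integral>\<^sup>+z. \<integral>\<^sup>+\<omega>. f (add_point z \<omega>, z) \<partial>P \<partial>\<Lambda>)"
    by (intro nn_integral_SUP_below[symmetric] measurable_below_section measurable_nn_integral_add_point f)
  finally show ?thesis .
qed

end

text \<open>Only an inequality, since \<open>a\<close> may already belong to \<open>A\<close>. It
  suffices for upper bounds and avoids showing that an inserted point is almost surely new.\<close>

lemma nn_integral_count_space_insert_le:
  "(\<integral>\<^sup>+x. f x \<partial>count_space (insert a A)) \<le> f a + (\<integral>\<^sup>+x. f x \<partial>count_space A)"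
proof -
  have "(\<integral>\<^sup>+x. f x \<partial>count_space (insert a A)) = (\<integral>\<^sup>+x. f x * indicator (insert a A) x \<partial>count_space UNIV)"
    by (simp add: nn_integral_count_space_indicator)
  also have "\<dots> \<le> (\<integral>\<^sup>+x. f x * indicator {a} x + f x * indicator A x \<partial>count_space UNIV)"
    by (intro nn_integral_mono) (auto split: split_indicator)
  also have "\<dots> = f a + (\<integral>\<^sup>+x. f x \<partial>count_space A)"
    by (subst nn_integral_add) (auto simp: nn_integral_count_space_indicator)
  finally show ?thesis .
qed

section \<open>Second moments along an exploration\<close>

text \<open>When \<open>C\<close> is asymmetric, at most one of two points can obstruct the other; this is what makes
  the off-diagonal terms of the variance cancel.\<close>

definition clear :: "(real \<times> real \<Rightarrow> (real \<times> real) set) \<Rightarrow> config \<Rightarrow> real \<times> real \<Rightarrow> ennreal" where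
  "clear C \<omega> z = of_bool (\<omega> \<inter> C z = {})"

text \<open>Emptiness of the moving region is a vanishing count, and that count is a sum over the
  points of a jointly measurable indicator.\<close>

lemma measurable_clear:
  assumes sets_C: "{(z, z'). z' \<in> C z} \<in> sets (borel \<Otimes>\<^sub>M borel)"
    and T: "T \<in> measurable M config_space" and g: "g \<in> measurable M borel"
  shows "(\<lambda>m. clear C (T m) (g m)) \<in> borel_measurable M"
proof -
  have "(\<lambda>x. (g (fst x), snd x)) \<in> measurable (M \<Otimes>\<^sub>M borel) (borel \<Otimes>\<^sub>M borel)"
    by (intro measurable_Pair measurable_compose[OF measurable_fst g] measurable_snd)
  from measurable_compose[OF this borel_measurable_indicator[OF sets_C]]
  have m: "(\<lambda>m. \<integral>\<^sup>+z. indicator {(z, z'). z' \<in> C z} (g m, z) \<partial>count_space (T m)) \<in> borel_measurable M"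
    (is "?N \<in> _") using measurable_nn_integral_points[OF T] by fastforce
  have "?N m = num_points (C (g m)) (T m)" for m
    unfolding num_points_eq_nn_integral by (intro nn_integral_cong) (simp add: indicator_def)
  then have "clear C (T m) (g m) = indicator {0} (?N m)" for m
    by (simp add: clear_def num_points_eq_0_iff indicator_def)
  moreover have "(\<lambda>m. indicator {0} (?N m) :: ennreal) \<in> borel_measurable M"
    by (rule measurable_compose[OF m]) simp
  ultimately show ?thesis
    by simp
qed

text \<open>With the cone below \<open>z\<close> as \<open>C z\<close>, the contributing points are
  those not above the graph of the maximum-likelihood estimator, that is, the points in the bias
  correction of \<open>F_hat\<close>.\<close>

definition explored_sum ::
    "(real \<times> real \<Rightarrow> (real \<times> real) set) \<Rightarrow> (real \<times> real \<Rightarrow> ennreal) \<Rightarrow> config \<Rightarrow> ennreal" where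
  "explored_sum C h \<omega> = (\<integral>\<^sup>+z. h z * clear C \<omega> z \<partial>count_space \<omega>)"

lemma measurable_explored_sum:
  assumes "{(z, z'). z' \<in> C z} \<in> sets (borel \<Otimes>\<^sub>M borel)" and "h \<in> borel_measurable borel"
    and "T \<in> measurable M config_space"
  shows "(\<lambda>m. explored_sum C h (T m)) \<in> borel_measurable M"
  unfolding explored_sum_def
  by (rule measurable_nn_integral_points[OF assms(3), where f="\<lambda>x. h (snd x) * clear C (T (fst x)) (snd x)", simplified])
     (intro borel_measurable_times_ennreal measurable_compose[OF measurable_snd assms(2)]
       measurable_clear[OF assms(1)] measurable_snd measurable_compose[OF measurable_fst assms(3)])

text \<open>\<open>C z\<close> is the region whose points hide \<open>z\<close>. The height bound
  gives it finite intensity, hence an exponential void probability.\<close>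

locale exploration = poisson_process +
  fixes C :: "real \<times> real \<Rightarrow> (real \<times> real) set"
  assumes sets_C: "{(z, z'). z' \<in> C z} \<in> sets (borel \<Otimes>\<^sub>M borel)"
    and asym_C: "z' \<in> C z \<Longrightarrow> z \<notin> C z'"
    and C_below: "C z \<subseteq> below (snd z)"
begin

lemma irrefl_C: "z \<notin> C z"
  using asym_C by blast

lemma borel_C: "C z \<in> sets borel"
  using sets_Pair1[OF sets_C, of z] by simp

lemma measurable_unobstructed:
  assumes "f \<in> measurable M borel" "g \<in> measurable M borel"
  shows "(\<lambda>m. of_bool (g m \<notin> C (f m)) :: ennreal) \<in> borel_measurable M"
proof -
  have "(\<lambda>m. (f m, g m)) \<in> measurable M (borel \<Otimes>\<^sub>M borel)"
    using assms by (rule measurable_Pair)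
  from measurable_compose[OF this borel_measurable_indicator[OF sets.compl_sets[OF sets_C]]]
  have "(\<lambda>m. indicator (space (borel \<Otimes>\<^sub>M borel) - {(z, z'). z' \<in> C z}) (f m, g m) :: ennreal)
      \<in> borel_measurable M" .
  then show ?thesis
    by (simp add: indicator_def space_pair_measure of_bool_def)
qed

lemma clear_add_point:
  "z' \<in> strip \<Longrightarrow> clear C (add_point z' \<omega>) z = clear C \<omega> z * of_bool (z' \<notin> C z)"
  by (simp add: clear_def add_point_Int_empty_iff)

lemma clear_le_1: "clear C \<omega> z \<le> 1"
  by (simp add: clear_def)

lemma nn_integral_clear: "(\<integral>\<^sup>+\<omega>. clear C \<omega> z \<partial>P) = emeasure P (void_event (C z))"
proof -
  have "(\<integral>\<^sup>+\<omega>. clear C \<omega> z \<partial>P) = (\<integral>\<^sup>+\<omega>. indicator (void_event (C z)) \<omega> \<partial>P)"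
    by (intro nn_integral_cong) (simp add: clear_def void_event_def indicator_def space_P)
  then show ?thesis
    using sets_void_event[OF borel_C[of z]] by (simp add: sets_P)
qed

text \<open>The compensator of \<open>explored_sum C h\<close>: since no \<open>z\<close> hides
  itself, inserting \<open>z\<close> does not change whether it is clear, and by the Mecke formula
  both have the same mean.\<close>

definition explored_integral :: "(real \<times> real \<Rightarrow> ennreal) \<Rightarrow> config \<Rightarrow> ennreal" where
  "explored_integral h \<omega> = (\<integral>\<^sup>+z. h z * clear C \<omega> z \<partial>\<Lambda>)"

lemma id_config: "(\<lambda>\<omega>. \<omega>) \<in> measurable P config_space"
  by (simp cong: measurable_cong_sets[OF sets_P])

lemma measurable_clear_section: "(\<lambda>\<omega>. clear C \<omega> z) \<in> borel_measurable P"
  by (intro measurable_clear[OF sets_C] id_config) simp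

lemma fst_borel: "fst \<in> measurable (\<Lambda> \<Otimes>\<^sub>M \<Lambda>) borel"
  and snd_borel: "snd \<in> measurable (\<Lambda> \<Otimes>\<^sub>M \<Lambda>) borel"
  using measurable_fst[of \<Lambda> \<Lambda>] measurable_snd[of \<Lambda> \<Lambda>]
  by (simp_all add: measurable_cong_sets[OF refl sets_intensity])

lemma fst_config: "fst \<in> measurable (P \<Otimes>\<^sub>M \<Lambda>) config_space"
  and snd_borel': "snd \<in> measurable (P \<Otimes>\<^sub>M \<Lambda>) borel"
  using measurable_fst[of P \<Lambda>] measurable_snd[of P \<Lambda>]
  by (simp_all add: measurable_cong_sets[OF refl sets_intensity] measurable_cong_sets[OF refl sets_P])

lemma id_intensity: "(\<lambda>z. z) \<in> measurable \<Lambda> borel"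
  by (simp cong: measurable_cong_sets[OF sets_intensity])

context
  fixes h :: "real \<times> real \<Rightarrow> ennreal"
  assumes h: "h \<in> borel_measurable borel"
begin

lemma measurable_h: "g \<in> measurable M borel \<Longrightarrow> (\<lambda>m. h (g m)) \<in> borel_measurable M"
  by (rule measurable_compose[OF _ h])

lemma measurable_explored_integral:
  assumes "T \<in> measurable M config_space"
  shows "(\<lambda>m. explored_integral h (T m)) \<in> borel_measurable M"
proof -
  have "(\<lambda>x. h (snd x) * clear C (T (fst x)) (snd x)) \<in> borel_measurable (M \<Otimes>\<^sub>M \<Lambda>)"
    by (intro borel_measurable_times_ennreal measurable_h measurable_clear[OF sets_C]
       measurable_compose[OF measurable_fst assms] measurable_snd[of M \<Lambda>, unfolded measurable_cong_sets[OF refl sets_intensity]])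
  then show ?thesis
    unfolding explored_integral_def
    by (intro intensity.borel_measurable_nn_integral) (simp add: case_prod_beta)
qed

text \<open>The common kernel of the three second moments. Off the diagonal, sum times sum, sum
  times integral and integral times integral differ only in the obstruction indicators that multiply
  it.\<close>

definition pair_term :: "real \<times> real \<Rightarrow> real \<times> real \<Rightarrow> ennreal" where
  "pair_term z z' = (\<integral>\<^sup>+\<omega>. h z * clear C \<omega> z * (h z' * clear C \<omega> z') \<partial>P)"

lemma pair_term_commute: "pair_term z z' = pair_term z' z"
  unfolding pair_term_def by (simp add: mult.commute)

lemma measurable_pair_term:
  assumes f: "f \<in> measurable M borel" and g: "g \<in> measurable M borel"
  shows "(\<lambda>m. pair_term (f m) (g m)) \<in> borel_measurable M"
proof -
  note f' = measurable_compose[OF measurable_fst f] and g' = measurable_compose[OF measurable_fst g]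
  have "(\<lambda>x. h (f (fst x)) * clear C (snd x) (f (fst x)) * (h (g (fst x)) * clear C (snd x) (g (fst x))))
      \<in> borel_measurable (M \<Otimes>\<^sub>M P)"
    by (intro borel_measurable_times_ennreal measurable_h measurable_clear[OF sets_C] f' g'
        measurable_snd[of M P, unfolded measurable_cong_sets[OF refl sets_P]])
  then show ?thesis
    unfolding pair_term_def
    by (intro sigma_finite_measure.borel_measurable_nn_integral[OF prob_space_imp_sigma_finite[OF prob_space_axioms]])
       (simp add: case_prod_beta)
qed

text \<open>No point is inserted here, only integrals are exchanged, so no obstruction indicator
  appears.\<close>

lemma nn_integral_explored_integral_sq:
  "(\<integral>\<^sup>+\<omega>. explored_integral h \<omega> * explored_integral h \<omega> \<partial>P) = (\<integral>\<^sup>+z. \<integral>\<^sup>+z'. pair_term z z' \<partial>\<Lambda> \<partial>\<Lambda>)"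
proof -
  have m: "(\<lambda>z. h z * clear C \<omega> z) \<in> borel_measurable \<Lambda>" if "\<omega> \<in> configs" for \<omega>
    using that by (intro borel_measurable_times_ennreal measurable_h measurable_clear[OF sets_C] id_intensity) simp
  have "(\<integral>\<^sup>+\<omega>. explored_integral h \<omega> * explored_integral h \<omega> \<partial>P)
      = (\<integral>\<^sup>+\<omega>. \<integral>\<^sup>+z. h z * clear C \<omega> z * explored_integral h \<omega> \<partial>\<Lambda> \<partial>P)"
    by (intro nn_integral_cong) (simp add: explored_integral_def nn_integral_multc m space_P)
  also have "\<dots> = (\<integral>\<^sup>+z. \<integral>\<^sup>+\<omega>. h z * clear C \<omega> z * explored_integral h \<omega> \<partial>P \<partial>\<Lambda>)"
    by (intro pair.Fubini'[symmetric])
       (unfold split_beta', intro borel_measurable_times_ennreal measurable_h measurable_clear[OF sets_C]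
         measurable_explored_integral fst_config snd_borel')
  also have "\<dots> = (\<integral>\<^sup>+z. \<integral>\<^sup>+\<omega>. \<integral>\<^sup>+z'. h z * clear C \<omega> z * (h z' * clear C \<omega> z') \<partial>\<Lambda> \<partial>P \<partial>\<Lambda>)"
    by (intro nn_integral_cong) (simp add: explored_integral_def nn_integral_cmult m space_P)
  also have "\<dots> = (\<integral>\<^sup>+z. \<integral>\<^sup>+z'. pair_term z z' \<partial>\<Lambda> \<partial>\<Lambda>)"
    unfolding pair_term_def
    by (intro nn_integral_cong pair.Fubini'[symmetric])
       (unfold split_beta', intro borel_measurable_times_ennreal measurable_h measurable_clear[OF sets_C]
         fst_config snd_borel' measurable_const, simp_all)
  finally show ?thesis .
qed

text \<open>The Mecke formula inserts \<open>z\<close>, which leaves \<open>z\<close> clear but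
  removes the contribution of every \<open>z'\<close> that is hidden by \<open>z\<close>. This costs
  the one indicator.\<close>

lemma nn_integral_explored_sum_integral:
  "(\<integral>\<^sup>+\<omega>. explored_sum C h \<omega> * explored_integral h \<omega> \<partial>P)
    = (\<integral>\<^sup>+z. \<integral>\<^sup>+z'. pair_term z z' * of_bool (z \<notin> C z') \<partial>\<Lambda> \<partial>\<Lambda>)"
proof -
  have "(\<integral>\<^sup>+\<omega>. explored_sum C h \<omega> * explored_integral h \<omega> \<partial>P)
      = (\<integral>\<^sup>+\<omega>. \<integral>\<^sup>+z. h z * clear C \<omega> z * explored_integral h \<omega> \<partial>count_space \<omega> \<partial>P)"
    by (intro nn_integral_cong) (simp add: explored_sum_def nn_integral_multc)
  also have "\<dots> = (\<integral>\<^sup>+z. \<integral>\<^sup>+\<omega>. h z * clear C (add_point z \<omega>) z * explored_integral h (add_point z \<omega>) \<partial>P \<partial>\<Lambda>)"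
    by (rule mecke[where f="\<lambda>(\<omega>, z). h z * clear C \<omega> z * explored_integral h \<omega>", simplified])
       (unfold split_beta', intro borel_measurable_times_ennreal measurable_h measurable_clear[OF sets_C]
         measurable_explored_integral measurable_fst measurable_snd)
  also have "\<dots> = (\<integral>\<^sup>+z. \<integral>\<^sup>+z'. pair_term z z' * of_bool (z \<notin> C z') \<partial>\<Lambda> \<partial>\<Lambda>)"
  proof (intro nn_integral_cong_AE, use AE_strip in eventually_elim)
    fix z assume z: "z \<in> strip"
    have m: "(\<lambda>z'. h z' * clear C \<omega> z' * of_bool (z \<notin> C z')) \<in> borel_measurable \<Lambda>" if "\<omega> \<in> configs" for \<omega>
      using that by (intro borel_measurable_times_ennreal measurable_h measurable_clear[OF sets_C] measurable_unobstructed id_intensity) simp_all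
    have "(\<integral>\<^sup>+\<omega>. h z * clear C (add_point z \<omega>) z * explored_integral h (add_point z \<omega>) \<partial>P)
        = (\<integral>\<^sup>+\<omega>. \<integral>\<^sup>+z'. h z * clear C \<omega> z * (h z' * clear C \<omega> z' * of_bool (z \<notin> C z')) \<partial>\<Lambda> \<partial>P)"
      by (intro nn_integral_cong, subst nn_integral_cmult[OF m])
         (simp_all add: clear_add_point[OF z] explored_integral_def irrefl_C space_P mult.assoc)
    also have "\<dots> = (\<integral>\<^sup>+z'. \<integral>\<^sup>+\<omega>. h z * clear C \<omega> z * (h z' * clear C \<omega> z' * of_bool (z \<notin> C z')) \<partial>P \<partial>\<Lambda>)"
      by (intro pair.Fubini'[symmetric])
         (unfold split_beta', intro borel_measurable_times_ennreal measurable_h measurable_clear[OF sets_C] measurable_unobstructed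
           fst_config snd_borel' measurable_const, simp_all)
    also have "\<dots> = (\<integral>\<^sup>+z'. pair_term z z' * of_bool (z \<notin> C z') \<partial>\<Lambda>)"
      unfolding pair_term_def
      by (intro nn_integral_cong, subst nn_integral_multc[symmetric])
         (auto intro!: borel_measurable_times_ennreal measurable_clear_section simp: mult.assoc)
    finally show "(\<integral>\<^sup>+\<omega>. h z * clear C (add_point z \<omega>) z * explored_integral h (add_point z \<omega>) \<partial>P)
        = (\<integral>\<^sup>+z'. pair_term z z' * of_bool (z \<notin> C z') \<partial>\<Lambda>)" .
  qed
  finally show ?thesis .
qed

text \<open>The Mecke formula is used twice. The diagonal yields the first term; for distinct
  inserted points each must leave the other one clear, whence both indicators.\<close>

lemma nn_integral_explored_sum_sq_le:
  "(\<integral>\<^sup>+\<omega>. explored_sum C h \<omega> * explored_sum C h \<omega> \<partial>P)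
    \<le> (\<integral>\<^sup>+z. (h z)\<^sup>2 * emeasure P (void_event (C z)) \<partial>\<Lambda>)
      + (\<integral>\<^sup>+z. \<integral>\<^sup>+z'. pair_term z z' * (of_bool (z' \<notin> C z) * of_bool (z \<notin> C z')) \<partial>\<Lambda> \<partial>\<Lambda>)"
proof -
  let ?F = "\<lambda>z \<omega> z'. h z * clear C \<omega> z * (h z' * clear C \<omega> z' * of_bool (z \<notin> C z'))"
  let ?p = "\<lambda>z z'. pair_term z z' * (of_bool (z' \<notin> C z) * of_bool (z \<notin> C z'))"
  have mF: "(\<lambda>x. ?F z (fst x) (snd x)) \<in> borel_measurable (config_space \<Otimes>\<^sub>M borel)" for z
    by (intro borel_measurable_times_ennreal measurable_h measurable_clear[OF sets_C] measurable_unobstructed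
        measurable_fst measurable_snd measurable_const) simp_all
  have mp: "(\<lambda>z. \<integral>\<^sup>+z'. ?p z z' \<partial>\<Lambda>) \<in> borel_measurable \<Lambda>"
    by (rule intensity.borel_measurable_nn_integral)
       (unfold split_beta', intro borel_measurable_times_ennreal measurable_pair_term measurable_unobstructed fst_borel snd_borel)
  have mq: "(\<lambda>z. (h z)\<^sup>2 * emeasure P (void_event (C z))) \<in> borel_measurable \<Lambda>"
  proof -
    have "(\<lambda>z. \<integral>\<^sup>+\<omega>. clear C \<omega> z \<partial>P) \<in> borel_measurable \<Lambda>"
      by (intro sigma_finite_measure.borel_measurable_nn_integral[OF prob_space_imp_sigma_finite[OF prob_space_axioms]])
         (unfold split_beta', intro measurable_clear[OF sets_C]
           measurable_snd[of \<Lambda> P, unfolded measurable_cong_sets[OF refl sets_P]]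
           measurable_fst[of \<Lambda> P, unfolded measurable_cong_sets[OF refl sets_intensity]])
    then show ?thesis
      unfolding nn_integral_clear power2_eq_square by (intro borel_measurable_times_ennreal measurable_h id_intensity)
  qed
  have "(\<integral>\<^sup>+\<omega>. explored_sum C h \<omega> * explored_sum C h \<omega> \<partial>P)
      = (\<integral>\<^sup>+\<omega>. \<integral>\<^sup>+z. h z * clear C \<omega> z * explored_sum C h \<omega> \<partial>count_space \<omega> \<partial>P)"
    by (intro nn_integral_cong) (simp add: explored_sum_def nn_integral_multc)
  also have "\<dots> = (\<integral>\<^sup>+z. \<integral>\<^sup>+\<omega>. h z * clear C (add_point z \<omega>) z * explored_sum C h (add_point z \<omega>) \<partial>P \<partial>\<Lambda>)"
    by (rule mecke[where f="\<lambda>(\<omega>, z). h z * clear C \<omega> z * explored_sum C h \<omega>", simplified])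
       (unfold split_beta', intro borel_measurable_times_ennreal measurable_h measurable_clear[OF sets_C]
         measurable_explored_sum[OF sets_C h] measurable_fst measurable_snd)
  also have "\<dots> \<le> (\<integral>\<^sup>+z. (h z)\<^sup>2 * emeasure P (void_event (C z)) + (\<integral>\<^sup>+z'. ?p z z' \<partial>\<Lambda>) \<partial>\<Lambda>)"
  proof (intro nn_integral_mono_AE, use AE_strip in eventually_elim)
    fix z assume z: "z \<in> strip"
    \<comment> \<open>The inserted point contributes its own term, which becomes the diagonal after
      bounding one of its two clearness factors by 1; the remaining points survive only if
      \<open>z\<close> does not hide them.\<close>
    have bound: "h z * clear C (add_point z \<omega>) z * explored_sum C h (add_point z \<omega>)
        \<le> (h z)\<^sup>2 * clear C \<omega> z + (\<integral>\<^sup>+z'. ?F z \<omega> z' \<partial>count_space \<omega>)" for \<omega>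
    proof -
      have "explored_sum C h (add_point z \<omega>)
          \<le> h z * clear C (add_point z \<omega>) z + (\<integral>\<^sup>+z'. h z' * clear C (add_point z \<omega>) z' \<partial>count_space \<omega>)"
        unfolding explored_sum_def using z nn_integral_count_space_insert_le[where a=z and A=\<omega>]
        by (simp add: add_point_def)
      also have "\<dots> \<le> h z + (\<integral>\<^sup>+z'. h z' * clear C \<omega> z' * of_bool (z \<notin> C z') \<partial>count_space \<omega>)"
        using mult_left_mono[OF clear_le_1, of "h z"]
        by (intro add_mono) (simp_all add: clear_add_point[OF z] mult.assoc)
      finally have "h z * clear C \<omega> z * explored_sum C h (add_point z \<omega>) \<le> h z * clear C \<omega> z *
          (h z + (\<integral>\<^sup>+z'. h z' * clear C \<omega> z' * of_bool (z \<notin> C z') \<partial>count_space \<omega>))"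
        by (rule mult_left_mono) simp
      also have "\<dots> = (h z)\<^sup>2 * clear C \<omega> z + (\<integral>\<^sup>+z'. ?F z \<omega> z' \<partial>count_space \<omega>)"
        by (subst nn_integral_cmult) (auto simp: distrib_left power2_eq_square mult_ac)
      finally show ?thesis
        by (simp add: clear_add_point[OF z] irrefl_C)
    qed
    have mS: "(\<lambda>\<omega>. \<integral>\<^sup>+z'. ?F z \<omega> z' \<partial>count_space \<omega>) \<in> borel_measurable P"
      using measurable_nn_integral_points[OF measurable_ident[unfolded id_def] mF[of z]]
      by (simp cong: measurable_cong_sets[OF sets_P])
    have "(\<integral>\<^sup>+\<omega>. h z * clear C (add_point z \<omega>) z * explored_sum C h (add_point z \<omega>) \<partial>P)
        \<le> (\<integral>\<^sup>+\<omega>. (h z)\<^sup>2 * clear C \<omega> z + (\<integral>\<^sup>+z'. ?F z \<omega> z' \<partial>count_space \<omega>) \<partial>P)"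
      by (intro nn_integral_mono bound)
    also have "\<dots> = (h z)\<^sup>2 * emeasure P (void_event (C z)) + (\<integral>\<^sup>+\<omega>. \<integral>\<^sup>+z'. ?F z \<omega> z' \<partial>count_space \<omega> \<partial>P)"
      using mS measurable_clear_section by (simp add: nn_integral_add nn_integral_cmult nn_integral_clear)
    also have "(\<integral>\<^sup>+\<omega>. \<integral>\<^sup>+z'. ?F z \<omega> z' \<partial>count_space \<omega> \<partial>P) = (\<integral>\<^sup>+z'. \<integral>\<^sup>+\<omega>. ?F z (add_point z' \<omega>) z' \<partial>P \<partial>\<Lambda>)"
      using mecke[OF mF[of z]] by simp
    also have "\<dots> = (\<integral>\<^sup>+z'. ?p z z' \<partial>\<Lambda>)"
    proof (intro nn_integral_cong_AE, use AE_strip in eventually_elim)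
      fix z' assume z': "z' \<in> strip"
      show "(\<integral>\<^sup>+\<omega>. ?F z (add_point z' \<omega>) z' \<partial>P) = ?p z z'"
        unfolding pair_term_def
        by (subst nn_integral_multc[symmetric])
           (auto intro!: borel_measurable_times_ennreal measurable_clear_section nn_integral_cong
             simp: clear_add_point[OF z'] irrefl_C mult_ac)
    qed
    finally show "(\<integral>\<^sup>+\<omega>. h z * clear C (add_point z \<omega>) z * explored_sum C h (add_point z \<omega>) \<partial>P)
        \<le> (h z)\<^sup>2 * emeasure P (void_event (C z)) + (\<integral>\<^sup>+z'. ?p z z' \<partial>\<Lambda>)" .
  qed
  also have "\<dots> = (\<integral>\<^sup>+z. (h z)\<^sup>2 * emeasure P (void_event (C z)) \<partial>\<Lambda>) + (\<integral>\<^sup>+z. \<integral>\<^sup>+z'. ?p z z' \<partial>\<Lambda> \<partial>\<Lambda>)"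
    by (intro nn_integral_add mp mq)
  finally show ?thesis .
qed

text \<open>Let \<open>a\<close> and \<open>b\<close> indicate that \<open>z\<close> does not hide
  \<open>z'\<close>, and conversely. Off the diagonal the square of the deviation carries the factor
  \<open>a * b + 1 - a - b = (1 - a) * (1 - b)\<close>, which vanishes because two points cannot
  hide each other. In \<open>ennreal\<close> the mixed moments stay on the left until they can be
  cancelled.\<close>

lemma nn_integral_explored_deviation_sq_finite:
  assumes fin: "(\<integral>\<^sup>+z. h z \<partial>\<Lambda>) < \<infinity>"
  shows "(\<integral>\<^sup>+\<omega>. ennreal ((enn2real (explored_sum C h \<omega>) - enn2real (explored_integral h \<omega>))\<^sup>2) \<partial>P)
    \<le> (\<integral>\<^sup>+z. (h z)\<^sup>2 * emeasure P (void_event (C z)) \<partial>\<Lambda>)"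
    (is "?D \<le> ?V")
proof -
  let ?S = "explored_sum C h" and ?I = "explored_integral h"
  let ?SI = "\<integral>\<^sup>+\<omega>. ?S \<omega> * ?I \<omega> \<partial>P"
  let ?a = "\<lambda>z z'. of_bool (z' \<notin> C z) :: ennreal"
  have m: "(\<lambda>x. pair_term (fst x) (snd x) * ?a (fst x) (snd x)) \<in> borel_measurable (\<Lambda> \<Otimes>\<^sub>M \<Lambda>)"
    "(\<lambda>x. pair_term (fst x) (snd x) * ?a (snd x) (fst x)) \<in> borel_measurable (\<Lambda> \<Otimes>\<^sub>M \<Lambda>)"
    "(\<lambda>x. pair_term (fst x) (snd x) * (?a (fst x) (snd x) * ?a (snd x) (fst x))) \<in> borel_measurable (\<Lambda> \<Otimes>\<^sub>M \<Lambda>)"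
    "(\<lambda>x. pair_term (fst x) (snd x)) \<in> borel_measurable (\<Lambda> \<Otimes>\<^sub>M \<Lambda>)"
    by (intro borel_measurable_times_ennreal measurable_pair_term measurable_unobstructed fst_borel snd_borel)+
  note prod = intensity.nn_integral_fst[OF m(1), simplified] intensity.nn_integral_fst[OF m(2), simplified]
    intensity.nn_integral_fst[OF m(3), simplified] intensity.nn_integral_fst[OF m(4), simplified]
  let ?\<Lambda>2 = "\<Lambda> \<Otimes>\<^sub>M \<Lambda>"
  have SI: "?SI = (\<integral>\<^sup>+x. pair_term (fst x) (snd x) * ?a (snd x) (fst x) \<partial>?\<Lambda>2)"
    unfolding nn_integral_explored_sum_integral by (rule prod(2))
  \<comment> \<open>Exchanging the two variables gives the mixed moment with the other indicator;
    its two copies are then written once with each.\<close>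
  have SI': "?SI = (\<integral>\<^sup>+x. pair_term (fst x) (snd x) * ?a (fst x) (snd x) \<partial>?\<Lambda>2)"
    unfolding nn_integral_explored_sum_integral
    by (subst intensity_pair.Fubini') (use m(1,2) in \<open>simp_all add: split_beta' pair_term_commute[of "_ :: real \<times> real"] prod(1)\<close>)
  note mS = measurable_explored_sum[OF sets_C h id_config] and mI = measurable_explored_integral[OF id_config]
  \<comment> \<open>The binomial formula without subtraction. For finite values it is an equality,
    and if a value is infinite the right side is \<open>top\<close>, so the convention for
    \<open>enn2real\<close> at infinity does no harm.\<close>
  have pw: "ennreal ((enn2real s - enn2real i)\<^sup>2) + (s * i + s * i) \<le> s * s + i * i" for s i :: ennreal
  proof (cases "s = \<infinity> \<or> i = \<infinity>")
    case True
    then have "s * s + i * i = top"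
      by (auto simp: ennreal_mult_top)
    then show ?thesis
      by (simp only: top_greatest)
  next
    case False
    then obtain a b where "s = ennreal a" "a \<ge> 0" "i = ennreal b" "b \<ge> 0"
      by (cases s; cases i) auto
    then show ?thesis
      by (simp add: ennreal_mult[symmetric] ennreal_plus[symmetric] del: ennreal_plus)
         (simp add: power2_eq_square algebra_simps)
  qed
  have "?D + (?SI + ?SI) = (\<integral>\<^sup>+\<omega>. ennreal ((enn2real (?S \<omega>) - enn2real (?I \<omega>))\<^sup>2)
      + (?S \<omega> * ?I \<omega> + ?S \<omega> * ?I \<omega>) \<partial>P)"
    using mS mI by (simp add: nn_integral_add)
  also have "\<dots> \<le> (\<integral>\<^sup>+\<omega>. ?S \<omega> * ?S \<omega> + ?I \<omega> * ?I \<omega> \<partial>P)"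
    by (intro nn_integral_mono pw)
  also have "\<dots> = (\<integral>\<^sup>+\<omega>. ?S \<omega> * ?S \<omega> \<partial>P) + (\<integral>\<^sup>+\<omega>. ?I \<omega> * ?I \<omega> \<partial>P)"
    using mS mI by (intro nn_integral_add) auto
  also have "\<dots> \<le> ?V + (\<integral>\<^sup>+x. pair_term (fst x) (snd x) * (?a (fst x) (snd x) * ?a (snd x) (fst x)) \<partial>?\<Lambda>2)
      + (\<integral>\<^sup>+x. pair_term (fst x) (snd x) \<partial>?\<Lambda>2)"
    unfolding prod(3,4)[symmetric] nn_integral_explored_integral_sq
    by (intro add_right_mono nn_integral_explored_sum_sq_le)
  also have "\<dots> = ?V + (\<integral>\<^sup>+x. pair_term (fst x) (snd x) * (?a (fst x) (snd x) * ?a (snd x) (fst x))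
      + pair_term (fst x) (snd x) \<partial>?\<Lambda>2)"
    by (simp only: nn_integral_add[OF m(3,4)] add.assoc)
  \<comment> \<open>Pointwise \<open>a * b + 1 \<le> a + b\<close> for the two indicators, since by
    asymmetry at least one of them equals 1.\<close>
  also have "\<dots> \<le> ?V + (\<integral>\<^sup>+x. pair_term (fst x) (snd x) * ?a (snd x) (fst x)
      + pair_term (fst x) (snd x) * ?a (fst x) (snd x) \<partial>?\<Lambda>2)"
  proof (intro add_left_mono nn_integral_mono)
    fix x :: "(real \<times> real) \<times> (real \<times> real)"
    show "pair_term (fst x) (snd x) * (?a (fst x) (snd x) * ?a (snd x) (fst x)) + pair_term (fst x) (snd x)
        \<le> pair_term (fst x) (snd x) * ?a (snd x) (fst x) + pair_term (fst x) (snd x) * ?a (fst x) (snd x)"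
      using asym_C[of "snd x" "fst x"] by (cases "snd x \<in> C (fst x)"; cases "fst x \<in> C (snd x)") simp_all
  qed
  also have "\<dots> = ?V + (?SI + ?SI)"
    by (simp only: nn_integral_add[OF m(2,1)] SI[symmetric] SI'[symmetric])
  finally have "?D + (?SI + ?SI) \<le> ?V + (?SI + ?SI)" .
  \<comment> \<open>Integrability of \<open>h\<close> enters here: it bounds the mixed moment by the
    square of its integral and permits the cancellation.\<close>
  moreover have "?SI \<noteq> \<infinity>"
  proof -
    have "?SI \<le> (\<integral>\<^sup>+z. \<integral>\<^sup>+z'. h z * h z' \<partial>\<Lambda> \<partial>\<Lambda>)"
      unfolding nn_integral_explored_sum_integral
    proof (intro nn_integral_mono)
      fix z z'
      have "h z * clear C \<omega> z * (h z' * clear C \<omega> z') \<le> h z * 1 * (h z' * 1)" for \<omega>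
        by (intro mult_mono clear_le_1) auto
      then have "pair_term z z' \<le> (\<integral>\<^sup>+\<omega>. h z * h z' \<partial>P)"
        unfolding pair_term_def by (intro nn_integral_mono) simp
      then have "pair_term z z' \<le> h z * h z'"
        by (simp add: emeasure_space_1)
      then show "pair_term z z' * ?a z' z \<le> h z * h z'"
        by (auto simp: of_bool_def)
    qed
    also have "\<dots> = (\<integral>\<^sup>+z. h z \<partial>\<Lambda>) * (\<integral>\<^sup>+z. h z \<partial>\<Lambda>)"
      by (simp add: nn_integral_cmult nn_integral_multc measurable_h id_intensity)
    also have "\<dots> < \<infinity>"
      using fin by (simp add: ennreal_mult_less_top)
    finally show ?thesis
      by simp
  qed
  ultimately show ?thesis
    by (simp add: add.commute[of _ "?SI + ?SI"] ennreal_add_left_cancel_le ennreal_add_eq_top)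
qed

end

text \<open>A weight that grows with the height need not be integrable against an infinite
  intensity. The bound is applied to the truncated weights, for which it is uniform in the level,
  and Fatou's lemma passes to the limit.\<close>

lemma nn_integral_explored_deviation_sq_le:
  assumes h: "h \<in> borel_measurable borel"
    and fin: "\<And>c. (\<integral>\<^sup>+z. h z * indicator (below c) z \<partial>\<Lambda>) < \<infinity>"
    and AE: "AE \<omega> in P. explored_sum C h \<omega> < \<infinity> \<and> explored_integral h \<omega> < \<infinity>"
  shows "(\<integral>\<^sup>+\<omega>. ennreal ((enn2real (explored_sum C h \<omega>) - enn2real (explored_integral h \<omega>))\<^sup>2) \<partial>P)
    \<le> (\<integral>\<^sup>+z. (h z)\<^sup>2 * emeasure P (void_event (C z)) \<partial>\<Lambda>)"
    (is "?L \<le> ?V")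
proof -
  define hc where "hc = (\<lambda>(c::nat) z. h z * indicator (below (real c)) z)"
  define d where "d = (\<lambda>g \<omega>. ennreal ((enn2real (explored_sum C g \<omega>) - enn2real (explored_integral g \<omega>))\<^sup>2))"
  have hc: "hc c \<in> borel_measurable borel" for c
    unfolding hc_def by (intro borel_measurable_times_ennreal h borel_measurable_indicator sets_below)
  have d_meas: "d (hc c) \<in> borel_measurable P" for c
    unfolding d_def
    by (intro measurable_compose[OF _ measurable_ennreal] borel_measurable_power borel_measurable_diff
        borel_measurable_enn2real measurable_explored_sum[OF sets_C hc id_config]
        measurable_explored_integral[OF hc id_config])
  have bound: "(\<integral>\<^sup>+\<omega>. d (hc c) \<omega> \<partial>P) \<le> ?V" for c
  proof -
    have "(\<integral>\<^sup>+\<omega>. d (hc c) \<omega> \<partial>P) \<le> (\<integral>\<^sup>+z. (hc c z)\<^sup>2 * emeasure P (void_event (C z)) \<partial>\<Lambda>)"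
      unfolding d_def
      using fin by (intro nn_integral_explored_deviation_sq_finite[OF hc]) (simp add: hc_def)
    also have "\<dots> \<le> ?V"
      by (intro nn_integral_mono mult_right_mono) (auto simp: hc_def split: split_indicator)
    finally show ?thesis .
  qed
  \<comment> \<open>Almost sure finiteness of both quantities makes the difference of the real parts
    converge along with the truncated sums and integrals.\<close>
  have lim: "AE \<omega> in P. liminf (\<lambda>c. d (hc c) \<omega>) = d h \<omega>"
    using AE AE_space
  proof eventually_elim
    fix \<omega> assume fin: "explored_sum C h \<omega> < \<infinity> \<and> explored_integral h \<omega> < \<infinity>" and w: "\<omega> \<in> space P"
    have inc: "incseq (\<lambda>c z. hc c z * clear C \<omega> z)"
      by (auto simp: mono_def le_fun_def hc_def intro!: mult_right_mono mult_left_mono split: split_indicator)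
    have clear: "(\<lambda>z. clear C \<omega> z) \<in> borel_measurable \<Lambda>"
      using w by (intro measurable_clear[OF sets_C] id_intensity) (simp add: space_P)
    have trunc: "h z * clear C \<omega> z * indicator (below (real c)) z = hc c z * clear C \<omega> z" for c z
      by (simp add: hc_def mult_ac)
    have "explored_sum C h \<omega> = (SUP c. explored_sum C (hc c) \<omega>)"
      unfolding explored_sum_def trunc[symmetric] by (rule nn_integral_SUP_below) simp
    moreover have "incseq (\<lambda>c. explored_sum C (hc c) \<omega>)"
      using inc by (auto simp: mono_def le_fun_def explored_sum_def intro!: nn_integral_mono)
    ultimately have 1: "(\<lambda>c. explored_sum C (hc c) \<omega>) \<longlonglongrightarrow> explored_sum C h \<omega>"
      by (metis LIMSEQ_SUP)
    have "explored_integral h \<omega> = (SUP c. explored_integral (hc c) \<omega>)"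
      unfolding explored_integral_def trunc[symmetric]
    proof (rule nn_integral_SUP_below)
      show "(\<lambda>z. h z * clear C \<omega> z * indicator (below c) z) \<in> borel_measurable \<Lambda>" for c
        by (intro borel_measurable_times_ennreal clear measurable_h[OF h] id_intensity
            borel_measurable_indicator) (simp only: sets_intensity sets_below)
    qed
    moreover have "incseq (\<lambda>c. explored_integral (hc c) \<omega>)"
      using inc by (auto simp: mono_def le_fun_def explored_integral_def intro!: nn_integral_mono)
    ultimately have 2: "(\<lambda>c. explored_integral (hc c) \<omega>) \<longlonglongrightarrow> explored_integral h \<omega>"
      by (metis LIMSEQ_SUP)
    have enn2real: "(\<lambda>c. enn2real (f c)) \<longlonglongrightarrow> enn2real x" if "f \<longlonglongrightarrow> x" "x < \<infinity>" for f and x :: ennreal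
      using that by (cases x) (auto intro!: tendsto_enn2real)
    have "(\<lambda>c. d (hc c) \<omega>) \<longlonglongrightarrow> d h \<omega>"
      unfolding d_def using fin
      by (intro tendsto_ennrealI tendsto_power tendsto_diff enn2real 1 2) auto
    then show "liminf (\<lambda>c. d (hc c) \<omega>) = d h \<omega>"
      by (intro lim_imp_Liminf) auto
  qed
  have "?L = (\<integral>\<^sup>+\<omega>. liminf (\<lambda>c. d (hc c) \<omega>) \<partial>P)"
    by (rule nn_integral_cong_AE) (use lim in eventually_elim, simp add: d_def)
  also have "\<dots> \<le> liminf (\<lambda>c. \<integral>\<^sup>+\<omega>. d (hc c) \<omega> \<partial>P)"
    by (rule nn_integral_liminf[OF d_meas])
  also have "\<dots> \<le> ?V"
    by (rule Liminf_le) (auto simp: bound)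
  finally show ?thesis .
qed

end

section \<open>The maximum-likelihood estimator and the functional estimator\<close>

text \<open>The inequality is strict so that \<open>z\<close> lies outside its own cone, and so that
  an empty cone corresponds to the weak inequality with which \<open>F_hat\<close> selects its
  points.\<close>

definition lower_cone :: "real \<Rightarrow> real \<Rightarrow> real \<times> real \<Rightarrow> (real \<times> real) set" where
  "lower_cone \<beta> R z = {z'. snd z' + R * \<bar>fst z - fst z'\<bar> powr \<beta> < snd z}"

lemma sets_lower_cone: "{(z, z'). z' \<in> lower_cone \<beta> R z} \<in> sets (borel \<Otimes>\<^sub>M borel)"
proof -
  have [measurable]: "(\<lambda>w. fst (fst w)) \<in> borel_measurable (borel :: ((real \<times> real) \<times> (real \<times> real)) measure)"
    "(\<lambda>w. snd (fst w)) \<in> borel_measurable (borel :: ((real \<times> real) \<times> (real \<times> real)) measure)"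
    "(\<lambda>w. fst (snd w)) \<in> borel_measurable (borel :: ((real \<times> real) \<times> (real \<times> real)) measure)"
    "(\<lambda>w. snd (snd w)) \<in> borel_measurable (borel :: ((real \<times> real) \<times> (real \<times> real)) measure)"
    by (intro borel_measurable_continuous_onI continuous_intros)+
  have "{w :: (real \<times> real) \<times> (real \<times> real).
      snd (snd w) + R * \<bar>fst (fst w) - fst (snd w)\<bar> powr \<beta> < snd (fst w)} \<in> sets borel"
    by measurable
  moreover have "{(z, z'). z' \<in> lower_cone \<beta> R z} = {w :: (real \<times> real) \<times> (real \<times> real).
      snd (snd w) + R * \<bar>fst (fst w) - fst (snd w)\<bar> powr \<beta> < snd (fst w)}"
    by (auto simp: lower_cone_def)
  ultimately show ?thesis
    by (simp only: borel_prod)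
qed

lemma configs_bdd_below:
  assumes "\<omega> \<in> configs"
  shows "\<exists>m. \<forall>z\<in>\<omega>. m \<le> snd z"
proof -
  have fin: "finite {z \<in> \<omega>. snd z \<le> 0}"
    using assms by (simp add: configs_def)
  let ?m = "Min (insert 0 (snd ` {z \<in> \<omega>. snd z \<le> 0}))"
  have "?m \<le> snd z" if "z \<in> \<omega>" for z
  proof (cases "snd z \<le> 0")
    case True
    then show ?thesis
      using fin that by (intro Min_le) auto
  next
    case False
    have "?m \<le> 0"
      using fin by (intro Min_le) auto
    then show ?thesis
      using False by linarith
  qed
  then show ?thesis
    by blast
qed

lemma config_fst: "\<omega> \<in> configs \<Longrightarrow> z \<in> \<omega> \<Longrightarrow> fst z \<in> {0..1}"
  by (auto simp: configs_def)

context
  fixes \<beta> R :: real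
  assumes \<beta>: "0 < \<beta>" and R: "0 < R"
begin

lemma lower_cone_asym: "z' \<in> lower_cone \<beta> R z \<Longrightarrow> z \<notin> lower_cone \<beta> R z'"
proof -
  have "0 \<le> R * \<bar>fst z - fst z'\<bar> powr \<beta>" "0 \<le> R * \<bar>fst z' - fst z\<bar> powr \<beta>"
    using R by simp_all
  then show "z' \<in> lower_cone \<beta> R z \<Longrightarrow> z \<notin> lower_cone \<beta> R z'"
    unfolding lower_cone_def mem_Collect_eq by linarith
qed

lemma lower_cone_below: "lower_cone \<beta> R z \<subseteq> below (snd z)"
proof
  fix z' assume "z' \<in> lower_cone \<beta> R z"
  moreover have "0 \<le> R * \<bar>fst z - fst z'\<bar> powr \<beta>"
    using R by simp
  ultimately have "snd z' \<le> snd z"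
    unfolding lower_cone_def mem_Collect_eq by linarith
  then show "z' \<in> below (snd z)"
    by (simp add: mem_Times_iff)
qed

text \<open>A bound below an infimum is a bound below all its members. The infimum needs a lower
  bound, supplied by finiteness below every level, and a nonempty set to be meaningful.\<close>

lemma le_mle_iff:
  assumes w: "\<omega> \<in> configs" "\<omega> \<noteq> {}"
  shows "y \<le> mle \<beta> R \<omega> x \<longleftrightarrow> \<omega> \<inter> lower_cone \<beta> R (x, y) = {}"
proof -
  obtain m where m: "\<And>z. z \<in> \<omega> \<Longrightarrow> m \<le> snd z"
    using configs_bdd_below[OF w(1)] by blast
  have "m \<le> snd z + R * \<bar>x - fst z\<bar> powr \<beta>" if "z \<in> \<omega>" for z
    using m[OF that] R by (simp add: add_increasing2)
  then have "bdd_below ((\<lambda>z. snd z + R * \<bar>x - fst z\<bar> powr \<beta>) ` \<omega>)"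
    by (auto intro!: bdd_belowI2[where m=m])
  then have "y \<le> mle \<beta> R \<omega> x \<longleftrightarrow> (\<forall>z\<in>\<omega>. y \<le> snd z + R * \<bar>x - fst z\<bar> powr \<beta>)"
    unfolding mle_def case_prod_beta by (rule le_cINF_iff[OF w(2)])
  then show ?thesis
    by (auto simp: lower_cone_def not_less disjoint_iff)
qed

lemma mle_le:
  assumes w: "\<omega> \<in> configs" and "z \<in> \<omega>"
  shows "mle \<beta> R \<omega> x \<le> snd z + R * \<bar>x - fst z\<bar> powr \<beta>"
proof -
  have "\<omega> \<noteq> {}"
    using assms by auto
  then have "\<omega> \<inter> lower_cone \<beta> R (x, mle \<beta> R \<omega> x) = {}"
    using le_mle_iff[OF w] by blast
  then show ?thesis
    using assms(2) by (auto simp: lower_cone_def not_less disjoint_iff)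
qed

lemma mle_le_on_unit_interval:
  assumes w: "\<omega> \<in> configs" and z: "z \<in> \<omega>" and x: "x \<in> {0..1}"
  shows "mle \<beta> R \<omega> x \<le> snd z + R"
proof -
  have "\<bar>x - fst z\<bar> \<le> 1"
    using config_fst[OF w z] x by (auto simp: abs_le_iff)
  then have "\<bar>x - fst z\<bar> powr \<beta> \<le> 1"
    using powr_mono2[of \<beta> "\<bar>x - fst z\<bar>" 1] \<beta> by simp
  then have "R * \<bar>x - fst z\<bar> powr \<beta> \<le> R"
    using R by (simp add: mult_left_le)
  then show ?thesis
    using mle_le[OF w z, of x] by linarith
qed

lemma le_mle:
  assumes "\<omega> \<in> configs" "\<omega> \<noteq> {}" and "\<And>z. z \<in> \<omega> \<Longrightarrow> m \<le> snd z + R * \<bar>x - fst z\<bar> powr \<beta>"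
  shows "m \<le> mle \<beta> R \<omega> x"
  unfolding le_mle_iff[OF assms(1,2)] using assms(3) by (fastforce simp: lower_cone_def)

lemma mle_bounded:
  assumes "\<omega> \<in> configs"
  shows "\<exists>K. \<forall>x\<in>{0..1}. \<bar>mle \<beta> R \<omega> x\<bar> \<le> K"
proof (cases "\<omega> = {}")
  case True
  then show ?thesis
    by (auto simp: mle_def)
next
  case False
  obtain m where m: "\<And>z. z \<in> \<omega> \<Longrightarrow> m \<le> snd z"
    using configs_bdd_below[OF assms] by blast
  obtain z where z: "z \<in> \<omega>"
    using False by auto
  have "\<bar>mle \<beta> R \<omega> x\<bar> \<le> \<bar>m\<bar> + \<bar>snd z + R\<bar>" if "x \<in> {0..1}" for x
  proof -
    have "m \<le> mle \<beta> R \<omega> x"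
      using m R by (intro le_mle[OF assms False]) (simp add: add_increasing2)
    then show ?thesis
      using mle_le_on_unit_interval[OF assms z that] by linarith
  qed
  then show ?thesis
    by blast
qed

text \<open>The superlevel sets of the estimator are events that a cone with moving apex is empty.
  The empty configuration is split off, since for it the estimator is an arbitrary but fixed
  value.\<close>

lemma measurable_mle:
  assumes T: "T \<in> measurable M config_space" and f: "f \<in> borel_measurable M"
  shows "(\<lambda>m. mle \<beta> R (T m) (f m)) \<in> borel_measurable M"
proof (rule borel_measurableI_ge)
  fix y :: real
  have Tc: "T m \<in> configs" if "m \<in> space M" for m
    using measurable_space[OF T that] by simp
  have fy: "(\<lambda>m. (f m, y)) \<in> measurable M borel"
    by (rule borel_measurable_Pair[OF f]) simp
  have 1: "{m \<in> space M. clear (lower_cone \<beta> R) (T m) (f m, y) = 1} \<in> sets M"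
    using measurable_clear[OF sets_lower_cone T fy] by measurable
  have 2: "{m \<in> space M. T m \<in> void_event UNIV} \<in> sets M"
    using measurable_sets[OF T sets_void_event[of UNIV]] by (simp add: vimage_def Int_def conj_commute)
  have 3: "{m \<in> space M. y \<le> mle \<beta> R {} (f m)} \<in> sets M"
    by (simp add: mle_def)
  have "y \<le> mle \<beta> R (T m) (f m) \<longleftrightarrow> T m \<in> void_event UNIV \<and> y \<le> mle \<beta> R {} (f m)
      \<or> T m \<notin> void_event UNIV \<and> clear (lower_cone \<beta> R) (T m) (f m, y) = 1" if "m \<in> space M" for m
    using Tc[OF that] by (cases "T m = {}") (simp_all add: void_event_def clear_def le_mle_iff)
  then have "{m \<in> space M. y \<le> mle \<beta> R (T m) (f m)}
      = ({m \<in> space M. T m \<in> void_event UNIV} \<inter> {m \<in> space M. y \<le> mle \<beta> R {} (f m)})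
        \<union> ({m \<in> space M. clear (lower_cone \<beta> R) (T m) (f m, y) = 1} - {m \<in> space M. T m \<in> void_event UNIV})"
    by blast
  also have "\<dots> \<in> sets M"
    using 1 2 3 by (intro sets.Un sets.Diff sets.Int)
  finally show "{m \<in> space M. y \<le> mle \<beta> R (T m) (f m)} \<in> sets M" .
qed

lemma mle_borel:
  assumes "\<omega> \<in> configs"
  shows "mle \<beta> R \<omega> \<in> borel_measurable borel"
  using measurable_mle[of "\<lambda>_. \<omega>" borel "\<lambda>x. x"] assms by simp

end

text \<open>The derivatives of the positive and negative part of \<open>\<bar>y\<bar> powr p\<close> are kept apart, so that all
  sums over configurations are sums of nonnegative terms.\<close>

definition contact_weight :: "real \<Rightarrow> real \<times> real \<Rightarrow> ennreal" where
  "contact_weight p z = ennreal (if snd z > 0 then p * snd z powr (p - 1) else 0)"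

definition contact_weight_neg :: "real \<Rightarrow> real \<times> real \<Rightarrow> ennreal" where
  "contact_weight_neg p z = contact_weight p (fst z, - snd z)"

lemma measurable_contact_weight: "contact_weight p \<in> borel_measurable borel"
  unfolding contact_weight_def[abs_def] borel_prod[symmetric] by measurable

lemma measurable_contact_weight_neg: "contact_weight_neg p \<in> borel_measurable borel"
  unfolding contact_weight_neg_def[abs_def] contact_weight_def borel_prod[symmetric] by measurable

lemma contact_weight_diff:
  "p \<ge> 1 \<Longrightarrow> enn2real (contact_weight p z) - enn2real (contact_weight_neg p z)
    = p * \<bar>snd z\<bar> powr (p - 1) * sgn (snd z)"
  by (auto simp: contact_weight_def contact_weight_neg_def sgn_if)

text \<open>The estimator is bounded on the unit interval, so all points in question lie below one
  level, and a configuration has finitely many of those.\<close>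

lemma clear_points:
  assumes "0 < \<beta>" "0 < R" and w: "\<omega> \<in> configs"
  shows "{z \<in> \<omega>. snd z \<le> mle \<beta> R \<omega> (fst z)} = {z \<in> \<omega>. \<omega> \<inter> lower_cone \<beta> R z = {}}"
    and "finite {z \<in> \<omega>. snd z \<le> mle \<beta> R \<omega> (fst z)}"
proof -
  show "{z \<in> \<omega>. snd z \<le> mle \<beta> R \<omega> (fst z)} = {z \<in> \<omega>. \<omega> \<inter> lower_cone \<beta> R z = {}}"
    using le_mle_iff[OF assms] by fastforce
  show "finite {z \<in> \<omega>. snd z \<le> mle \<beta> R \<omega> (fst z)}"
  proof -
    obtain K where K: "\<And>x. x \<in> {0..1} \<Longrightarrow> \<bar>mle \<beta> R \<omega> x\<bar> \<le> K"
      using mle_bounded[OF assms] by blast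
    have "{z \<in> \<omega>. snd z \<le> mle \<beta> R \<omega> (fst z)} \<subseteq> {z \<in> \<omega>. snd z \<le> K}"
    proof safe
      fix a b assume "(a, b) \<in> \<omega>" "snd (a, b) \<le> mle \<beta> R \<omega> (fst (a, b))"
      moreover have "a \<in> {0..1}"
        using config_fst[OF w \<open>(a, b) \<in> \<omega>\<close>] by simp
      ultimately show "snd (a, b) \<le> K"
        using K[of a] by simp
    qed
    then show ?thesis
      using w by (auto simp: configs_def intro: finite_subset)
  qed
qed

lemma explored_sum_eq:
  assumes "0 < \<beta>" "0 < R" and "\<omega> \<in> configs"
  shows "explored_sum (lower_cone \<beta> R) h \<omega> = (\<Sum>z\<in>{z \<in> \<omega>. snd z \<le> mle \<beta> R \<omega> (fst z)}. h z)"
  unfolding explored_sum_def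
  by (subst nn_integral_count_space'[OF clear_points(2)[OF assms]])
     (auto simp: clear_points(1)[OF assms] clear_def intro!: sum.cong)

lemma F_hat_eq:
  assumes "0 < \<beta>" "0 < R" "p \<ge> 1" and w: "\<omega> \<in> configs"
  shows "F_hat n \<beta> R p \<omega> = (LBINT x:{0..1}. \<bar>mle \<beta> R \<omega> x\<bar> powr p)
    - 1 / real n * (enn2real (explored_sum (lower_cone \<beta> R) (contact_weight p) \<omega>)
      - enn2real (explored_sum (lower_cone \<beta> R) (contact_weight_neg p) \<omega>))"
proof -
  have "enn2real (explored_sum (lower_cone \<beta> R) (contact_weight p) \<omega>)
      - enn2real (explored_sum (lower_cone \<beta> R) (contact_weight_neg p) \<omega>)
      = (\<Sum>z\<in>{z \<in> \<omega>. snd z \<le> mle \<beta> R \<omega> (fst z)}. p * \<bar>snd z\<bar> powr (p - 1) * sgn (snd z))"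
    unfolding explored_sum_eq[OF assms(1,2,4)] contact_weight_diff[OF assms(3), symmetric] sum_subtractf
    by (subst (1 2) enn2real_sum) (auto simp: contact_weight_def contact_weight_neg_def)
  moreover have "{(x, y) \<in> \<omega>. mle \<beta> R \<omega> x \<ge> y} = {z \<in> \<omega>. snd z \<le> mle \<beta> R \<omega> (fst z)}"
    by auto
  ultimately show ?thesis
    by (simp add: F_hat_def case_prod_beta)
qed

lemma measurable_F_hat:
  assumes "0 < \<beta>" "0 < R" "p \<ge> 1"
  shows "F_hat n \<beta> R p \<in> borel_measurable config_space"
proof -
  have id: "(\<lambda>\<omega>. \<omega>) \<in> measurable config_space config_space"
    by simp
  have 1: "(\<lambda>\<omega>. LBINT x:{0..1}. \<bar>mle \<beta> R \<omega> x\<bar> powr p) \<in> borel_measurable config_space"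
  proof -
    have [measurable]: "(\<lambda>x. mle \<beta> R (fst x) (snd x)) \<in> borel_measurable (config_space \<Otimes>\<^sub>M lborel)"
      by (intro measurable_mle[OF assms(1,2)] measurable_fst measurable_compose[OF measurable_snd]) simp
    show ?thesis
      unfolding set_lebesgue_integral_def
      by (intro lborel.borel_measurable_lebesgue_integral) (simp add: case_prod_beta)
  qed
  let ?s = "\<lambda>h \<omega>. enn2real (explored_sum (lower_cone \<beta> R) h \<omega>)"
  have 2: "?s (contact_weight p) \<in> borel_measurable config_space"
    "?s (contact_weight_neg p) \<in> borel_measurable config_space"
    by (rule measurable_compose[OF measurable_explored_sum[OF sets_lower_cone _ id] borel_measurable_enn2real[OF measurable_ident[unfolded id_def]]],
        rule measurable_contact_weight measurable_contact_weight_neg)+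
  then have "(\<lambda>\<omega>. ?s (contact_weight p) \<omega> - ?s (contact_weight_neg p) \<omega>) \<in> borel_measurable config_space"
    by (rule borel_measurable_diff)
  then have "(\<lambda>\<omega>. 1 / real n * (?s (contact_weight p) \<omega> - ?s (contact_weight_neg p) \<omega>)) \<in> borel_measurable config_space"
    by simp
  with 1 have "(\<lambda>\<omega>. (LBINT x:{0..1}. \<bar>mle \<beta> R \<omega> x\<bar> powr p)
      - 1 / real n * (?s (contact_weight p) \<omega> - ?s (contact_weight_neg p) \<omega>)) \<in> borel_measurable config_space"
    by (rule borel_measurable_diff)
  then show ?thesis
    by (subst measurable_cong[OF F_hat_eq[OF assms]]) simp_all
qed

lemma plugin_test_in_tests:
  assumes "0 < \<beta>" "0 < R" "p \<ge> 1"
  shows "plugin_test n \<beta> R p \<rho> \<in> tests"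
proof -
  have "{\<omega> \<in> space config_space. \<rho> powr p / 2 \<le> F_hat n \<beta> R p \<omega>} \<in> sets config_space"
    using measurable_F_hat[OF assms, of n] by measurable
  then have "(indicator {\<omega> \<in> space config_space. \<rho> powr p / 2 \<le> F_hat n \<beta> R p \<omega>} :: _ \<Rightarrow> real)
      \<in> borel_measurable config_space"
    by (rule borel_measurable_indicator)
  moreover have "plugin_test n \<beta> R p \<rho> \<omega>
      = indicator {\<omega> \<in> space config_space. \<rho> powr p / 2 \<le> F_hat n \<beta> R p \<omega>} \<omega>"
    if "\<omega> \<in> space config_space" for \<omega>
    using that by (simp add: plugin_test_def indicator_def)
  ultimately have "plugin_test n \<beta> R p \<rho> \<in> borel_measurable config_space"
    by (subst measurable_cong[where g="indicator {\<omega> \<in> space config_space. \<rho> powr p / 2 \<le> F_hat n \<beta> R p \<omega>}"])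
  then show ?thesis
    by (simp add: tests_def plugin_test_def)
qed

section \<open>The boundary model\<close>

text \<open>Membership in the Hoelder ball says nothing about \<open>g\<close> off the unit interval; the clamped version
  is continuous on the whole line.\<close>

definition clamped :: "(real \<Rightarrow> real) \<Rightarrow> real \<Rightarrow> real" where
  "clamped g x = g (max 0 (min 1 x))"

lemma clamped_eq: "x \<in> {0..1} \<Longrightarrow> clamped g x = g x"
  by (simp add: clamped_def)

lemma holder_ballD:
  "g \<in> holder_ball \<beta> R \<Longrightarrow> x \<in> {0..1} \<Longrightarrow> y \<in> {0..1} \<Longrightarrow> \<bar>g x - g y\<bar> \<le> R * \<bar>x - y\<bar> powr \<beta>"
  by (simp add: holder_ball_def)

lemma continuous_on_holder_ball:
  assumes "0 < \<beta>" "0 < R" and g: "g \<in> holder_ball \<beta> R"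
  shows "continuous_on {0..1} g"
proof (rule continuous_onI)
  fix x e :: real assume x: "x \<in> {0..1}" and "0 < e"
  define d where "d = (e / R) powr (1 / \<beta>)"
  show "\<exists>d>0. \<forall>x'\<in>{0..1}. dist x' x < d \<longrightarrow> dist (g x') (g x) \<le> e"
  proof (intro exI[of _ d] conjI ballI impI)
    show "0 < d"
      using \<open>0 < e\<close> \<open>0 < R\<close> by (simp add: d_def)
    fix x' assume x': "x' \<in> {0..1}" "dist x' x < d"
    have "\<bar>x' - x\<bar> powr \<beta> \<le> d powr \<beta>"
      using x' \<open>0 < \<beta>\<close> by (intro powr_mono2) (auto simp: dist_real_def)
    also have "\<dots> = e / R"
      using \<open>0 < \<beta>\<close> \<open>0 < e\<close> \<open>0 < R\<close> by (simp add: d_def powr_powr)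
    finally have "R * \<bar>x' - x\<bar> powr \<beta> \<le> e"
      using \<open>0 < R\<close> by (simp add: field_simps)
    then show "dist (g x') (g x) \<le> e"
      using holder_ballD[OF g x'(1) x] by (simp add: dist_real_def)
  qed
qed

lemma continuous_on_clamped: "continuous_on {0..1} g \<Longrightarrow> continuous_on UNIV (clamped g)"
  unfolding clamped_def
  by (rule continuous_on_compose2[where f="\<lambda>x. max 0 (min 1 x)"]) (auto intro!: continuous_intros)

lemma sets_epigraph:
  assumes "f \<in> borel_measurable borel"
  shows "{z. f (fst z) \<le> snd z} \<in> sets (borel :: (real \<times> real) measure)"
proof -
  have "(\<lambda>z. f (fst z)) \<in> borel_measurable (borel :: (real \<times> real) measure)"
    "snd \<in> borel_measurable (borel :: (real \<times> real) measure)"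
    by (intro measurable_compose[OF _ assms] borel_measurable_continuous_onI continuous_intros)+
  from borel_measurable_le[OF this] show ?thesis
    by simp
qed

lemma nn_integral_boundary_intensity:
  assumes g: "continuous_on {0..1} g" and f: "f \<in> borel_measurable borel"
  shows "(\<integral>\<^sup>+z. f z \<partial>boundary_intensity n g)
    = ennreal (real n) * (\<integral>\<^sup>+x\<in>{0..1}. (\<integral>\<^sup>+y\<in>{g x..}. f (x, y) \<partial>lborel) \<partial>lborel)"
proof -
  let ?E = "{z. clamped g (fst z) \<le> snd z}"
  have cg: "clamped g \<in> borel_measurable borel"
    by (intro borel_measurable_continuous_onI continuous_on_clamped g)
  have E: "?E \<in> sets borel"
    by (rule sets_epigraph[OF cg])
  have ind: "(\<lambda>z. ennreal (real n) * indicator strip z * indicator ?E z) \<in> borel_measurable borel"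
    by (intro borel_measurable_times_ennreal measurable_const borel_measurable_indicator E sets_strip) simp
  have eq: "(case z of (x, y) \<Rightarrow> ennreal (real n * of_bool (x \<in> {0..1} \<and> g x \<le> y)))
      = ennreal (real n) * indicator strip z * indicator ?E z" for z
    by (cases z) (auto simp: clamped_eq indicator_def)
  have "(\<integral>\<^sup>+z. f z \<partial>boundary_intensity n g)
      = (\<integral>\<^sup>+z. ennreal (real n) * indicator strip z * indicator ?E z * f z \<partial>lborel)"
    unfolding boundary_intensity_def eq using ind f by (intro nn_integral_density) auto
  also have "\<dots> = (\<integral>\<^sup>+z. ennreal (real n) * indicator strip z * indicator ?E z * f z \<partial>(lborel \<Otimes>\<^sub>M lborel))"
    by (simp only: lborel_prod)
  also have "\<dots> = (\<integral>\<^sup>+x. \<integral>\<^sup>+y. ennreal (real n) * indicator strip (x, y) * indicator ?E (x, y) * f (x, y) \<partial>lborel \<partial>lborel)"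
    using ind f by (intro lborel.nn_integral_fst[symmetric]) (simp add: lborel_prod)
  also have "\<dots> = (\<integral>\<^sup>+x. ennreal (real n) * ((\<integral>\<^sup>+y\<in>{g x..}. f (x, y) \<partial>lborel) * indicator {0..1} x) \<partial>lborel)"
  proof (intro nn_integral_cong)
    fix x :: real
    have fx: "(\<lambda>y. f (x, y)) \<in> borel_measurable borel"
      using f unfolding borel_prod[symmetric] by simp
    show "(\<integral>\<^sup>+y. ennreal (real n) * indicator strip (x, y) * indicator ?E (x, y) * f (x, y) \<partial>lborel)
        = ennreal (real n) * ((\<integral>\<^sup>+y\<in>{g x..}. f (x, y) \<partial>lborel) * indicator {0..1} x)"
    proof (cases "x \<in> {0..1}")
      case True
      then have "(\<integral>\<^sup>+y. ennreal (real n) * indicator strip (x, y) * indicator ?E (x, y) * f (x, y) \<partial>lborel)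
          = (\<integral>\<^sup>+y. ennreal (real n) * (f (x, y) * indicator {g x..} y) \<partial>lborel)"
        by (intro nn_integral_cong) (auto simp: clamped_eq indicator_def)
      also have "\<dots> = ennreal (real n) * (\<integral>\<^sup>+y\<in>{g x..}. f (x, y) \<partial>lborel)"
        using fx by (intro nn_integral_cmult) simp
      finally show ?thesis
        using True by simp
    qed (auto simp: indicator_def)
  qed
  also have "\<dots> = ennreal (real n) * (\<integral>\<^sup>+x\<in>{0..1}. (\<integral>\<^sup>+y\<in>{g x..}. f (x, y) \<partial>lborel) \<partial>lborel)"
  proof (rule nn_integral_cmult)
    have "(\<lambda>x. \<integral>\<^sup>+y. f (x, y) * indicator ?E (x, y) \<partial>lborel) \<in> borel_measurable borel"
    proof (rule lborel.borel_measurable_nn_integral)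
      have "(\<lambda>z. f z * indicator ?E z) \<in> borel_measurable (borel \<Otimes>\<^sub>M lborel)"
        using f E by (simp add: measurable_cong_sets[OF sets_pair_measure_cong[OF refl sets_lborel] refl] borel_prod)
      then show "(\<lambda>(x, y). f (x, y) * indicator ?E (x, y)) \<in> borel_measurable (borel \<Otimes>\<^sub>M lborel)"
        by (simp add: case_prod_beta)
    qed
    then have "(\<lambda>x. (\<integral>\<^sup>+y. f (x, y) * indicator ?E (x, y) \<partial>lborel) * indicator {0..1} x) \<in> borel_measurable lborel"
      by simp
    moreover have "(\<integral>\<^sup>+y. f (x, y) * indicator ?E (x, y) \<partial>lborel) * indicator {0..1} x
        = (\<integral>\<^sup>+y\<in>{g x..}. f (x, y) \<partial>lborel) * indicator {0..1} x" for x
      by (auto simp: clamped_eq indicator_def intro!: nn_integral_cong)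
    ultimately show "(\<lambda>x. (\<integral>\<^sup>+y\<in>{g x..}. f (x, y) \<partial>lborel) * indicator {0..1} x) \<in> borel_measurable lborel"
      by simp
  qed
  finally show ?thesis .
qed

lemma sets_boundary_intensity: "sets (boundary_intensity n g) = sets borel"
  by (simp add: boundary_intensity_def)

lemma emeasure_boundary_intensity:
  assumes g: "continuous_on {0..1} g" and B: "B \<in> sets borel"
  shows "emeasure (boundary_intensity n g) B
    = ennreal (real n) * (\<integral>\<^sup>+x\<in>{0..1}. emeasure lborel {y. g x \<le> y \<and> (x, y) \<in> B} \<partial>lborel)"
proof -
  have slice: "(\<integral>\<^sup>+y\<in>{g x..}. indicator B (x, y) \<partial>lborel) = emeasure lborel {y. g x \<le> y \<and> (x, y) \<in> B}" for x
  proof -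
    have "Pair x -` B \<in> sets borel"
      using B unfolding borel_prod[symmetric] by (rule sets_Pair1)
    then have "{y. g x \<le> y \<and> (x, y) \<in> B} \<in> sets borel"
      using sets.Int[of "{g x..}" borel "Pair x -` B"] by (simp add: Int_def)
    then have "emeasure lborel {y. g x \<le> y \<and> (x, y) \<in> B}
        = (\<integral>\<^sup>+y. indicator {y. g x \<le> y \<and> (x, y) \<in> B} y \<partial>lborel)"
      by simp
    also have "\<dots> = (\<integral>\<^sup>+y\<in>{g x..}. indicator B (x, y) \<partial>lborel)"
      by (intro nn_integral_cong) (auto simp: indicator_def)
    finally show ?thesis ..
  qed
  have "emeasure (boundary_intensity n g) B = (\<integral>\<^sup>+z. indicator B z \<partial>boundary_intensity n g)"
    using B by (simp add: sets_boundary_intensity)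
  also have "\<dots> = ennreal (real n) * (\<integral>\<^sup>+x\<in>{0..1}. (\<integral>\<^sup>+y\<in>{g x..}. indicator B (x, y) \<partial>lborel) \<partial>lborel)"
    using B by (intro nn_integral_boundary_intensity[OF g] borel_measurable_indicator)
  also have "\<dots> = ennreal (real n) * (\<integral>\<^sup>+x\<in>{0..1}. emeasure lborel {y. g x \<le> y \<and> (x, y) \<in> B} \<partial>lborel)"
    by (simp only: slice)
  finally show ?thesis .
qed

locale boundary_model =
  fixes \<beta> R :: real and n :: nat and g :: "real \<Rightarrow> real" and P :: "config measure"
  assumes \<beta>: "0 < \<beta>" and R: "0 < R" and n: "n \<ge> 1" and g: "g \<in> holder_ball \<beta> R"
    and boundary_law: "poisson_process_law (boundary_intensity n g) P"
begin

abbreviation intensity :: "(real \<times> real) measure" where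
  "intensity \<equiv> boundary_intensity n g"

lemma g_cont: "continuous_on {0..1} g"
  by (rule continuous_on_holder_ball[OF \<beta> R g])

lemma g_bounded: "x \<in> {0..1} \<Longrightarrow> \<bar>g x\<bar> \<le> \<bar>g 0\<bar> + R"
proof -
  assume x: "x \<in> {0..1}"
  then have "R * \<bar>x - 0\<bar> powr \<beta> \<le> R"
    using R \<beta> powr_mono2[of \<beta> x 1] by (simp add: mult_left_le)
  then show ?thesis
    using holder_ballD[OF g x, of 0] by simp
qed

text \<open>Growth of the intensity with the level is what rules out the empty configuration, for
  which the estimator would be meaningless.\<close>

lemma emeasure_below_ge:
  assumes "c \<ge> \<bar>g 0\<bar> + R"
  shows "emeasure intensity (below c) \<ge> ennreal (real n * (c - (\<bar>g 0\<bar> + R)))"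
proof -
  have "ennreal (real n * (c - (\<bar>g 0\<bar> + R))) = ennreal (real n) * (\<integral>\<^sup>+x\<in>{0..1::real}. ennreal (c - (\<bar>g 0\<bar> + R)) \<partial>lborel)"
    using assms by (subst nn_integral_cmult_indicator) (simp_all add: ennreal_mult)
  also have "\<dots> \<le> ennreal (real n) * (\<integral>\<^sup>+x\<in>{0..1}. emeasure lborel {y. g x \<le> y \<and> (x, y) \<in> below c} \<partial>lborel)"
  proof (intro mult_left_mono nn_integral_mono)
    fix x :: real
    have "ennreal (c - (\<bar>g 0\<bar> + R)) \<le> emeasure lborel {g x..c}" if "x \<in> {0..1}"
      using g_bounded[OF that] assms by (simp add: ennreal_leI)
    moreover have "{y. g x \<le> y \<and> (x, y) \<in> below c} = {g x..c}"
      by auto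
    ultimately show "ennreal (c - (\<bar>g 0\<bar> + R)) * indicator {0..1} x
        \<le> emeasure lborel {y. g x \<le> y \<and> (x, y) \<in> below c} * indicator {0..1} x"
      by (simp add: indicator_def)
  qed simp
  also have "\<dots> = emeasure intensity (below c)"
    by (rule emeasure_boundary_intensity[OF g_cont sets_below, symmetric])
  finally show ?thesis .
qed

sublocale exploration intensity P "lower_cone \<beta> R"
proof
  show "poisson_process_law intensity P"
    by (rule boundary_law)
  show "sets intensity = sets borel"
    by (rule sets_boundary_intensity)
  show "emeasure intensity (below c) < \<infinity>" for c
  proof -
    have "emeasure intensity (below c)
        = ennreal (real n) * (\<integral>\<^sup>+x\<in>{0..1}. emeasure lborel {y. g x \<le> y \<and> (x, y) \<in> below c} \<partial>lborel)"
      by (rule emeasure_boundary_intensity[OF g_cont sets_below])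
    also have "\<dots> \<le> ennreal (real n) * (\<integral>\<^sup>+x\<in>{0..1::real}. ennreal (\<bar>c\<bar> + (\<bar>g 0\<bar> + R)) \<partial>lborel)"
    proof (intro mult_left_mono nn_integral_mono)
      fix x :: real
      have "emeasure lborel {g x..c} \<le> ennreal (\<bar>c\<bar> + (\<bar>g 0\<bar> + R))" if "x \<in> {0..1}"
        using g_bounded[OF that] by (auto simp: emeasure_lborel_Icc_eq intro!: ennreal_leI simp del: ennreal_plus)
      moreover have "{y. g x \<le> y \<and> (x, y) \<in> below c} = {g x..c}"
        by auto
      ultimately show "emeasure lborel {y. g x \<le> y \<and> (x, y) \<in> below c} * indicator {0..1} x
          \<le> ennreal (\<bar>c\<bar> + (\<bar>g 0\<bar> + R)) * indicator {0..1} x"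
        by (simp add: indicator_def)
    qed simp
    also have "\<dots> < \<infinity>"
      by (subst nn_integral_cmult_indicator) (simp_all add: ennreal_mult_less_top del: ennreal_plus)
    finally show ?thesis .
  qed
  show "emeasure intensity (- strip) = 0"
  proof -
    have "emeasure intensity (- strip)
        = ennreal (real n) * (\<integral>\<^sup>+x\<in>{0..1}. emeasure lborel {y. g x \<le> y \<and> (x, y) \<in> - strip} \<partial>lborel)"
      by (intro emeasure_boundary_intensity[OF g_cont] borel_comp sets_strip)
    moreover have "emeasure lborel {y. g x \<le> y \<and> (x, y) \<in> - strip} * indicator {0..1} x = 0" for x
      by (cases "x \<in> {0..1}") auto
    then have "(\<integral>\<^sup>+x\<in>{0..1}. emeasure lborel {y. g x \<le> y \<and> (x, y) \<in> - strip} \<partial>lborel) = 0"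
      by (simp only: nn_integral_const mult_zero_left)
    ultimately show ?thesis
      by simp
  qed
qed (use sets_lower_cone lower_cone_asym[OF \<beta> R] lower_cone_below[OF \<beta> R] in auto)

lemma AE_nonempty: "AE \<omega> in P. \<omega> \<noteq> {}"
proof -
  have "prob (void_event UNIV) \<le> e" if "e > 0" for e
  proof -
    \<comment> \<open>At this level the intensity is at least \<open>ln (1 / e)\<close>, so the void
      probability is at most \<open>e\<close>; the maximum with 1 keeps the level above the range of
      the boundary.\<close>
    define c where "c = max 1 (ln (1 / e)) + (\<bar>g 0\<bar> + R)"
    have "ennreal (real n * (c - (\<bar>g 0\<bar> + R))) \<le> ennreal (measure intensity (below c))"
      using emeasure_below_ge[of c] finite_below[of c]
      by (simp add: c_def emeasure_eq_ennreal_measure)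
    then have "real n * (c - (\<bar>g 0\<bar> + R)) \<le> measure intensity (below c)"
      by simp
    moreover have "1 * max 1 (ln (1 / e)) \<le> real n * max 1 (ln (1 / e))"
      using n by (intro mult_right_mono) auto
    ultimately have "ln (1 / e) \<le> measure intensity (below c)"
      by (simp add: c_def)
    then have "exp (- measure intensity (below c)) \<le> exp (- ln (1 / e))"
      by simp
    also have "\<dots> = e"
      using that by (simp add: ln_div)
    finally have "prob (void_event (below c)) \<le> e"
      by (simp add: void_probability[OF sets_below order_refl])
    moreover have "prob (void_event UNIV) \<le> prob (void_event (below c))"
    proof (rule finite_measure_mono)
      show "void_event UNIV \<subseteq> void_event (below c)"
        by (auto simp: void_event_def)
    qed (simp only: sets_P sets_void_event sets_below)
    ultimately show ?thesis
      by linarith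
  qed
  then have "prob (void_event UNIV) = 0"
    using field_le_epsilon[of "prob (void_event UNIV)" 0] measure_nonneg[of P] by (auto intro: antisym)
  then have "AE \<omega> in P. \<omega> \<notin> void_event UNIV"
    by (subst (asm) prob_eq_0) (simp_all add: sets_P sets_void_event)
  then show ?thesis
    using AE_space by eventually_elim (auto simp: void_event_def space_P)
qed

text \<open>The part of the strip under the boundary has intensity 0 and is bounded above, so it is
  void with probability \<open>exp 0\<close>.\<close>

lemma AE_above: "AE \<omega> in P. \<forall>z\<in>\<omega>. g (fst z) \<le> snd z"
proof -
  let ?B = "strip - {z. clamped g (fst z) \<le> snd z}"
  have B: "?B \<in> sets borel"
    by (intro sets.Diff sets_strip sets_epigraph borel_measurable_continuous_onI continuous_on_clamped g_cont)
  have "?B \<subseteq> below (\<bar>g 0\<bar> + R)"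
    using g_bounded by (fastforce simp: mem_Times_iff clamped_eq)
  then have "prob (void_event ?B) = exp (- measure intensity ?B)"
    by (rule void_probability[OF B])
  moreover have "emeasure intensity ?B = 0"
  proof -
    have empty: "{y. g x \<le> y \<and> (x, y) \<in> ?B} = {}" for x
      by (auto simp: clamped_eq)
    show ?thesis
      unfolding emeasure_boundary_intensity[OF g_cont B] empty emeasure_empty by simp
  qed
  ultimately have "prob (void_event ?B) = 1"
    by (simp add: measure_def)
  then have "AE \<omega> in P. \<omega> \<in> void_event ?B"
    using sets_void_event[OF B] by (intro AE_prob_1) simp
  then show ?thesis
  proof eventually_elim
    fix \<omega> assume w: "\<omega> \<in> void_event ?B"
    show "\<forall>z\<in>\<omega>. g (fst z) \<le> snd z"
    proof
      fix z assume z: "z \<in> \<omega>"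
      then have "fst z \<in> {0..1}" "z \<notin> ?B"
        using w config_fst[of \<omega> z] by (auto simp: void_event_def)
      then show "g (fst z) \<le> snd z"
        by (auto simp: mem_Times_iff clamped_eq)
    qed
  qed
qed

text \<open>By the Hoelder condition every upward cone rooted on or above the graph stays above the
  graph, and the estimator is the infimum of such cones.\<close>

lemma le_mle_boundary:
  assumes w: "\<omega> \<in> configs" "\<omega> \<noteq> {}" and above: "\<forall>z\<in>\<omega>. g (fst z) \<le> snd z" and x: "x \<in> {0..1}"
  shows "g x \<le> mle \<beta> R \<omega> x"
proof (rule le_mle[OF \<beta> R w])
  fix z assume z: "z \<in> \<omega>"
  have "g x - g (fst z) \<le> R * \<bar>x - fst z\<bar> powr \<beta>"
    using holder_ballD[OF g x config_fst[OF w(1) z]] by linarith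
  then show "g x \<le> snd z + R * \<bar>x - fst z\<bar> powr \<beta>"
    using above z by force
qed

end

section \<open>Integrals of the contact weights along vertical lines\<close>

lemma has_integral_pos_part_powr:
  fixes a b p :: real
  assumes "p \<ge> 1" "a \<le> b"
  shows "((\<lambda>y. if y > 0 then p * y powr (p - 1) else 0) has_integral
    (max 0 b powr p - max 0 a powr p)) {a..b}"
\<comment> \<open>The point 0 is exempted: for \<open>p = 1\<close> the positive part has a kink
  there.\<close>
proof (rule fundamental_theorem_of_calculus_interior_strong[where S="{0}"])
  show "continuous_on {a..b} (\<lambda>y. max 0 y powr p)"
    using assms by (intro continuous_on_powr' continuous_intros) auto
  fix y assume "y \<in> {a<..<b} - {0}"
  then consider "y > 0" | "y < 0"
    by force
  then show "((\<lambda>y. max 0 y powr p) has_vector_derivative (if y > 0 then p * y powr (p - 1) else 0)) (at y)"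
  proof cases
    case 1
    then have "((\<lambda>y. y powr p) has_real_derivative (p * y powr (p - 1))) (at y)"
      by (auto intro!: derivative_eq_intros simp: powr_diff field_simps)
    then have "((\<lambda>y. max 0 y powr p) has_real_derivative (p * y powr (p - 1))) (at y)"
      by (rule has_field_derivative_transform_within_open[of _ _ _ "{0<..}"]) (use 1 in auto)
    then show ?thesis
      using 1 by (simp add: has_real_derivative_iff_has_vector_derivative)
  next
    case 2
    have "((\<lambda>y. 0) has_real_derivative 0) (at y)"
      by simp
    then have "((\<lambda>y. max 0 y powr p) has_real_derivative 0) (at y)"
      by (rule has_field_derivative_transform_within_open[of _ _ _ "{..<0}"]) (use 2 in auto)
    then show ?thesis
      using 2 by (simp add: has_real_derivative_iff_has_vector_derivative)
  qed
qed (use assms in auto)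

lemma nn_integral_contact_weight:
  assumes "p \<ge> 1" "a \<le> b"
  shows "(\<integral>\<^sup>+y\<in>{a..b}. contact_weight p (x, y) \<partial>lborel) = ennreal (max 0 b powr p - max 0 a powr p)"
proof -
  have "(\<integral>\<^sup>+y\<in>{a..b}. contact_weight p (x, y) \<partial>lborel)
      = (\<integral>\<^sup>+y. ennreal (indicator {a..b} y * (if y > 0 then p * y powr (p - 1) else 0)) \<partial>lborel)"
    by (intro nn_integral_cong) (simp add: contact_weight_def indicator_def)
  also have "\<dots> = ennreal (max 0 b powr p - max 0 a powr p)"
    by (rule nn_integral_has_integral_lebesgue[OF _ has_integral_pos_part_powr[OF assms]])
       (use assms in auto)
  finally show ?thesis .
qed

lemma nn_integral_contact_weight_neg:
  assumes "p \<ge> 1" "a \<le> b"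
  shows "(\<integral>\<^sup>+y\<in>{a..b}. contact_weight_neg p (x, y) \<partial>lborel) = ennreal (max 0 (- a) powr p - max 0 (- b) powr p)"
proof -
  have m: "(\<lambda>y. contact_weight_neg p (x, y) * indicator {a..b} y) \<in> borel_measurable borel"
    unfolding contact_weight_neg_def contact_weight_def snd_conv fst_conv by simp
  have "(\<integral>\<^sup>+y\<in>{a..b}. contact_weight_neg p (x, y) \<partial>lborel)
      = (\<integral>\<^sup>+y. contact_weight_neg p (x, - y) * indicator {a..b} (- y) \<partial>lborel)"
    using nn_integral_real_affine[OF m, of "-1" 0] by simp
  also have "\<dots> = (\<integral>\<^sup>+y\<in>{- b..- a}. contact_weight p (x, y) \<partial>lborel)"
    by (intro nn_integral_cong) (auto simp: contact_weight_neg_def indicator_def)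
  also have "\<dots> = ennreal (max 0 (- a) powr p - max 0 (- b) powr p)"
    using assms by (intro nn_integral_contact_weight) auto
  finally show ?thesis .
qed

lemma abs_powr_split: "\<bar>y :: real\<bar> powr p = max 0 y powr p + max 0 (- y) powr p"
  by (cases "y \<ge> 0") auto

lemma set_integrable_unit_interval:
  fixes f :: "real \<Rightarrow> real"
  assumes "f \<in> borel_measurable borel" "\<And>x. x \<in> {0..1} \<Longrightarrow> \<bar>f x\<bar> \<le> K"
  shows "set_integrable lborel {0..1} f"
  unfolding set_integrable_def
  using assms by (intro integrableI_bounded_set_indicator[where B=K]) auto

lemma nn_integral_unit_interval:
  assumes "set_integrable lborel {0..1} f" "\<And>x. x \<in> {0..1} \<Longrightarrow> 0 \<le> f x"
  shows "(\<integral>\<^sup>+x\<in>{0..1}. ennreal (f x) \<partial>lborel) = ennreal (LBINT x:{0..1}. f x)"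
proof -
  have "(\<integral>\<^sup>+x\<in>{0..1}. ennreal (f x) \<partial>lborel) = (\<integral>\<^sup>+x. ennreal (indicator {0..1} x *\<^sub>R f x) \<partial>lborel)"
    by (intro nn_integral_cong) (simp add: indicator_def)
  also have "\<dots> = ennreal (\<integral>x. indicator {0..1} x *\<^sub>R f x \<partial>lborel)"
    using assms by (intro nn_integral_eq_integral) (auto simp: set_integrable_def indicator_def)
  finally show ?thesis
    by (simp add: set_lebesgue_integral_def)
qed

context boundary_model
begin

text \<open>Over \<open>x\<close>, the clear heights are exactly those up to the estimator, so the
  compensator integrates \<open>h\<close> over the region between the boundary and the
  estimator.\<close>

lemma explored_integral_eq:
  assumes w: "\<omega> \<in> configs" "\<omega> \<noteq> {}" and above: "\<forall>z\<in>\<omega>. g (fst z) \<le> snd z"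
    and h: "h \<in> borel_measurable borel"
  shows "explored_integral h \<omega>
    = ennreal (real n) * (\<integral>\<^sup>+x\<in>{0..1}. (\<integral>\<^sup>+y\<in>{g x..mle \<beta> R \<omega> x}. h (x, y) \<partial>lborel) \<partial>lborel)"
proof -
  have "(\<lambda>z. clear (lower_cone \<beta> R) \<omega> z) \<in> borel_measurable borel"
    using w by (intro measurable_clear[OF sets_lower_cone]) auto
  then have "explored_integral h \<omega>
      = ennreal (real n) * (\<integral>\<^sup>+x\<in>{0..1}. (\<integral>\<^sup>+y\<in>{g x..}. h (x, y) * clear (lower_cone \<beta> R) \<omega> (x, y) \<partial>lborel) \<partial>lborel)"
    unfolding explored_integral_def
    by (intro nn_integral_boundary_intensity[OF g_cont] borel_measurable_times_ennreal h)
  moreover have "(\<integral>\<^sup>+y\<in>{g x..}. h (x, y) * clear (lower_cone \<beta> R) \<omega> (x, y) \<partial>lborel)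
      = (\<integral>\<^sup>+y\<in>{g x..mle \<beta> R \<omega> x}. h (x, y) \<partial>lborel)" for x
    by (intro nn_integral_cong)
       (auto simp: clear_def le_mle_iff[OF \<beta> R w, symmetric] indicator_def)
  ultimately show ?thesis
    by simp
qed

text \<open>Both the bias correction and the plug-in error are integrals of the derivative of
  \<open>\<bar>y\<bar> powr p\<close> over the explored region, against the point process and its intensity.\<close>

lemma F_hat_deviation:
  assumes p: "p \<ge> 1" and w: "\<omega> \<in> configs" "\<omega> \<noteq> {}" and above: "\<forall>z\<in>\<omega>. g (fst z) \<le> snd z"
  shows "explored_integral (contact_weight p) \<omega> < \<infinity>"
    and "explored_integral (contact_weight_neg p) \<omega> < \<infinity>"
    and "F_hat n \<beta> R p \<omega> - (LBINT x:{0..1}. \<bar>g x\<bar> powr p)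
      = 1 / real n * ((enn2real (explored_integral (contact_weight p) \<omega>)
          - enn2real (explored_sum (lower_cone \<beta> R) (contact_weight p) \<omega>))
        - (enn2real (explored_integral (contact_weight_neg p) \<omega>)
          - enn2real (explored_sum (lower_cone \<beta> R) (contact_weight_neg p) \<omega>)))"
proof -
  let ?m = "mle \<beta> R \<omega>" and ?g = "clamped g"
  have ge: "g x \<le> ?m x" if "x \<in> {0..1}" for x
    by (rule le_mle_boundary[OF w above that])
  obtain K where K: "\<And>x. x \<in> {0..1} \<Longrightarrow> \<bar>?m x\<bar> \<le> K"
    using mle_bounded[OF \<beta> R w(1)] by blast
  have [measurable]: "?m \<in> borel_measurable borel"
    by (rule mle_borel[OF \<beta> R w(1)])
  have [measurable]: "?g \<in> borel_measurable borel"
    by (intro borel_measurable_continuous_onI continuous_on_clamped g_cont)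
  let ?B = "\<bar>K\<bar> + (\<bar>g 0\<bar> + R)"
  have bound: "\<bar>max 0 y powr p\<bar> \<le> ?B powr p" if "\<bar>y\<bar> \<le> ?B" for y
    using that p R by (auto intro!: powr_mono2)
  have gB: "\<bar>g x\<bar> \<le> ?B" and mB: "\<bar>?m x\<bar> \<le> ?B" if "x \<in> {0..1}" for x
    using K[OF that] g_bounded[OF that] R by auto
  have int: "set_integrable lborel {0..1} (\<lambda>x. max 0 (?m x) powr p)"
    "set_integrable lborel {0..1} (\<lambda>x. max 0 (- ?m x) powr p)"
    using mB by (auto intro!: set_integrable_unit_interval[where K="?B powr p"] bound)
  have intg': "set_integrable lborel {0..1} (\<lambda>x. max 0 (?g x) powr p)"
    "set_integrable lborel {0..1} (\<lambda>x. max 0 (- ?g x) powr p)"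
    using gB by (auto intro!: set_integrable_unit_interval[where K="?B powr p"] bound simp: clamped_eq)
  have intg: "set_integrable lborel {0..1} (\<lambda>x. max 0 (g x) powr p)"
    "set_integrable lborel {0..1} (\<lambda>x. max 0 (- g x) powr p)"
    by (subst set_integrable_cong[OF refl refl, of _ _ "\<lambda>x. max 0 (?g x) powr p"], simp add: clamped_eq, rule intg'(1),
        subst set_integrable_cong[OF refl refl, of _ _ "\<lambda>x. max 0 (- ?g x) powr p"], simp add: clamped_eq, rule intg'(2))
  have mono: "max 0 (g x) powr p \<le> max 0 (?m x) powr p" "max 0 (- ?m x) powr p \<le> max 0 (- g x) powr p"
    if "x \<in> {0..1}" for x
    using ge[OF that] p by (auto intro!: powr_mono2 simp del: max.bounded_iff)
  have pos: "explored_integral (contact_weight p) \<omega>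
      = ennreal (real n * (LBINT x:{0..1}. max 0 (?m x) powr p - max 0 (g x) powr p))"
  proof -
    have slice: "(\<integral>\<^sup>+y\<in>{g x..?m x}. contact_weight p (x, y) \<partial>lborel) * indicator {0..1} x
        = ennreal (max 0 (?m x) powr p - max 0 (g x) powr p) * indicator {0..1} x" for x
      by (cases "x \<in> {0..1}") (simp_all add: nn_integral_contact_weight[OF p ge])
    have "explored_integral (contact_weight p) \<omega>
        = ennreal (real n) * (\<integral>\<^sup>+x\<in>{0..1}. ennreal (max 0 (?m x) powr p - max 0 (g x) powr p) \<partial>lborel)"
      unfolding explored_integral_eq[OF w above measurable_contact_weight]
      by (simp only: slice)
    also have "\<dots> = ennreal (real n) * ennreal (LBINT x:{0..1}. max 0 (?m x) powr p - max 0 (g x) powr p)"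
      by (subst nn_integral_unit_interval) (auto intro!: set_integral_diff int intg mono)
    finally show ?thesis
      by (simp add: ennreal_mult')
  qed
  have neg: "explored_integral (contact_weight_neg p) \<omega>
      = ennreal (real n * (LBINT x:{0..1}. max 0 (- g x) powr p - max 0 (- ?m x) powr p))"
  proof -
    have slice: "(\<integral>\<^sup>+y\<in>{g x..?m x}. contact_weight_neg p (x, y) \<partial>lborel) * indicator {0..1} x
        = ennreal (max 0 (- g x) powr p - max 0 (- ?m x) powr p) * indicator {0..1} x" for x
      by (cases "x \<in> {0..1}") (simp_all add: nn_integral_contact_weight_neg[OF p ge])
    have "explored_integral (contact_weight_neg p) \<omega>
        = ennreal (real n) * (\<integral>\<^sup>+x\<in>{0..1}. ennreal (max 0 (- g x) powr p - max 0 (- ?m x) powr p) \<partial>lborel)"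
      unfolding explored_integral_eq[OF w above measurable_contact_weight_neg]
      by (simp only: slice)
    also have "\<dots> = ennreal (real n) * ennreal (LBINT x:{0..1}. max 0 (- g x) powr p - max 0 (- ?m x) powr p)"
      by (subst nn_integral_unit_interval) (auto intro!: set_integral_diff int intg mono)
    finally show ?thesis
      by (simp add: ennreal_mult')
  qed
  show "explored_integral (contact_weight p) \<omega> < \<infinity>" "explored_integral (contact_weight_neg p) \<omega> < \<infinity>"
    by (simp_all add: pos neg)
  have nonneg: "0 \<le> (LBINT x:{0..1}. max 0 (?m x) powr p - max 0 (g x) powr p)"
    "0 \<le> (LBINT x:{0..1}. max 0 (- g x) powr p - max 0 (- ?m x) powr p)"
    unfolding set_lebesgue_integral_def using mono
    by (auto intro!: integral_nonneg_AE simp: indicator_def)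
  have split: "(LBINT x:{0..1}. \<bar>f x\<bar> powr p) = (LBINT x:{0..1}. max 0 (f x) powr p) + (LBINT x:{0..1}. max 0 (- f x) powr p)"
    if "set_integrable lborel {0..1} (\<lambda>x. max 0 (f x) powr p)" "set_integrable lborel {0..1} (\<lambda>x. max 0 (- f x) powr p)" for f :: "real \<Rightarrow> real"
    unfolding abs_powr_split by (rule set_integral_add(2)[OF that])
  \<comment> \<open>The positive part of the argument increases and the negative part decreases from
    \<open>g\<close> to the estimator; the difference of the two compensators reassembles the
    increment of \<open>\<bar>y\<bar> powr p\<close>.\<close>
  have "enn2real (explored_integral (contact_weight p) \<omega>) - enn2real (explored_integral (contact_weight_neg p) \<omega>)
      = real n * ((LBINT x:{0..1}. \<bar>?m x\<bar> powr p) - (LBINT x:{0..1}. \<bar>g x\<bar> powr p))"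
    unfolding pos neg enn2real_ennreal[OF mult_nonneg_nonneg[OF of_nat_0_le_iff nonneg(1)]]
      enn2real_ennreal[OF mult_nonneg_nonneg[OF of_nat_0_le_iff nonneg(2)]]
    by (simp add: split int intg set_integral_diff algebra_simps)
  then have "(LBINT x:{0..1}. \<bar>?m x\<bar> powr p) - (LBINT x:{0..1}. \<bar>g x\<bar> powr p)
      = 1 / real n * (enn2real (explored_integral (contact_weight p) \<omega>)
        - enn2real (explored_integral (contact_weight_neg p) \<omega>))"
    using n by (simp add: field_simps)
  then show "F_hat n \<beta> R p \<omega> - (LBINT x:{0..1}. \<bar>g x\<bar> powr p)
      = 1 / real n * ((enn2real (explored_integral (contact_weight p) \<omega>)
          - enn2real (explored_sum (lower_cone \<beta> R) (contact_weight p) \<omega>))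
        - (enn2real (explored_integral (contact_weight_neg p) \<omega>)
          - enn2real (explored_sum (lower_cone \<beta> R) (contact_weight_neg p) \<omega>)))"
    unfolding F_hat_eq[OF \<beta> R p w(1)] by (simp add: algebra_simps)
qed

lemma nn_integral_contact_weight_below:
  assumes p: "p \<ge> 1"
  shows "(\<integral>\<^sup>+z. contact_weight p z * indicator (below c) z \<partial>intensity) < \<infinity>"
    and "(\<integral>\<^sup>+z. contact_weight_neg p z * indicator (below c) z \<partial>intensity) < \<infinity>"
proof -
  \<comment> \<open>Large enough for the interval from \<open>- ?b\<close> to \<open>?b\<close> to
    contain every slice between the boundary and the level \<open>c\<close>; on it both weights
    integrate to \<open>?b powr p\<close>.\<close>
  let ?b = "\<bar>c\<bar> + (\<bar>g 0\<bar> + R)"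
  have fin: "(\<integral>\<^sup>+z. h z * indicator (below c) z \<partial>intensity) < \<infinity>"
    if h: "h \<in> borel_measurable borel"
      and int: "\<And>x. (\<integral>\<^sup>+y\<in>{- ?b..?b}. h (x, y) \<partial>lborel) \<le> ennreal (?b powr p)" for h
  proof -
    have "(\<integral>\<^sup>+z. h z * indicator (below c) z \<partial>intensity)
        = ennreal (real n) * (\<integral>\<^sup>+x\<in>{0..1}. (\<integral>\<^sup>+y\<in>{g x..}. h (x, y) * indicator (below c) (x, y) \<partial>lborel) \<partial>lborel)"
      by (intro nn_integral_boundary_intensity[OF g_cont] borel_measurable_times_ennreal h
          borel_measurable_indicator sets_below)
    also have "\<dots> \<le> ennreal (real n) * (\<integral>\<^sup>+x\<in>{0..1::real}. ennreal (?b powr p) \<partial>lborel)"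
    proof (intro mult_left_mono nn_integral_mono)
      fix x :: real
      have "(\<integral>\<^sup>+y\<in>{g x..}. h (x, y) * indicator (below c) (x, y) \<partial>lborel) \<le> ennreal (?b powr p)" if "x \<in> {0..1}"
      proof -
        have "(\<integral>\<^sup>+y\<in>{g x..}. h (x, y) * indicator (below c) (x, y) \<partial>lborel) \<le> (\<integral>\<^sup>+y\<in>{- ?b..?b}. h (x, y) \<partial>lborel)"
          using g_bounded[OF that] R by (intro nn_integral_mono) (auto simp: indicator_def)
        then show ?thesis
          using int order_trans by blast
      qed
      then show "(\<integral>\<^sup>+y\<in>{g x..}. h (x, y) * indicator (below c) (x, y) \<partial>lborel) * indicator {0..1} x
          \<le> ennreal (?b powr p) * indicator {0..1} x"
        by (simp add: indicator_def)
    qed simp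
    also have "\<dots> < \<infinity>"
      by (subst nn_integral_cmult_indicator) (simp_all add: ennreal_mult_less_top)
    finally show ?thesis .
  qed
  show "(\<integral>\<^sup>+z. contact_weight p z * indicator (below c) z \<partial>intensity) < \<infinity>"
    using R by (intro fin measurable_contact_weight) (simp add: nn_integral_contact_weight[OF p])
  show "(\<integral>\<^sup>+z. contact_weight_neg p z * indicator (below c) z \<partial>intensity) < \<infinity>"
    using R by (intro fin measurable_contact_weight_neg) (simp add: nn_integral_contact_weight_neg[OF p] algebra_simps)
qed

lemma explored_sum_finite:
  assumes "\<omega> \<in> configs"
  shows "explored_sum (lower_cone \<beta> R) (contact_weight p) \<omega> < \<infinity>"
    and "explored_sum (lower_cone \<beta> R) (contact_weight_neg p) \<omega> < \<infinity>"
  using clear_points(2)[OF \<beta> R assms]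
  by (simp_all add: explored_sum_eq[OF \<beta> R assms] contact_weight_def contact_weight_neg_def)

lemma measurable_void_probability:
  "(\<lambda>z. emeasure P (void_event (lower_cone \<beta> R z))) \<in> borel_measurable borel"
  unfolding nn_integral_clear[symmetric]
  by (intro sigma_finite_measure.borel_measurable_nn_integral[OF prob_space_imp_sigma_finite[OF prob_space_axioms]])
     (unfold split_beta', intro measurable_clear[OF sets_lower_cone] measurable_fst
       measurable_snd[of borel P, unfolded measurable_cong_sets[OF refl sets_P]])

text \<open>The factor 2 comes from \<open>(a - b)\<^sup>2 \<le> 2 * (a\<^sup>2 + b\<^sup>2)\<close>
  for the deviations of the positive and the negative weight. These weights have disjoint supports,
  so their squares add up to a single kernel.\<close>

lemma nn_integral_F_hat_deviation_sq:
  assumes p: "p \<ge> 1"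
  shows "(\<integral>\<^sup>+\<omega>. ennreal ((F_hat n \<beta> R p \<omega> - (LBINT x:{0..1}. \<bar>g x\<bar> powr p))\<^sup>2) \<partial>P)
    \<le> ennreal (2 / (real n)\<^sup>2)
      * (\<integral>\<^sup>+z. ennreal (p\<^sup>2 * \<bar>snd z\<bar> powr (2 * (p - 1))) * emeasure P (void_event (lower_cone \<beta> R z)) \<partial>intensity)"
proof -
  let ?d = "\<lambda>h \<omega>. enn2real (explored_sum (lower_cone \<beta> R) h \<omega>) - enn2real (explored_integral h \<omega>)"
  let ?V = "\<lambda>h. \<integral>\<^sup>+z. (h z)\<^sup>2 * emeasure P (void_event (lower_cone \<beta> R z)) \<partial>intensity"
  have good: "AE \<omega> in P. \<omega> \<in> configs \<and> \<omega> \<noteq> {} \<and> (\<forall>z\<in>\<omega>. g (fst z) \<le> snd z)"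
    using AE_space AE_nonempty AE_above by eventually_elim (simp add: space_P)
  have AE_fin: "AE \<omega> in P. explored_sum (lower_cone \<beta> R) h \<omega> < \<infinity> \<and> explored_integral h \<omega> < \<infinity>"
    if "h \<in> {contact_weight p, contact_weight_neg p}" for h
    using good by eventually_elim (use that F_hat_deviation(1,2)[OF p] explored_sum_finite in auto)
  have dev: "(\<integral>\<^sup>+\<omega>. ennreal ((?d h \<omega>)\<^sup>2) \<partial>P) \<le> ?V h" if h: "h \<in> {contact_weight p, contact_weight_neg p}" for h
    using h measurable_contact_weight measurable_contact_weight_neg nn_integral_contact_weight_below[OF p]
    by (intro nn_integral_explored_deviation_sq_le AE_fin) auto
  have md: "(\<lambda>\<omega>. ennreal ((?d h \<omega>)\<^sup>2)) \<in> borel_measurable P" if h: "h \<in> borel_measurable borel" for h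
    using measurable_explored_sum[OF sets_lower_cone h id_config] measurable_explored_integral[OF h id_config]
    by (intro measurable_compose[OF _ measurable_ennreal] borel_measurable_power borel_measurable_diff
        borel_measurable_enn2real)
  have "(\<integral>\<^sup>+\<omega>. ennreal ((F_hat n \<beta> R p \<omega> - (LBINT x:{0..1}. \<bar>g x\<bar> powr p))\<^sup>2) \<partial>P)
      \<le> (\<integral>\<^sup>+\<omega>. ennreal (2 / (real n)\<^sup>2) * (ennreal ((?d (contact_weight p) \<omega>)\<^sup>2)
        + ennreal ((?d (contact_weight_neg p) \<omega>)\<^sup>2)) \<partial>P)"
  proof (rule nn_integral_mono_AE, use good in eventually_elim)
    fix \<omega> assume "\<omega> \<in> configs \<and> \<omega> \<noteq> {} \<and> (\<forall>z\<in>\<omega>. g (fst z) \<le> snd z)"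
    then have "(F_hat n \<beta> R p \<omega> - (LBINT x:{0..1}. \<bar>g x\<bar> powr p))\<^sup>2
        = (1 / real n * (?d (contact_weight_neg p) \<omega> - ?d (contact_weight p) \<omega>))\<^sup>2"
      by (subst F_hat_deviation(3)[OF p]) (auto simp: algebra_simps)
    also have "\<dots> = 1 / (real n)\<^sup>2 * (?d (contact_weight_neg p) \<omega> - ?d (contact_weight p) \<omega>)\<^sup>2"
      by (simp only: power_mult_distrib power_divide power_one)
    also have "\<dots> \<le> 1 / (real n)\<^sup>2 * (2 * ((?d (contact_weight p) \<omega>)\<^sup>2 + (?d (contact_weight_neg p) \<omega>)\<^sup>2))"
    proof (intro mult_left_mono)
      have "(a - b)\<^sup>2 \<le> 2 * (b\<^sup>2 + a\<^sup>2)" for a b :: real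
        using zero_le_power2[of "a + b"] by (simp add: power2_eq_square algebra_simps)
      then show "(?d (contact_weight_neg p) \<omega> - ?d (contact_weight p) \<omega>)\<^sup>2
          \<le> 2 * ((?d (contact_weight p) \<omega>)\<^sup>2 + (?d (contact_weight_neg p) \<omega>)\<^sup>2)" .
    qed simp
    also have "\<dots> = 2 / (real n)\<^sup>2 * ((?d (contact_weight p) \<omega>)\<^sup>2 + (?d (contact_weight_neg p) \<omega>)\<^sup>2)"
      by simp
    finally show "ennreal ((F_hat n \<beta> R p \<omega> - (LBINT x:{0..1}. \<bar>g x\<bar> powr p))\<^sup>2)
        \<le> ennreal (2 / (real n)\<^sup>2) * (ennreal ((?d (contact_weight p) \<omega>)\<^sup>2) + ennreal ((?d (contact_weight_neg p) \<omega>)\<^sup>2))"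
      by (simp add: ennreal_mult[symmetric] ennreal_plus[symmetric] ennreal_leI del: ennreal_plus)
  qed
  also have "\<dots> = ennreal (2 / (real n)\<^sup>2) * ((\<integral>\<^sup>+\<omega>. ennreal ((?d (contact_weight p) \<omega>)\<^sup>2) \<partial>P)
      + (\<integral>\<^sup>+\<omega>. ennreal ((?d (contact_weight_neg p) \<omega>)\<^sup>2) \<partial>P))"
    using md[OF measurable_contact_weight, of p] md[OF measurable_contact_weight_neg, of p]
    by (subst nn_integral_cmult) (auto simp: nn_integral_add)
  also have "\<dots> \<le> ennreal (2 / (real n)\<^sup>2) * (?V (contact_weight p) + ?V (contact_weight_neg p))"
    by (intro mult_left_mono add_mono dev) auto
  also have "?V (contact_weight p) + ?V (contact_weight_neg p)
      = (\<integral>\<^sup>+z. (contact_weight p z)\<^sup>2 * emeasure P (void_event (lower_cone \<beta> R z))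
        + (contact_weight_neg p z)\<^sup>2 * emeasure P (void_event (lower_cone \<beta> R z)) \<partial>intensity)"
  proof (rule nn_integral_add[symmetric])
    show "(\<lambda>z. (contact_weight p z)\<^sup>2 * emeasure P (void_event (lower_cone \<beta> R z))) \<in> borel_measurable intensity"
      "(\<lambda>z. (contact_weight_neg p z)\<^sup>2 * emeasure P (void_event (lower_cone \<beta> R z))) \<in> borel_measurable intensity"
      unfolding power2_eq_square measurable_cong_sets[OF sets_boundary_intensity refl]
      by (intro borel_measurable_times_ennreal measurable_contact_weight measurable_contact_weight_neg
          measurable_void_probability)+
  qed
  also have "\<dots> \<le> (\<integral>\<^sup>+z. ennreal (p\<^sup>2 * \<bar>snd z\<bar> powr (2 * (p - 1))) * emeasure P (void_event (lower_cone \<beta> R z)) \<partial>intensity)"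
  proof (rule nn_integral_mono)
    fix z :: "real \<times> real"
    have "(contact_weight p z)\<^sup>2 + (contact_weight_neg p z)\<^sup>2 \<le> ennreal (p\<^sup>2 * \<bar>snd z\<bar> powr (2 * (p - 1)))"
    proof -
      have "ennreal (p * y powr (p - 1)) * ennreal (p * y powr (p - 1)) = ennreal (p * p * y powr (2 * p - 2))" for y
        using p by (simp add: ennreal_mult[symmetric] powr_add[symmetric] mult_ac)
      then show ?thesis
        by (simp add: contact_weight_def contact_weight_neg_def power2_eq_square algebra_simps)
    qed
    then show "(contact_weight p z)\<^sup>2 * emeasure P (void_event (lower_cone \<beta> R z))
        + (contact_weight_neg p z)\<^sup>2 * emeasure P (void_event (lower_cone \<beta> R z))
      \<le> ennreal (p\<^sup>2 * \<bar>snd z\<bar> powr (2 * (p - 1))) * emeasure P (void_event (lower_cone \<beta> R z))"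
      by (simp add: distrib_right[symmetric] mult_right_mono)
  qed
  finally show ?thesis
    by (simp add: mult_left_mono)
qed

end

section \<open>Consistency of the plug-in test\<close>

text \<open>Half of the exponential decay absorbs the power. The resulting constant depends on
  \<open>p\<close>, \<open>\<beta>\<close> and \<open>R\<close> when it is applied, but neither on
  \<open>n\<close> nor on the boundary.\<close>

lemma nn_integral_powr_exp_finite:
  assumes "\<kappa> > 0" "q \<ge> 0"
  shows "\<exists>K\<ge>0. (\<integral>\<^sup>+s\<in>{0..}. ennreal ((1 + s) powr q * exp (- \<kappa> * (s - 1))) \<partial>lborel) \<le> ennreal K"
proof -
  \<comment> \<open>Chosen so that \<open>ln u \<le> u - 1\<close> at \<open>u = a * (1 + s)\<close>
    bounds \<open>q * ln (1 + s)\<close> with slope at most \<open>\<kappa> / 2\<close>; the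
    \<open>+ 1\<close> avoids division by zero at \<open>q = 0\<close>. \<open>D\<close> collects
    the constants.\<close>
  define a where "a = \<kappa> / (2 * (q + 1))"
  define D where "D = \<kappa> / 2 + \<kappa> - q * (1 + ln a)"
  have a: "a > 0" "q * a \<le> \<kappa> / 2"
    using assms by (simp_all add: a_def field_simps)
  have bound: "(1 + s) powr q * exp (- \<kappa> * (s - 1)) \<le> exp D * exp (- (\<kappa> / 2) * s)" if "s \<ge> 0" for s
  proof -
    have "ln (1 + s) = ln (a * (1 + s)) - ln a"
      using a that by (simp add: ln_mult)
    also have "\<dots> \<le> a * (1 + s) - 1 - ln a"
      using ln_le_minus_one[of "a * (1 + s)"] a that by simp
    finally have "q * ln (1 + s) \<le> q * (a * (1 + s) - 1 - ln a)"
      using assms(2) by (rule mult_left_mono)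
    also have "\<dots> = (q * a) * (1 + s) - q * (1 + ln a)"
      by (simp add: algebra_simps)
    also have "\<dots> \<le> (\<kappa> / 2) * (1 + s) - q * (1 + ln a)"
      using a(2) that by (intro diff_right_mono mult_right_mono) auto
    finally have "q * ln (1 + s) + (- \<kappa> * (s - 1)) \<le> D + (- (\<kappa> / 2) * s)"
      by (simp add: D_def field_simps)
    then show ?thesis
      using that by (simp add: powr_def exp_add[symmetric] del: exp_le_cancel_iff) (simp only: exp_le_cancel_iff)
  qed
  let ?F = "\<lambda>s. - (exp D * (2 / \<kappa>)) * exp (- (\<kappa> / 2) * s)"
  have "(\<integral>\<^sup>+s\<in>{0..}. ennreal ((1 + s) powr q * exp (- \<kappa> * (s - 1))) \<partial>lborel)
      \<le> (\<integral>\<^sup>+s\<in>{0..}. ennreal (exp D * exp (- (\<kappa> / 2) * s)) \<partial>lborel)"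
    using bound by (intro nn_integral_mono) (auto simp: indicator_def intro!: ennreal_leI)
  also have "\<dots> = ennreal (0 - ?F 0)"
  proof (rule nn_integral_FTC_atLeast)
    show "(?F has_real_derivative exp D * exp (- (\<kappa> / 2) * s)) (at s)" for s
      using assms by (auto intro!: derivative_eq_intros)
    show "(?F \<longlongrightarrow> 0) at_top"
      using assms by real_asymp
  qed auto
  finally show ?thesis
    using assms by (intro exI[of _ "exp D * (2 / \<kappa>)"]) simp
qed

text \<open>The balance that defines the bandwidth: a box of width \<open>h\<close> and height
  \<open>h powr \<beta>\<close> has intensity 1.\<close>

lemma bandwidth_identity:
  assumes n: "n \<ge> 1" and "0 < \<beta>" and h: "h = real n powr (- 1 / (\<beta> + 1))"
  shows "real n * h powr \<beta> = 1 / h"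
proof -
  have "real n * h powr \<beta> = real n powr 1 * real n powr ((- 1 / (\<beta> + 1)) * \<beta>)"
    using n by (simp add: h powr_powr)
  also have "\<dots> = real n powr (1 + (- 1 / (\<beta> + 1)) * \<beta>)"
    by (simp only: powr_add)
  also have "1 + (- 1 / (\<beta> + 1)) * \<beta> = 1 / (\<beta> + 1)"
    using \<open>0 < \<beta>\<close> by (simp add: field_simps)
  finally show ?thesis
    by (simp add: h powr_minus_divide)
qed

lemma set_integrable_abs_powr:
  fixes g :: "real \<Rightarrow> real"
  assumes "continuous_on {0..1} g" "q > 0"
  shows "set_integrable lborel {0..1} (\<lambda>x. \<bar>g x\<bar> powr q)"
  using assms by (intro borel_integrable_atLeastAtMost' continuous_on_powr' continuous_intros) auto

context boundary_model
begin

text \<open>Below a point at height \<open>t\<close> over the boundary, the explored cone contains a rectangle of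
  height \<open>t / 2\<close> whose width is comparable to \<open>t powr (1 / \<beta>)\<close>.\<close>

lemma void_probability_lower_cone:
  assumes x: "x \<in> {0..1}" and t: "t \<ge> 0"
  shows "emeasure P (void_event (lower_cone \<beta> R (x, g x + t)))
    \<le> ennreal (exp (- (real n * (t / 2) * min ((t / (4 * R)) powr (1 / \<beta>)) (1 / 2))))"
proof -
  \<comment> \<open>\<open>\<delta>\<close> is the distance over which the cone rises by at most
    \<open>t / 4\<close>. The cap \<open>1 / 2\<close> leaves room for an interval of this length on
    one side of \<open>x\<close> within the unit interval, and \<open>a\<close> is its left
    end.\<close>
  define \<delta> where "\<delta> = min ((t / (4 * R)) powr (1 / \<beta>)) (1 / 2)"
  define a where "a = (if x \<le> 1 / 2 then x else x - \<delta>)"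
  have \<delta>: "0 \<le> \<delta>" "\<delta> \<le> 1 / 2"
    by (simp_all add: \<delta>_def)
  have near: "u \<in> {0..1} \<and> R * \<bar>x - u\<bar> powr \<beta> \<le> t / 4" if "u \<in> {a..a + \<delta>}" for u
  proof -
    have u: "u \<in> {0..1}" "\<bar>x - u\<bar> \<le> \<delta>"
      using that \<delta> x by (auto simp: a_def split: if_splits)
    have "\<bar>x - u\<bar> powr \<beta> \<le> ((t / (4 * R)) powr (1 / \<beta>)) powr \<beta>"
      using u \<beta> by (intro powr_mono2) (auto simp: \<delta>_def)
    also have "\<dots> = t / (4 * R)"
      using \<beta> t R by (simp add: powr_powr)
    finally have "R * \<bar>x - u\<bar> powr \<beta> \<le> t / 4"
      using R by (simp add: field_simps)
    then show ?thesis
      using u by simp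
  qed
  let ?C = "lower_cone \<beta> R (x, g x + t)"
  have "ennreal (real n * (t / 2) * \<delta>)
      = ennreal (real n) * (\<integral>\<^sup>+u. ennreal (t / 2) * indicator {a..a + \<delta>} u \<partial>lborel)"
    using \<delta> t by (subst nn_integral_cmult_indicator) (simp_all add: ennreal_mult[symmetric] mult.assoc)
  also have "\<dots> \<le> ennreal (real n) * (\<integral>\<^sup>+u\<in>{0..1}. emeasure lborel {y. g u \<le> y \<and> (u, y) \<in> ?C} \<partial>lborel)"
  proof (intro mult_left_mono nn_integral_mono)
    fix u
    show "ennreal (t / 2) * indicator {a..a + \<delta>} u
        \<le> emeasure lborel {y. g u \<le> y \<and> (u, y) \<in> ?C} * indicator {0..1} u"
    proof (cases "u \<in> {a..a + \<delta>}")
      case True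
      note nu = near[OF True]
      \<comment> \<open>Over \<open>u\<close> the rim of the cone has dropped by at most
        \<open>t / 4\<close> and the boundary has risen by at most \<open>t / 4\<close>, so at least
        \<open>t / 2\<close> of the height \<open>t\<close> remains.\<close>
      have eq: "{y. g u \<le> y \<and> (u, y) \<in> ?C} = {g u..<g x + t - R * \<bar>x - u\<bar> powr \<beta>}"
        by (auto simp: lower_cone_def)
      have "g u - g x \<le> t / 4"
        using holder_ballD[OF g _ x, of u] nu by (auto simp: abs_minus_commute)
      then have "t / 2 \<le> g x + t - R * \<bar>x - u\<bar> powr \<beta> - g u"
        using nu by linarith
      then have "ennreal (t / 2) \<le> emeasure lborel {g u..<g x + t - R * \<bar>x - u\<bar> powr \<beta>}"
        using t by (simp add: ennreal_leI)
      then show ?thesis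
        unfolding eq using True nu by simp
    qed simp
  qed simp
  also have "\<dots> = emeasure intensity ?C"
    by (rule emeasure_boundary_intensity[OF g_cont borel_C, symmetric])
  also have "\<dots> = ennreal (measure intensity ?C)"
    using finite_intensity[OF C_below[of "(x, g x + t)"]] by (intro emeasure_eq_ennreal_measure) (simp add: less_top)
  finally have "real n * (t / 2) * \<delta> \<le> measure intensity ?C"
    by simp
  then show ?thesis
    by (simp add: emeasure_eq_measure void_probability[OF borel_C C_below] \<delta>_def[symmetric])
qed

text \<open>Heights are measured from the boundary in units of \<open>h powr \<beta>\<close>, the
  scale on which void probabilities decay. The weight is then at most a power of
  \<open>M * (1 + s)\<close>, and the remaining integral over \<open>s\<close> is the constant
  \<open>K\<close>.\<close>

lemma variance_kernel_le:
  assumes p: "p \<ge> 1" and K: "K \<ge> 0"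
    "(\<integral>\<^sup>+s\<in>{0..}. ennreal ((1 + s) powr (2 * (p - 1)) * exp (- \<kappa> * (s - 1))) \<partial>lborel) \<le> ennreal K"
    and \<kappa>: "\<kappa> = min ((1 / (4 * R)) powr (1 / \<beta>)) (1 / 2) / 2"
    and h: "h = real n powr (- 1 / (\<beta> + 1))"
    and x: "x \<in> {0..1}"
  shows "(\<integral>\<^sup>+y\<in>{g x..}. ennreal (p\<^sup>2 * \<bar>y\<bar> powr (2 * (p - 1)))
      * emeasure P (void_event (lower_cone \<beta> R (x, y))) \<partial>lborel)
    \<le> ennreal (p\<^sup>2 * K / h powr \<beta> * (\<bar>g x\<bar> powr (2 * p) + h powr (2 * \<beta> * p)))"
proof -
  define d where "d = h powr \<beta>"
  define M where "M = max \<bar>g x\<bar> d"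
  define q where "q = 2 * (p - 1)"
  have h01: "0 < h" "h \<le> 1"
    using n \<beta> powr_mono[of "- 1 / (\<beta> + 1)" 0 "real n"] by (simp_all add: h)
  have d: "d > 0"
    using h01 by (simp add: d_def)
  have nd: "real n * d = 1 / h"
    unfolding d_def by (rule bandwidth_identity[OF n \<beta> h])
  have M: "M > 0" "\<bar>g x\<bar> \<le> M" "d \<le> M"
    using d by (auto simp: M_def)
  have q: "q \<ge> 0"
    using p by (simp add: q_def)
  \<comment> \<open>From height \<open>s = 1\<close> on, the cone has width at least
    \<open>2 * \<kappa> * h\<close>, and the intensity identity gives the linear exponent. Below
    \<open>s = 1\<close> the cone may be too thin, so the exponent is shifted by 1 and the claim
    becomes trivial there.\<close>
  have expo: "\<kappa> * (s - 1) \<le> real n * (d * s / 2) * min ((d * s / (4 * R)) powr (1 / \<beta>)) (1 / 2)"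
    if s: "s \<ge> 0" for s
  proof (cases "s \<ge> 1")
    case True
    have "(d * s / (4 * R)) powr (1 / \<beta>) = d powr (1 / \<beta>) * s powr (1 / \<beta>) * (1 / (4 * R)) powr (1 / \<beta>)"
      using d s R by (simp add: powr_mult[symmetric])
    also have "d powr (1 / \<beta>) = h"
      using \<beta> h01 by (simp add: d_def powr_powr)
    also have "h * s powr (1 / \<beta>) * (1 / (4 * R)) powr (1 / \<beta>) \<ge> h * 1 * (1 / (4 * R)) powr (1 / \<beta>)"
      using True \<beta> h01 by (intro mult_right_mono mult_left_mono ge_one_powr_ge_zero) auto
    finally have "h * (1 / (4 * R)) powr (1 / \<beta>) \<le> (d * s / (4 * R)) powr (1 / \<beta>)"
      by simp
    moreover have "h * (1 / 2) \<le> 1 / 2"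
      using h01 by simp
    moreover have "h * (2 * \<kappa>) = min (h * (1 / (4 * R)) powr (1 / \<beta>)) (h * (1 / 2))"
      using h01 by (simp add: \<kappa> min_mult_distrib_left)
    ultimately have "h * (2 * \<kappa>) \<le> min ((d * s / (4 * R)) powr (1 / \<beta>)) (1 / 2)"
      by (simp only: min.mono)
    then have le: "(s / (2 * h)) * (h * (2 * \<kappa>)) \<le> (s / (2 * h)) * min ((d * s / (4 * R)) powr (1 / \<beta>)) (1 / 2)"
      using s h01 by (intro mult_left_mono) auto
    have e1: "(s / (2 * h)) * (h * (2 * \<kappa>)) = \<kappa> * s"
      using h01 by simp
    have "s / (2 * h) = s / 2 * (1 / h)"
      by simp
    also have "\<dots> = real n * (d * s / 2)"
      by (simp only: nd[symmetric]) simp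
    finally have e2: "s / (2 * h) = real n * (d * s / 2)" .
    have "\<kappa> * s \<le> real n * (d * s / 2) * min ((d * s / (4 * R)) powr (1 / \<beta>)) (1 / 2)"
      by (rule le[unfolded e1, unfolded e2])
    moreover have "0 \<le> \<kappa>"
      by (simp add: \<kappa>)
    ultimately show ?thesis
      unfolding right_diff_distrib by linarith
  next
    case False
    have "\<kappa> * (s - 1) \<le> 0"
      using False by (intro mult_nonneg_nonpos) (auto simp: \<kappa>)
    also have "0 \<le> real n * (d * s / 2) * min ((d * s / (4 * R)) powr (1 / \<beta>)) (1 / 2)"
      using s d by simp
    finally show ?thesis .
  qed
  let ?f = "\<lambda>y. ennreal (p\<^sup>2 * \<bar>y\<bar> powr q) * emeasure P (void_event (lower_cone \<beta> R (x, y))) * indicator {g x..} y"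
  have m: "?f \<in> borel_measurable borel"
  proof -
    have "(\<lambda>y. emeasure P (void_event (lower_cone \<beta> R (x, y)))) \<in> borel_measurable borel"
      by (rule measurable_compose[OF _ measurable_void_probability]) (rule borel_measurable_Pair, simp_all)
    then show ?thesis
      by simp
  qed
  have "(\<integral>\<^sup>+y. ?f y \<partial>lborel) = ennreal d * (\<integral>\<^sup>+s. ?f (g x + d * s) \<partial>lborel)"
    using nn_integral_real_affine[OF m, of d "g x"] d by simp
  also have "\<dots> \<le> ennreal d * (\<integral>\<^sup>+s. ennreal (p\<^sup>2 * M powr q) * (ennreal ((1 + s) powr q * exp (- \<kappa> * (s - 1))) * indicator {0..} s) \<partial>lborel)"
  proof (intro mult_left_mono nn_integral_mono)
    fix s
    show "?f (g x + d * s) \<le> ennreal (p\<^sup>2 * M powr q) * (ennreal ((1 + s) powr q * exp (- \<kappa> * (s - 1))) * indicator {0..} s)"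
    proof (cases "s \<ge> 0")
      case True
      have "d * s \<le> M * s"
        using M True by (intro mult_right_mono) auto
      then have "\<bar>g x + d * s\<bar> \<le> M * (1 + s)"
        using M True d by (simp add: abs_le_iff distrib_left) (smt (verit) mult_nonneg_nonneg)
      then have "\<bar>g x + d * s\<bar> powr q \<le> (M * (1 + s)) powr q"
        using q by (intro powr_mono2) auto
      also have "\<dots> = M powr q * (1 + s) powr q"
        using M True by (simp add: powr_mult)
      finally have 1: "p\<^sup>2 * \<bar>g x + d * s\<bar> powr q \<le> p\<^sup>2 * (M powr q * (1 + s) powr q)"
        by (rule mult_left_mono) simp
      have "emeasure P (void_event (lower_cone \<beta> R (x, g x + d * s)))
          \<le> ennreal (exp (- (real n * (d * s / 2) * min ((d * s / (4 * R)) powr (1 / \<beta>)) (1 / 2))))"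
        using True d by (intro void_probability_lower_cone[OF x]) simp
      also have "\<dots> \<le> ennreal (exp (- \<kappa> * (s - 1)))"
        using expo[OF True] by (intro ennreal_leI) simp
      finally have "?f (g x + d * s) \<le> ennreal (p\<^sup>2 * (M powr q * (1 + s) powr q)) * ennreal (exp (- \<kappa> * (s - 1)))"
        using 1 True d by (simp add: mult_mono ennreal_leI)
      then show ?thesis
        using True by (simp add: ennreal_mult[symmetric] mult_ac)
    next
      case False
      then have "g x + d * s < g x"
        using d by (simp add: mult_pos_neg)
      then show ?thesis
        by simp
    qed
  qed simp
  also have "\<dots> = ennreal d * (ennreal (p\<^sup>2 * M powr q) * (\<integral>\<^sup>+s\<in>{0..}. ennreal ((1 + s) powr q * exp (- \<kappa> * (s - 1))) \<partial>lborel))"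
    by (subst nn_integral_cmult) auto
  also have "\<dots> \<le> ennreal d * (ennreal (p\<^sup>2 * M powr q) * ennreal K)"
    using K(2) by (intro mult_left_mono) (auto simp: q_def)
  also have "\<dots> = ennreal (p\<^sup>2 * K / d * (d powr 2 * M powr q))"
  proof -
    have "ennreal d * (ennreal (p\<^sup>2 * M powr q) * ennreal K) = ennreal (d * (p\<^sup>2 * M powr q * K))"
      using d K by (subst (1 2) ennreal_mult) auto
    moreover have "d * (p\<^sup>2 * M powr q * K) = p\<^sup>2 * K / d * (d powr 2 * M powr q)"
      using d by (simp add: powr_numeral power2_eq_square)
    ultimately show ?thesis
      by simp
  qed
  also have "\<dots> \<le> ennreal (p\<^sup>2 * K / d * (\<bar>g x\<bar> powr (2 * p) + d powr (2 * p)))"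
  proof (intro ennreal_leI mult_left_mono)
    \<comment> \<open>Replacing \<open>d\<close> by \<open>M\<close> completes the power to
      \<open>2 * p\<close>, and the power of a maximum is at most the sum of the powers.\<close>
    have "d powr 2 * M powr q \<le> M powr 2 * M powr q"
      using M d by (intro mult_right_mono powr_mono2) auto
    also have "\<dots> = M powr (2 * p)"
      by (simp add: powr_add[symmetric] q_def)
    also have "\<dots> \<le> \<bar>g x\<bar> powr (2 * p) + d powr (2 * p)"
      by (simp add: M_def max_def)
    finally show "d powr 2 * M powr q \<le> \<bar>g x\<bar> powr (2 * p) + d powr (2 * p)" .
  qed (use K d in auto)
  also have "d powr (2 * p) = h powr (2 * \<beta> * p)"
    by (simp add: d_def powr_powr mult_ac)
  finally show ?thesis
    by (simp add: q_def d_def)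
qed

text \<open>The kernel bound is integrated over \<open>x\<close>. The intensity contributes
  \<open>n\<close>, the normalisation \<open>1 / n\<^sup>2\<close> and the kernel
  \<open>1 / h powr \<beta>\<close>; by the bandwidth identity they combine to
  \<open>h\<close>.\<close>

lemma nn_integral_F_hat_deviation_sq_le:
  assumes p: "p \<ge> 1" and K: "K \<ge> 0"
    "(\<integral>\<^sup>+s\<in>{0..}. ennreal ((1 + s) powr (2 * (p - 1)) * exp (- \<kappa> * (s - 1))) \<partial>lborel) \<le> ennreal K"
    and \<kappa>: "\<kappa> = min ((1 / (4 * R)) powr (1 / \<beta>)) (1 / 2) / 2"
    and h: "h = real n powr (- 1 / (\<beta> + 1))"
  shows "(\<integral>\<^sup>+\<omega>. ennreal ((F_hat n \<beta> R p \<omega> - (LBINT x:{0..1}. \<bar>g x\<bar> powr p))\<^sup>2) \<partial>P)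
    \<le> ennreal (2 * p\<^sup>2 * K * h * ((LBINT x:{0..1}. \<bar>g x\<bar> powr (2 * p)) + h powr (2 * \<beta> * p)))"
proof -
  have h0: "h > 0"
    using n by (simp add: h)
  let ?c = "p\<^sup>2 * K / h powr \<beta>"
  have c: "?c \<ge> 0"
    using K by simp
  let ?J = "(LBINT x:{0..1}. \<bar>g x\<bar> powr (2 * p)) + h powr (2 * \<beta> * p)"
  have int: "set_integrable lborel {0..1} (\<lambda>x. \<bar>g x\<bar> powr (2 * p))"
    "set_integrable lborel {0..1} (\<lambda>x :: real. h powr (2 * \<beta> * p))"
    using p by (intro set_integrable_abs_powr[OF g_cont], simp)
      (rule set_integrable_unit_interval[where K="h powr (2 * \<beta> * p)"], simp_all)
  have J: "(LBINT x:{0..1}. ?c * (\<bar>g x\<bar> powr (2 * p) + h powr (2 * \<beta> * p))) = ?c * ?J"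
  proof -
    have "(LBINT x:{0..1 :: real}. h powr (2 * \<beta> * p)) = h powr (2 * \<beta> * p)"
      by (simp add: set_lebesgue_integral_def)
    then show ?thesis
      by (simp add: set_integral_add(2)[OF int])
  qed
  have m: "(\<lambda>z. ennreal (p\<^sup>2 * \<bar>snd z\<bar> powr (2 * (p - 1))) * emeasure P (void_event (lower_cone \<beta> R z)))
      \<in> borel_measurable borel"
  proof -
    have "(snd :: real \<times> real \<Rightarrow> real) \<in> borel_measurable borel"
      by (intro borel_measurable_continuous_onI continuous_intros)
    then have "(\<lambda>z :: real \<times> real. ennreal (p\<^sup>2 * \<bar>snd z\<bar> powr (2 * (p - 1)))) \<in> borel_measurable borel"
      by simp
    then show ?thesis
      by (intro borel_measurable_times_ennreal measurable_void_probability)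
  qed
  have "(\<integral>\<^sup>+z. ennreal (p\<^sup>2 * \<bar>snd z\<bar> powr (2 * (p - 1))) * emeasure P (void_event (lower_cone \<beta> R z)) \<partial>intensity)
      = ennreal (real n) * (\<integral>\<^sup>+x\<in>{0..1}. (\<integral>\<^sup>+y\<in>{g x..}. ennreal (p\<^sup>2 * \<bar>y\<bar> powr (2 * (p - 1)))
        * emeasure P (void_event (lower_cone \<beta> R (x, y))) \<partial>lborel) \<partial>lborel)"
    using nn_integral_boundary_intensity[OF g_cont m] by simp
  also have "\<dots> \<le> ennreal (real n) * (\<integral>\<^sup>+x\<in>{0..1}. ennreal (?c * (\<bar>g x\<bar> powr (2 * p) + h powr (2 * \<beta> * p))) \<partial>lborel)"
    using variance_kernel_le[OF p K \<kappa> h]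
    by (intro mult_left_mono nn_integral_mono) (auto simp: indicator_def)
  also have "\<dots> = ennreal (real n) * ennreal (?c * ?J)"
  proof -
    have "(\<integral>\<^sup>+x\<in>{0..1}. ennreal (?c * (\<bar>g x\<bar> powr (2 * p) + h powr (2 * \<beta> * p))) \<partial>lborel)
        = ennreal (LBINT x:{0..1}. ?c * (\<bar>g x\<bar> powr (2 * p) + h powr (2 * \<beta> * p)))"
    proof (rule nn_integral_unit_interval)
      show "set_integrable lborel {0..1} (\<lambda>x. ?c * (\<bar>g x\<bar> powr (2 * p) + h powr (2 * \<beta> * p)))"
        by (intro set_integrable_mult_right impI set_integral_add int)
      show "0 \<le> ?c * (\<bar>g x\<bar> powr (2 * p) + h powr (2 * \<beta> * p))" for x
        by (intro mult_nonneg_nonneg c add_nonneg_nonneg) auto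
    qed
    then show ?thesis
      by (simp only: J)
  qed
  finally have "(\<integral>\<^sup>+\<omega>. ennreal ((F_hat n \<beta> R p \<omega> - (LBINT x:{0..1}. \<bar>g x\<bar> powr p))\<^sup>2) \<partial>P)
      \<le> ennreal (2 / (real n)\<^sup>2) * (ennreal (real n) * ennreal (?c * ?J))"
    using nn_integral_F_hat_deviation_sq[OF p] by (meson mult_left_mono order_trans zero_le)
  also have "\<dots> = ennreal (2 / (real n)\<^sup>2 * (real n * (?c * ?J)))"
    by (simp only: ennreal_mult' ennreal_mult'' of_nat_0_le_iff zero_le_divide_iff zero_le_power2 zero_le_numeral simp_thms)
  also have "2 / (real n)\<^sup>2 * (real n * (?c * ?J)) = 2 * p\<^sup>2 * K * h * ?J"
  proof -
    have "real n * h powr \<beta> = 1 / h"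
      by (rule bandwidth_identity[OF n \<beta> h])
    then have "h = 1 / (real n * h powr \<beta>)"
      by simp
    then have "2 * p\<^sup>2 * K * h * ?J = 2 * p\<^sup>2 * K * (1 / (real n * h powr \<beta>)) * ?J"
      by simp
    then show ?thesis
      using n h0 by (simp add: power2_eq_square)
  qed
  finally show ?thesis .
qed

text \<open>Chebyshev's inequality, stated for a function with values in the unit interval that
  vanishes unless the deviation is large. It thus applies to a test under the null hypothesis and to
  its complement under an alternative.\<close>

lemma expectation_le_of_deviation:
  assumes p: "p \<ge> 1" and V: "(\<integral>\<^sup>+\<omega>. ennreal ((F_hat n \<beta> R p \<omega> - (LBINT x:{0..1}. \<bar>g x\<bar> powr p))\<^sup>2) \<partial>P) \<le> ennreal V" "V \<ge> 0"
    and \<phi>: "\<phi> \<in> borel_measurable config_space" "\<And>\<omega>. \<omega> \<in> configs \<Longrightarrow> 0 \<le> \<phi> \<omega> \<and> \<phi> \<omega> \<le> 1"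
    and \<delta>: "\<delta> > 0"
    and dev: "\<And>\<omega>. \<omega> \<in> configs \<Longrightarrow> \<phi> \<omega> \<noteq> 0 \<Longrightarrow> \<delta> \<le> \<bar>F_hat n \<beta> R p \<omega> - (LBINT x:{0..1}. \<bar>g x\<bar> powr p)\<bar>"
  shows "(LINT \<omega>|P. \<phi> \<omega>) \<le> V / \<delta>\<^sup>2"
proof -
  let ?D = "\<lambda>\<omega>. F_hat n \<beta> R p \<omega> - (LBINT x:{0..1}. \<bar>g x\<bar> powr p)"
  have mD: "?D \<in> borel_measurable P"
    using measurable_F_hat[OF \<beta> R p, of n] by (simp cong: measurable_cong_sets[OF sets_P])
  have m\<phi>: "\<phi> \<in> borel_measurable P"
    using \<phi>(1) by (simp cong: measurable_cong_sets[OF sets_P])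
  have int: "integrable P \<phi>"
    using \<phi>(2) by (intro integrable_const_bound[where B=1] m\<phi> AE_I2) (simp add: space_P)
  have "ennreal (LINT \<omega>|P. \<phi> \<omega>) = (\<integral>\<^sup>+\<omega>. ennreal (\<phi> \<omega>) \<partial>P)"
    using \<phi>(2) int by (intro nn_integral_eq_integral[symmetric] AE_I2) (auto simp: space_P)
  also have "\<dots> \<le> (\<integral>\<^sup>+\<omega>. ennreal (1 / \<delta>\<^sup>2) * ennreal ((?D \<omega>)\<^sup>2) \<partial>P)"
  proof (rule nn_integral_mono)
    fix \<omega> assume "\<omega> \<in> space P"
    then have w: "\<omega> \<in> configs"
      by (simp add: space_P)
    have "\<phi> \<omega> \<le> 1 / \<delta>\<^sup>2 * (?D \<omega>)\<^sup>2"
    proof (cases "\<phi> \<omega> = 0")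
      case False
      have "\<delta>\<^sup>2 \<le> (?D \<omega>)\<^sup>2"
        using dev[OF w False] \<delta> by (metis abs_le_square_iff abs_of_pos)
      then have "1 \<le> 1 / \<delta>\<^sup>2 * (?D \<omega>)\<^sup>2"
        using \<delta> by (simp add: field_simps)
      then show ?thesis
        using \<phi>(2)[OF w] by linarith
    qed simp
    then show "ennreal (\<phi> \<omega>) \<le> ennreal (1 / \<delta>\<^sup>2) * ennreal ((?D \<omega>)\<^sup>2)"
      by (simp add: ennreal_mult[symmetric] ennreal_leI)
  qed
  also have "\<dots> = ennreal (1 / \<delta>\<^sup>2) * (\<integral>\<^sup>+\<omega>. ennreal ((?D \<omega>)\<^sup>2) \<partial>P)"
    using mD by (intro nn_integral_cmult measurable_compose[OF _ measurable_ennreal] borel_measurable_power)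
  also have "\<dots> \<le> ennreal (1 / \<delta>\<^sup>2) * ennreal V"
    by (intro mult_left_mono V) simp
  also have "\<dots> = ennreal (V / \<delta>\<^sup>2)"
    using V by (simp add: ennreal_mult[symmetric])
  finally show ?thesis
    using V by simp
qed

end

section \<open>The variance compared with the squared signal\<close>

lemma powr_le_Lp_integral:
  assumes "p \<ge> 1" "\<rho> > 0" "\<rho> \<le> Lp_norm p g"
  shows "\<rho> powr p \<le> (LBINT x:{0..1}. \<bar>g x\<bar> powr p)"
proof -
  have nonneg: "0 \<le> (LBINT x:{0..1}. \<bar>g x\<bar> powr p)"
    unfolding set_lebesgue_integral_def by (intro integral_nonneg_AE) auto
  have "\<rho> powr p \<le> ((LBINT x:{0..1}. \<bar>g x\<bar> powr p) powr (1 / p)) powr p"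
    using assms unfolding Lp_norm_def by (intro powr_mono2) auto
  also have "\<dots> = (LBINT x:{0..1}. \<bar>g x\<bar> powr p)"
    using assms nonneg by (simp add: powr_powr)
  finally show ?thesis .
qed

text \<open>A Hoelder function that is large somewhere is large on an interval of proportional size.\<close>

lemma Lp_integral_ge:
  assumes "0 < \<beta>" "0 < R" "p \<ge> 1" and g: "g \<in> holder_ball \<beta> R"
    and x: "x \<in> {0..1}" and A: "A = \<bar>g x\<bar>" "A > 0"
  shows "(A / 2) powr p * min (1 / 2) ((A / (2 * R)) powr (1 / \<beta>)) \<le> (LBINT x:{0..1}. \<bar>g x\<bar> powr p)"
proof -
  \<comment> \<open>Within this distance the Hoelder bound lets \<open>g\<close> lose at most half
    of its modulus \<open>A\<close>; the cap \<open>1 / 2\<close> and the choice of side keep the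
    interval inside the unit interval.\<close>
  define \<delta> where "\<delta> = min (1 / 2) ((A / (2 * R)) powr (1 / \<beta>))"
  define a where "a = (if x \<le> 1 / 2 then x else x - \<delta>)"
  have \<delta>: "0 \<le> \<delta>" "\<delta> \<le> 1 / 2"
    by (simp_all add: \<delta>_def)
  have near: "u \<in> {0..1} \<and> A / 2 \<le> \<bar>g u\<bar>" if "u \<in> {a..a + \<delta>}" for u
  proof -
    have u: "u \<in> {0..1}" "\<bar>x - u\<bar> \<le> \<delta>"
      using that \<delta> x by (auto simp: a_def split: if_splits)
    have "\<bar>x - u\<bar> powr \<beta> \<le> ((A / (2 * R)) powr (1 / \<beta>)) powr \<beta>"
      using u assms(1) by (intro powr_mono2) (auto simp: \<delta>_def)
    also have "\<dots> = A / (2 * R)"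
      using assms(1,2) A by (simp add: powr_powr)
    finally have "R * \<bar>x - u\<bar> powr \<beta> \<le> A / 2"
      using assms(2) by (simp add: field_simps)
    then have "\<bar>g x - g u\<bar> \<le> A / 2"
      using holder_ballD[OF g x u(1)] by linarith
    then have "A / 2 \<le> \<bar>g u\<bar>"
      using A(1) by linarith
    then show ?thesis
      using u by simp
  qed
  have "(A / 2) powr p * \<delta> = (\<integral>u. indicator {a..a + \<delta>} u * (A / 2) powr p \<partial>lborel)"
    using \<delta> by simp
  also have "\<dots> \<le> (\<integral>u. indicator {0..1} u *\<^sub>R (\<bar>g u\<bar> powr p) \<partial>lborel)"
  proof (rule integral_mono)
    show "integrable lborel (\<lambda>u. indicator {0..1} u *\<^sub>R (\<bar>g u\<bar> powr p))"
      using set_integrable_abs_powr[OF continuous_on_holder_ball[OF assms(1,2) g], of p] assms(3)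
      by (simp add: set_integrable_def)
    show "indicator {a..a + \<delta>} u * (A / 2) powr p \<le> indicator {0..1} u *\<^sub>R (\<bar>g u\<bar> powr p)" for u
      using near[of u] A assms(3) by (auto simp: indicator_def intro!: powr_mono2)
  qed (intro integrable_mult_left integrable_real_indicator, auto simp: emeasure_lborel_Icc_eq)
  finally show ?thesis
    by (simp add: \<delta>_def set_lebesgue_integral_def)
qed

text \<open>With \<open>A\<close> the maximum of \<open>\<bar>g\<bar>\<close> and \<open>G\<close>
  the integral of its \<open>p\<close>-th power, the ratio is at most
  \<open>h * A powr p / G\<close>. If \<open>A\<close> is small, \<open>G\<close> is bounded below
  by \<open>\<rho> powr p\<close>; if \<open>A\<close> is large, by the mass of the peak. Only the
  first case involves the separation \<open>\<rho>\<close>; the other bound vanishes with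
  \<open>h\<close>.\<close>

lemma Lp_integral_square_ratio:
  assumes "0 < \<beta>" "0 < R" "p \<ge> 1" and g: "g \<in> holder_ball \<beta> R" and h: "0 < h" "h \<le> 1"
    and \<rho>: "\<rho> > 0" "\<rho> powr p \<le> (LBINT x:{0..1}. \<bar>g x\<bar> powr p)"
  shows "h * (LBINT x:{0..1}. \<bar>g x\<bar> powr (2 * p)) / (LBINT x:{0..1}. \<bar>g x\<bar> powr p)\<^sup>2
    \<le> h powr (\<beta> * p + 1 / 2) / \<rho> powr p
      + 2 powr p * (2 * h + (2 * R) powr (1 / \<beta>) * h powr (1 / (2 * p * \<beta>)))"
proof -
  define G where "G = (LBINT x:{0..1}. \<bar>g x\<bar> powr p)"
  have cont: "continuous_on {0..1} g"
    by (rule continuous_on_holder_ball[OF assms(1,2) g])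
  obtain x0 where x0: "x0 \<in> {0..1}" "\<And>x. x \<in> {0..1} \<Longrightarrow> \<bar>g x\<bar> \<le> \<bar>g x0\<bar>"
  proof -
    have "continuous_on {0..1} (\<lambda>x. \<bar>g x\<bar>)"
      using cont by (intro continuous_intros)
    then have "\<exists>x\<in>{0..1}. \<forall>y\<in>{0..1}. \<bar>g y\<bar> \<le> \<bar>g x\<bar>"
      by (intro continuous_attains_sup) auto
    then show thesis
      using that by blast
  qed
  define A where "A = \<bar>g x0\<bar>"
  have G: "G > 0"
    using \<rho> by (auto simp: G_def intro: less_le_trans[of 0 "\<rho> powr p"])
  have intp: "set_integrable lborel {0..1} (\<lambda>x. \<bar>g x\<bar> powr p)"
    "set_integrable lborel {0..1} (\<lambda>x. \<bar>g x\<bar> powr (2 * p))"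
    using assms(3) by (auto intro!: set_integrable_abs_powr[OF cont])
  have "G \<le> (LBINT x:{0..1 :: real}. A powr p)"
    unfolding G_def using x0 assms(3)
    by (intro set_integral_mono intp borel_integrable_atLeastAtMost' continuous_intros)
       (auto simp: A_def intro!: powr_mono2)
  then have "A > 0"
    using G assms(3) by (cases "A = 0") (auto simp: A_def set_lebesgue_integral_def)
  have "(LBINT x:{0..1}. \<bar>g x\<bar> powr (2 * p)) \<le> (LBINT x:{0..1}. A powr p * \<bar>g x\<bar> powr p)"
  proof (intro set_integral_mono intp set_integrable_mult_right impI)
    fix x :: real assume "x \<in> {0..1}"
    then have "\<bar>g x\<bar> powr p * \<bar>g x\<bar> powr p \<le> A powr p * \<bar>g x\<bar> powr p"
      using x0 assms(3) by (intro mult_right_mono powr_mono2) (auto simp: A_def)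
    then show "\<bar>g x\<bar> powr (2 * p) \<le> A powr p * \<bar>g x\<bar> powr p"
      by (simp add: powr_add[symmetric])
  qed
  also have "\<dots> = A powr p * G"
    by (simp add: G_def)
  finally have "h * (LBINT x:{0..1}. \<bar>g x\<bar> powr (2 * p)) / G\<^sup>2 \<le> h * (A powr p * G) / G\<^sup>2"
    using h by (intro divide_right_mono mult_left_mono) auto
  also have "\<dots> = h * A powr p / G"
    using G by (simp add: power2_eq_square)
  also have "\<dots> \<le> h powr (\<beta> * p + 1 / 2) / \<rho> powr p
      + 2 powr p * (2 * h + (2 * R) powr (1 / \<beta>) * h powr (1 / (2 * p * \<beta>)))"
  \<comment> \<open>At this threshold \<open>h * A powr p\<close> equals
    \<open>h powr (\<beta> * p + 1 / 2)\<close>, the \<open>p\<close>-th power of the critical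
    rate.\<close>
  proof (cases "A \<le> h powr (\<beta> - 1 / (2 * p))")
    case True
    have "A powr p \<le> (h powr (\<beta> - 1 / (2 * p))) powr p"
      using True \<open>A > 0\<close> assms(3) by (intro powr_mono2) auto
    also have "\<dots> = h powr (\<beta> * p - 1 / 2)"
      using assms(3) by (simp add: powr_powr left_diff_distrib)
    finally have "h * A powr p \<le> h powr 1 * h powr (\<beta> * p - 1 / 2)"
      using h by (simp add: mult_left_mono)
    also have "\<dots> = h powr (\<beta> * p + 1 / 2)"
      unfolding powr_add[symmetric] by (rule arg_cong[where f="(powr) h"]) simp
    finally have "h * A powr p / G \<le> h powr (\<beta> * p + 1 / 2) / \<rho> powr p"
      using \<rho> G by (intro frac_le) (auto simp: G_def)
    moreover have "0 \<le> 2 powr p * (2 * h + (2 * R) powr (1 / \<beta>) * h powr (1 / (2 * p * \<beta>)))"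
      using h by simp
    ultimately show ?thesis
      by linarith
  next
    case False
    \<comment> \<open>The width of the peak: half of the maximum is kept on an interval of this
      length.\<close>
    let ?w = "min (1 / 2) ((A / (2 * R)) powr (1 / \<beta>))"
    have w: "?w > 0"
      using \<open>A > 0\<close> assms(2) by simp
    have "(A / 2) powr p * ?w \<le> G"
      unfolding G_def by (rule Lp_integral_ge[OF assms(1,2,3) g x0(1) A_def \<open>A > 0\<close>])
    then have "h * A powr p / G \<le> h * A powr p / ((A / 2) powr p * ?w)"
      using h w \<open>A > 0\<close> G by (intro divide_left_mono mult_pos_pos) auto
    also have "\<dots> = 2 powr p * (h * (1 / ?w))"
      using \<open>A > 0\<close> by (simp add: powr_divide)
    also have "1 / ?w \<le> 2 + (2 * R / A) powr (1 / \<beta>)"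
      using \<open>A > 0\<close> assms(2) by (auto simp: min_def powr_divide)
    also have "(2 * R / A) powr (1 / \<beta>) \<le> (2 * R / h powr (\<beta> - 1 / (2 * p))) powr (1 / \<beta>)"
      using False h assms \<open>A > 0\<close> by (intro powr_mono2 divide_left_mono) auto
    also have "\<dots> = (2 * R) powr (1 / \<beta>) * h powr (- (\<beta> - 1 / (2 * p)) * (1 / \<beta>))"
    proof -
      have e: "- (\<beta> - 1 / (2 * p)) * (1 / \<beta>) = - ((\<beta> - 1 / (2 * p)) / \<beta>)"
        by (simp only: mult_minus_left times_divide_eq_right mult_1_right)
      show ?thesis
        unfolding e powr_minus_divide using assms(2) h by (simp add: powr_divide powr_powr)
    qed
    finally have "h * A powr p / G \<le> 2 powr p * (h * (2 + (2 * R) powr (1 / \<beta>) * h powr (- (\<beta> - 1 / (2 * p)) * (1 / \<beta>))))"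
      using h by (simp add: mult_left_mono)
    also have "\<dots> = 2 powr p * (2 * h + (2 * R) powr (1 / \<beta>) * (h powr 1 * h powr (- (\<beta> - 1 / (2 * p)) * (1 / \<beta>))))"
      using h by (simp add: algebra_simps)
    also have "h powr 1 * h powr (- (\<beta> - 1 / (2 * p)) * (1 / \<beta>)) = h powr (1 / (2 * p * \<beta>))"
      unfolding powr_add[symmetric] using assms(1) by (simp add: field_simps)
    finally have "h * A powr p / G \<le> 2 powr p * (2 * h + (2 * R) powr (1 / \<beta>) * h powr (1 / (2 * p * \<beta>)))" .
    moreover have "0 \<le> h powr (\<beta> * p + 1 / 2) / \<rho> powr p"
      by simp
    ultimately show ?thesis
      by linarith
  qed
  finally show ?thesis
    by (simp add: G_def)
qed

section \<open>Error bounds for the plug-in test\<close>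

lemma zero_in_holder_ball: "0 < R \<Longrightarrow> (\<lambda>_. 0) \<in> holder_ball \<beta> R"
  by (simp add: holder_ball_def)

lemma alternatives_nonempty:
  assumes "0 < R" "p \<ge> 1" "\<rho> > 0"
  shows "(\<lambda>_. \<rho>) \<in> alternatives \<beta> R p \<rho>"
proof -
  have "Lp_norm p (\<lambda>_. \<rho>) = \<rho>"
    using assms by (simp add: Lp_norm_def set_lebesgue_integral_def powr_powr)
  then show ?thesis
    using assms by (simp add: alternatives_def holder_ball_def)
qed

lemma critical_rate_powr:
  assumes "0 < \<beta>" "p \<ge> 1" and h: "h = real n powr (- 1 / (\<beta> + 1))"
  shows "critical_rate \<beta> p n powr p = h powr (\<beta> * p + 1 / 2)"
proof -
  have eq: "- ((\<beta> + 1 / (2 * p)) / (\<beta> + 1)) * p = - 1 / (\<beta> + 1) * (\<beta> * p + 1 / 2)"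
  proof -
    have "(\<beta> + 1 / (2 * p)) * p = \<beta> * p + 1 / 2"
      using assms(2) by (simp add: field_simps)
    then show ?thesis
      by simp
  qed
  show ?thesis
    unfolding critical_rate_def h powr_powr by (simp only: eq)
qed

lemma tests_integral_bounds:
  assumes "prob_space P" "sets P = sets config_space" "\<psi> \<in> tests"
  shows "integrable P \<psi>" "0 \<le> (LINT \<omega>|P. \<psi> \<omega>)" "0 \<le> (LINT \<omega>|P. 1 - \<psi> \<omega>)" "(LINT \<omega>|P. 1 - \<psi> \<omega>) \<le> 1"
    "(LINT \<omega>|P. 1 - \<psi> \<omega>) = 1 - (LINT \<omega>|P. \<psi> \<omega>)"
proof -
  interpret prob_space P by fact
  have sp: "space P = configs"
    using sets_eq_imp_space_eq[OF assms(2)] by simp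
  have \<psi>: "0 \<le> \<psi> \<omega>" "\<psi> \<omega> \<le> 1" if "\<omega> \<in> space P" for \<omega>
    using assms(3) that by (auto simp: tests_def sp)
  have m: "\<psi> \<in> borel_measurable P"
    using assms(3) by (simp add: tests_def cong: measurable_cong_sets[OF assms(2)])
  show int: "integrable P \<psi>"
    using \<psi> by (intro integrable_const_bound[where B=1] m AE_I2) simp
  show nonneg: "0 \<le> (LINT \<omega>|P. \<psi> \<omega>)"
    using \<psi> by (intro integral_nonneg_AE AE_I2)
  show "0 \<le> (LINT \<omega>|P. 1 - \<psi> \<omega>)"
    using \<psi> by (intro integral_nonneg_AE AE_I2) simp
  show eq: "(LINT \<omega>|P. 1 - \<psi> \<omega>) = 1 - (LINT \<omega>|P. \<psi> \<omega>)"
    using int by (simp add: prob_space)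
  show "(LINT \<omega>|P. 1 - \<psi> \<omega>) \<le> 1"
    using eq nonneg by simp
qed

text \<open>The factor 8 is the 2 of the variance bound times the 4 from putting the threshold at
  half of the signal. The bound depends on \<open>n\<close> only through \<open>h\<close> and
  \<open>q\<close>, and is uniform over the alternatives.\<close>

lemma plugin_test_error_bounds:
  assumes \<beta>: "0 < \<beta>" and R: "0 < R" and p: "p \<ge> 1" and \<rho>: "\<rho> > 0" and n: "n \<ge> 1"
    and K: "K \<ge> 0"
    "(\<integral>\<^sup>+s\<in>{0..}. ennreal ((1 + s) powr (2 * (p - 1)) * exp (- \<kappa> * (s - 1))) \<partial>lborel) \<le> ennreal K"
    and \<kappa>: "\<kappa> = min ((1 / (4 * R)) powr (1 / \<beta>)) (1 / 2) / 2"
    and h: "h = real n powr (- 1 / (\<beta> + 1))"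
    and law: "\<And>g. g \<in> holder_ball \<beta> R \<Longrightarrow> poisson_process_law (boundary_intensity n g) (law g)"
    and q: "q = (critical_rate \<beta> p n / \<rho>) powr p"
  shows "0 \<le> testing_error law (alternatives \<beta> R p \<rho>) (plugin_test n \<beta> R p \<rho>)"
    and "testing_error law (alternatives \<beta> R p \<rho>) (plugin_test n \<beta> R p \<rho>)
      \<le> 8 * p\<^sup>2 * K * (q + 2 * q\<^sup>2 + 2 powr p * (2 * h + (2 * R) powr (1 / \<beta>) * h powr (1 / (2 * p * \<beta>))))"
proof -
  let ?\<psi> = "plugin_test n \<beta> R p \<rho>" and ?\<G> = "alternatives \<beta> R p \<rho>"
  let ?E = "2 powr p * (2 * h + (2 * R) powr (1 / \<beta>) * h powr (1 / (2 * p * \<beta>)))"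
  have test: "?\<psi> \<in> tests"
    by (rule plugin_test_in_tests[OF \<beta> R p])
  have bm: "boundary_model \<beta> R n g (law g)" if "g \<in> holder_ball \<beta> R" for g
    using that \<beta> R n law by (simp add: boundary_model_def)
  have ps: "prob_space (law g)" "sets (law g) = sets config_space" if "g \<in> holder_ball \<beta> R" for g
    using law[OF that] by (simp_all add: poisson_process_law_def)
  have h01: "0 < h" "h \<le> 1"
    using n \<beta> powr_mono[of "- 1 / (\<beta> + 1)" 0 "real n"] by (simp_all add: h)
  have q_eq: "q = h powr (\<beta> * p + 1 / 2) / \<rho> powr p"
    using critical_rate_powr[OF \<beta> p h] \<rho> by (simp add: q powr_divide critical_rate_def)
  \<comment> \<open>The part of the variance that remains at \<open>g = 0\<close> is, up to a
    constant, the critical rate to the power \<open>2 * p\<close>. This is the origin of the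
    rate.\<close>
  have q2: "h * h powr (2 * \<beta> * p) = (h powr (\<beta> * p + 1 / 2))\<^sup>2"
  proof -
    have "h * h powr (2 * \<beta> * p) = h powr 1 * h powr (2 * \<beta> * p)"
      using h01 by simp
    also have "\<dots> = h powr (\<beta> * p + 1 / 2) * h powr (\<beta> * p + 1 / 2)"
      unfolding powr_add[symmetric] by (simp add: algebra_simps)
    finally show ?thesis
      by (simp add: power2_eq_square)
  qed
  have nonempty: "?\<G> \<noteq> {}"
    using alternatives_nonempty[OF R p \<rho>] by blast
  have alt: "g \<in> holder_ball \<beta> R" "\<rho> \<le> Lp_norm p g" if "g \<in> ?\<G>" for g
    using that by (simp_all add: alternatives_def)
  have bdd: "bdd_above ((\<lambda>g. LINT \<omega>|law g. 1 - ?\<psi> \<omega>) ` ?\<G>)"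
    using tests_integral_bounds(4)[OF ps test] alt by (intro bdd_aboveI2[where M=1]) blast
  have type1: "(LINT \<omega>|law (\<lambda>_. 0). ?\<psi> \<omega>) \<le> 8 * p\<^sup>2 * K * q\<^sup>2"
  proof -
    interpret boundary_model \<beta> R n "\<lambda>_. 0" "law (\<lambda>_. 0)"
      by (rule bm[OF zero_in_holder_ball[OF R]])
    have "(LINT \<omega>|law (\<lambda>_. 0). ?\<psi> \<omega>)
        \<le> 2 * p\<^sup>2 * K * h * ((LBINT x:{0..1::real}. \<bar>0\<bar> powr (2 * p)) + h powr (2 * \<beta> * p)) / (\<rho> powr p / 2)\<^sup>2"
    proof (rule expectation_le_of_deviation[OF p nn_integral_F_hat_deviation_sq_le[OF p K \<kappa> h]])
      show "?\<psi> \<in> borel_measurable config_space" "\<And>\<omega>. \<omega> \<in> configs \<Longrightarrow> 0 \<le> ?\<psi> \<omega> \<and> ?\<psi> \<omega> \<le> 1"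
        using test by (simp_all add: tests_def)
      show "\<rho> powr p / 2 \<le> \<bar>F_hat n \<beta> R p \<omega> - (LBINT x:{0..1::real}. \<bar>0\<bar> powr p)\<bar>" if "?\<psi> \<omega> \<noteq> 0" for \<omega>
        using that p by (simp add: plugin_test_def set_lebesgue_integral_def)
    qed (use K h01 \<rho> in \<open>auto simp: set_lebesgue_integral_def\<close>)
    also have "\<dots> = 8 * p\<^sup>2 * K * (h * h powr (2 * \<beta> * p)) / (\<rho> powr p)\<^sup>2"
      by (simp add: set_lebesgue_integral_def power_divide)
    also have "\<dots> = 8 * p\<^sup>2 * K * q\<^sup>2"
      unfolding q2 q_eq by (simp add: power_divide)
    finally show ?thesis .
  qed
  have type2: "(LINT \<omega>|law g. 1 - ?\<psi> \<omega>) \<le> 8 * p\<^sup>2 * K * (q + ?E + q\<^sup>2)" if gA: "g \<in> ?\<G>" for g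
  proof -
    interpret boundary_model \<beta> R n g "law g"
      by (rule bm[OF alt(1)[OF gA]])
    define G where "G = (LBINT x:{0..1}. \<bar>g x\<bar> powr p)"
    define J where "J = (LBINT x:{0..1}. \<bar>g x\<bar> powr (2 * p))"
    have \<rho>G: "\<rho> powr p \<le> G"
      unfolding G_def by (rule powr_le_Lp_integral[OF p \<rho> alt(2)[OF gA]])
    have "0 < \<rho> powr p"
      using \<rho> by simp
    then have G: "G > 0"
      using \<rho>G by linarith
    have J: "J \<ge> 0"
      unfolding J_def set_lebesgue_integral_def by (intro integral_nonneg_AE) auto
    have "(LINT \<omega>|law g. 1 - ?\<psi> \<omega>) \<le> 2 * p\<^sup>2 * K * h * (J + h powr (2 * \<beta> * p)) / (G / 2)\<^sup>2"
      unfolding J_def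
    proof (rule expectation_le_of_deviation[OF p nn_integral_F_hat_deviation_sq_le[OF p K \<kappa> h]])
      show "(\<lambda>\<omega>. 1 - ?\<psi> \<omega>) \<in> borel_measurable config_space"
        using test by (intro borel_measurable_diff measurable_const) (simp_all add: tests_def)
      show "0 \<le> 1 - ?\<psi> \<omega> \<and> 1 - ?\<psi> \<omega> \<le> 1" for \<omega>
        by (simp add: plugin_test_def)
      \<comment> \<open>A missed alternative has an estimate below \<open>\<rho> powr p / 2\<close>,
        hence below \<open>G / 2\<close>. Keeping \<open>G\<close> here, instead of
        \<open>\<rho> powr p\<close>, lets the variance, which grows with \<open>g\<close>, be
        divided by the actual squared signal.\<close>
      show "G / 2 \<le> \<bar>F_hat n \<beta> R p \<omega> - (LBINT x:{0..1}. \<bar>g x\<bar> powr p)\<bar>" if "1 - ?\<psi> \<omega> \<noteq> 0" for \<omega>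
      proof -
        have "F_hat n \<beta> R p \<omega> < \<rho> powr p / 2"
          using that by (simp add: plugin_test_def of_bool_def split: if_splits)
        then show ?thesis
          using \<rho>G unfolding G_def[symmetric] by linarith
      qed
    qed (use K h01 J G in \<open>auto simp: J_def\<close>)
    also have "\<dots> = 8 * p\<^sup>2 * K * (h * J / G\<^sup>2 + h * h powr (2 * \<beta> * p) / G\<^sup>2)"
      using G by (simp add: power_divide field_simps)
    also have "\<dots> \<le> 8 * p\<^sup>2 * K * ((q + ?E) + q\<^sup>2)"
    proof (intro mult_left_mono add_mono)
      show "h * J / G\<^sup>2 \<le> q + ?E"
        unfolding q_eq J_def G_def
        by (rule Lp_integral_square_ratio[OF \<beta> R p alt(1)[OF gA] h01 \<rho> \<rho>G[unfolded G_def]])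
      have "(h powr (\<beta> * p + 1 / 2))\<^sup>2 / G\<^sup>2 \<le> (h powr (\<beta> * p + 1 / 2))\<^sup>2 / (\<rho> powr p)\<^sup>2"
        using \<rho>G \<rho> G by (intro divide_left_mono power_mono mult_pos_pos zero_less_power) auto
      then show "h * h powr (2 * \<beta> * p) / G\<^sup>2 \<le> q\<^sup>2"
        by (simp add: q2 q_eq power_divide)
    qed (use K in auto)
    finally show ?thesis .
  qed
  obtain g where g: "g \<in> ?\<G>"
    using nonempty by blast
  have "0 \<le> (LINT \<omega>|law g. 1 - ?\<psi> \<omega>)"
    by (rule tests_integral_bounds(3)[OF ps[OF alt(1)[OF g]] test])
  also have "\<dots> \<le> (SUP g\<in>?\<G>. LINT \<omega>|law g. 1 - ?\<psi> \<omega>)"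
    by (rule cSUP_upper[OF g bdd])
  finally show "0 \<le> testing_error law ?\<G> ?\<psi>"
    unfolding testing_error_def
    using tests_integral_bounds(2)[OF ps[OF zero_in_holder_ball[OF R]] test] by linarith
  have "(SUP g\<in>?\<G>. LINT \<omega>|law g. 1 - ?\<psi> \<omega>) \<le> 8 * p\<^sup>2 * K * (q + ?E + q\<^sup>2)"
    by (rule cSUP_least[OF nonempty type2])
  then have "testing_error law ?\<G> ?\<psi> \<le> 8 * p\<^sup>2 * K * q\<^sup>2 + 8 * p\<^sup>2 * K * (q + ?E + q\<^sup>2)"
    unfolding testing_error_def using type1 by linarith
  also have "\<dots> = 8 * p\<^sup>2 * K * (q + 2 * q\<^sup>2 + ?E)"
    by (simp add: algebra_simps)
  finally show "testing_error law ?\<G> ?\<psi> \<le> 8 * p\<^sup>2 * K * (q + 2 * q\<^sup>2 + ?E)" .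
qed

theorem plugin_test_consistent:
  fixes law :: "nat \<Rightarrow> (real \<Rightarrow> real) \<Rightarrow> config measure"
  assumes \<beta>: "0 < \<beta>" and R: "0 < R" and p: "p \<ge> 1"
    and r: "\<And>n. n \<ge> 1 \<Longrightarrow> r n > 0"
    and law: "\<And>n g. n \<ge> 1 \<Longrightarrow> g \<in> holder_ball \<beta> R \<Longrightarrow>
      poisson_process_law (boundary_intensity n g) (law n g)"
    and rate: "filterlim (\<lambda>n. r n / critical_rate \<beta> p n) at_top sequentially"
  shows "(\<lambda>n. testing_error (law n) (alternatives \<beta> R p (r n)) (plugin_test n \<beta> R p (r n))) \<longlonglongrightarrow> 0"
proof -
  define \<kappa> where "\<kappa> = min ((1 / (4 * R)) powr (1 / \<beta>)) (1 / 2) / 2"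
  have "\<kappa> > 0"
    using R by (simp add: \<kappa>_def)
  then obtain K where K: "K \<ge> 0"
    "(\<integral>\<^sup>+s\<in>{0..}. ennreal ((1 + s) powr (2 * (p - 1)) * exp (- \<kappa> * (s - 1))) \<partial>lborel) \<le> ennreal K"
    using nn_integral_powr_exp_finite[of \<kappa> "2 * (p - 1)"] p by auto
  define h where "h = (\<lambda>n. real n powr (- 1 / (\<beta> + 1)))"
  define q where "q = (\<lambda>n. (critical_rate \<beta> p n / r n) powr p)"
  let ?b = "\<lambda>n. 8 * p\<^sup>2 * K * (q n + 2 * (q n)\<^sup>2
    + 2 powr p * (2 * h n + (2 * R) powr (1 / \<beta>) * h n powr (1 / (2 * p * \<beta>))))"
  have h0: "h \<longlonglongrightarrow> 0"
    unfolding h_def using \<beta>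
    by (intro tendsto_neg_powr filterlim_real_sequentially) (simp add: divide_neg_pos)
  have "(\<lambda>n. inverse (r n / critical_rate \<beta> p n)) \<longlonglongrightarrow> 0"
    by (rule filterlim_compose[OF tendsto_inverse_0_at_top[OF filterlim_ident] rate])
  then have q0: "q \<longlonglongrightarrow> 0"
    unfolding q_def using p
    by (intro tendsto_zero_powrI[OF _ tendsto_const])
       (auto intro!: eventually_sequentiallyI[of 1] divide_nonneg_nonneg dest: r simp: critical_rate_def less_imp_le[OF r])
  have h1: "(\<lambda>n. h n powr (1 / (2 * p * \<beta>))) \<longlonglongrightarrow> 0"
    using h0 p \<beta> by (intro tendsto_zero_powrI[OF _ tendsto_const]) (auto simp: h_def)
  have "?b \<longlonglongrightarrow> 8 * p\<^sup>2 * K * (0 + 2 * 0\<^sup>2 + 2 powr p * (2 * 0 + (2 * R) powr (1 / \<beta>) * 0))"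
    by (intro tendsto_intros q0 h0 h1)
  then have "?b \<longlonglongrightarrow> 0"
    by simp
  then show ?thesis
  proof (rule tendsto_sandwich[OF _ _ tendsto_const, rotated 2])
    note bounds = plugin_test_error_bounds[OF \<beta> R p r _ K \<kappa>_def _ law]
    show "eventually (\<lambda>n. 0 \<le> testing_error (law n) (alternatives \<beta> R p (r n)) (plugin_test n \<beta> R p (r n))) sequentially"
      by (intro eventually_sequentiallyI[of 1] bounds(1)[OF _ _ refl _ _ refl])
    show "eventually (\<lambda>n. testing_error (law n) (alternatives \<beta> R p (r n)) (plugin_test n \<beta> R p (r n)) \<le> ?b n) sequentially"
      by (intro eventually_sequentiallyI[of 1] bounds(2)) (simp_all add: h_def q_def)
  qed
qed

section \<open>The lower bound\<close>

text \<open>Strict at the top, matching the weak inequality in the intensity: the points with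
  nonnegative height over the unit interval outside \<open>subgraph g\<close> are those on or above
  both the axis and \<open>g\<close>.\<close>

definition subgraph :: "(real \<Rightarrow> real) \<Rightarrow> (real \<times> real) set" where
  "subgraph g = {z \<in> strip. 0 \<le> snd z \<and> snd z < g (fst z)}"

lemma sets_subgraph:
  assumes "continuous_on {0..1} g"
  shows "subgraph g \<in> sets borel"
proof -
  have "subgraph g = strip \<inter> {z. 0 \<le> snd z} - {z. clamped g (fst z) \<le> snd z}"
    by (auto simp: subgraph_def clamped_eq)
  moreover have "{z :: real \<times> real. 0 \<le> snd z} \<in> sets borel"
    using sets_epigraph[of "\<lambda>_. 0"] by simp
  moreover have "{z. clamped g (fst z) \<le> snd z} \<in> sets borel"
    by (intro sets_epigraph borel_measurable_continuous_onI continuous_on_clamped assms)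
  ultimately show ?thesis
    by (simp only: sets.Diff sets.Int sets_strip)
qed

text \<open>Outside the subgraph the two intensities agree because \<open>g\<close> is nonnegative.
  Unions appear because intersecting void events unites the avoided sets.\<close>

lemma boundary_intensity_Un_subgraph:
  assumes g: "continuous_on {0..1} g" "\<And>x. x \<in> {0..1} \<Longrightarrow> 0 \<le> g x" and B: "B \<in> sets borel"
  shows "emeasure (boundary_intensity n (\<lambda>_. 0)) (B \<union> subgraph g)
    = emeasure (boundary_intensity n (\<lambda>_. 0)) (subgraph g) + emeasure (boundary_intensity n g) B"
proof -
  have c0: "continuous_on {0..1} (\<lambda>_ :: real. 0 :: real)"
    by simp
  have D: "subgraph g \<in> sets borel"
    by (rule sets_subgraph[OF g(1)])
  have "emeasure (boundary_intensity n (\<lambda>_. 0)) (B \<union> subgraph g)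
      = emeasure (boundary_intensity n (\<lambda>_. 0)) (subgraph g \<union> (B - subgraph g))"
    by (rule arg_cong2[where f=emeasure]) auto
  also have "\<dots> = emeasure (boundary_intensity n (\<lambda>_. 0)) (subgraph g)
      + emeasure (boundary_intensity n (\<lambda>_. 0)) (B - subgraph g)"
    using B D by (intro plus_emeasure[symmetric]) (auto simp: sets_boundary_intensity)
  also have "emeasure (boundary_intensity n (\<lambda>_. 0)) (B - subgraph g) = emeasure (boundary_intensity n g) B"
  proof -
    have "emeasure lborel {y. 0 \<le> y \<and> (x, y) \<in> B - subgraph g} * indicator {0..1} x
        = emeasure lborel {y. g x \<le> y \<and> (x, y) \<in> B} * indicator {0..1} x" for x
    proof (cases "x \<in> {0..1}")
      case True
      then have "{y. 0 \<le> y \<and> (x, y) \<in> B - subgraph g} = {y. g x \<le> y \<and> (x, y) \<in> B}"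
        using g(2)[OF True] by (auto simp: subgraph_def)
      then show ?thesis
        by simp
    qed simp
    then show ?thesis
      unfolding emeasure_boundary_intensity[OF c0 sets.Diff[OF B D]] emeasure_boundary_intensity[OF g(1) B]
      by simp
  qed
  finally show ?thesis .
qed

text \<open>Raising the boundary from \<open>0\<close> to \<open>g\<close> amounts to conditioning on the absence of points
  between the two boundaries.\<close>

lemma boundary_law_eq_density:
  assumes P0: "boundary_model \<beta> R n (\<lambda>_. 0) P0" and P: "boundary_model \<beta> R n g P"
    and nonneg: "\<And>x. x \<in> {0..1} \<Longrightarrow> 0 \<le> g x"
  shows "P = density P0 (\<lambda>\<omega>. ennreal (exp (measure (boundary_intensity n (\<lambda>_. 0)) (subgraph g))
    * indicator (void_event (subgraph g)) \<omega>))"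
    (is "_ = ?Q")
proof -
  interpret P0: boundary_model \<beta> R n "\<lambda>_. 0" P0 by fact
  interpret P: boundary_model \<beta> R n g P by fact
  let ?D = "subgraph g"
  have D: "?D \<in> sets borel"
    by (rule sets_subgraph[OF P.g_cont])
  have D_below: "?D \<subseteq> below (\<bar>g 0\<bar> + R)"
    using P.g_bounded by (force simp: subgraph_def mem_Times_iff)
  have void: "emeasure P (void_event B) = emeasure ?Q (void_event B)"
    if B: "B \<in> sets borel" "B \<subseteq> below c" for B c
  proof -
    have U: "B \<union> ?D \<in> sets borel" "B \<union> ?D \<subseteq> below (max c (\<bar>g 0\<bar> + R))"
      using B D D_below by (auto simp: mem_Times_iff subset_iff le_max_iff_disj)
    note fin = P0.finite_intensity[OF U(2)] P0.finite_intensity[OF D_below] P.finite_intensity[OF B(2)]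
    \<comment> \<open>In the void probability of the union the subgraph splits off as a factor,
      which the normalising exponential of the density removes.\<close>
    have sum: "measure P0.intensity (B \<union> ?D) = measure P0.intensity ?D + measure P.intensity B"
    proof -
      have "emeasure P0.intensity (B \<union> ?D) = emeasure P0.intensity ?D + emeasure P.intensity B"
        by (rule boundary_intensity_Un_subgraph[OF P.g_cont nonneg B(1)])
      then show ?thesis
        using fin by (simp add: measure_def enn2real_plus)
    qed
    have m: "(\<lambda>\<omega>. ennreal (exp (measure P0.intensity ?D) * indicator (void_event ?D) \<omega>)) \<in> borel_measurable P0"
      using sets_void_event[OF D] by (simp add: P0.sets_P)
    have "emeasure ?Q (void_event B)
        = (\<integral>\<^sup>+\<omega>. ennreal (exp (measure P0.intensity ?D) * indicator (void_event ?D) \<omega>) * indicator (void_event B) \<omega> \<partial>P0)"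
      using sets_void_event[OF B(1)] by (intro emeasure_density m) (simp add: P0.sets_P)
    also have "\<dots> = (\<integral>\<^sup>+\<omega>. ennreal (exp (measure P0.intensity ?D)) * indicator (void_event (B \<union> ?D)) \<omega> \<partial>P0)"
      unfolding void_event_Int[symmetric] by (intro nn_integral_cong) (auto simp: indicator_def)
    also have "\<dots> = ennreal (exp (measure P0.intensity ?D)) * emeasure P0 (void_event (B \<union> ?D))"
      using sets_void_event[OF U(1)] by (intro nn_integral_cmult_indicator) (simp add: P0.sets_P)
    also have "\<dots> = ennreal (exp (measure P0.intensity ?D) * exp (- measure P0.intensity (B \<union> ?D)))"
      by (simp add: P0.emeasure_eq_measure P0.void_probability[OF U] ennreal_mult)
    also have "exp (measure P0.intensity ?D) * exp (- measure P0.intensity (B \<union> ?D)) = exp (- measure P.intensity B)"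
      unfolding sum exp_add[symmetric] by simp
    also have "ennreal \<dots> = emeasure P (void_event B)"
      by (simp add: P.emeasure_eq_measure P.void_probability[OF B])
    finally show ?thesis ..
  qed
  show ?thesis
  proof (rule measure_eqI_generator_eq[OF Int_stable_bounded_voids bounded_voids_subset, where A="\<lambda>_. configs"])
    show "emeasure P X = emeasure ?Q X" if "X \<in> bounded_voids" for X
      using that void by (auto simp: bounded_voids_def)
    show "sets P = sigma_sets configs bounded_voids" "sets ?Q = sigma_sets configs bounded_voids"
      by (simp_all add: P.sets_P P0.sets_P sets_config_space_voids)
    show "emeasure P configs \<noteq> \<infinity>" for i :: nat
      by (simp add: P.emeasure_eq_measure)
  qed (use configs_in_bounded_voids in auto)
qed

lemma integral_boundary_law:
  assumes P0: "boundary_model \<beta> R n (\<lambda>_. 0) P0" and P: "boundary_model \<beta> R n g P"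
    and nonneg: "\<And>x. x \<in> {0..1} \<Longrightarrow> 0 \<le> g x" and \<phi>: "\<phi> \<in> borel_measurable config_space"
  shows "(LINT \<omega>|P. \<phi> \<omega>) = (LINT \<omega>|P0. exp (measure (boundary_intensity n (\<lambda>_. 0)) (subgraph g))
    * indicator (void_event (subgraph g)) \<omega> * \<phi> \<omega>)"
proof -
  interpret P0: boundary_model \<beta> R n "\<lambda>_. 0" P0 by fact
  interpret P: boundary_model \<beta> R n g P by fact
  have "void_event (subgraph g) \<in> sets P0"
    using sets_void_event[OF sets_subgraph[OF P.g_cont]] by (simp add: P0.sets_P)
  moreover have "\<phi> \<in> borel_measurable P0"
    using \<phi> by (simp cong: measurable_cong_sets[OF P0.sets_P])
  ultimately show ?thesis
    by (subst boundary_law_eq_density[OF P0 P nonneg], simp, subst integral_density) auto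
qed

text \<open>Le Cam's method for a uniform mixture: by Cauchy--Schwarz the total testing error is
  controlled by the second moment of the mixture likelihood ratio, and void probabilities turn the
  latter into exponentials of the intensity of the overlaps.\<close>

lemma testing_error_mixture_ge:
  fixes G :: "'i \<Rightarrow> real \<Rightarrow> real"
  assumes \<beta>: "0 < \<beta>" and R: "0 < R" and n: "n \<ge> 1"
    and law: "\<And>g. g \<in> holder_ball \<beta> R \<Longrightarrow> poisson_process_law (boundary_intensity n g) (law g)"
    and F: "finite F" "F \<noteq> {}"
    and G: "\<And>f. f \<in> F \<Longrightarrow> G f \<in> alternatives \<beta> R p \<rho>"
    and nonneg: "\<And>f x. f \<in> F \<Longrightarrow> x \<in> {0..1} \<Longrightarrow> 0 \<le> G f x"
    and overlap: "(\<Sum>f\<in>F. \<Sum>f'\<in>F. exp (measure (boundary_intensity n (\<lambda>_. 0)) (subgraph (G f) \<inter> subgraph (G f'))))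
      \<le> (1 + e) * (real (card F))\<^sup>2"
    and \<psi>: "\<psi> \<in> tests"
  shows "1 - sqrt e \<le> testing_error law (alternatives \<beta> R p \<rho>) \<psi>"
proof -
  let ?\<G> = "alternatives \<beta> R p \<rho>" and ?\<Lambda> = "boundary_intensity n (\<lambda>_. 0)"
  define P0 where "P0 = law (\<lambda>_. 0)"
  have bm: "boundary_model \<beta> R n g (law g)" if "g \<in> holder_ball \<beta> R" for g
    using that \<beta> R n law by (simp add: boundary_model_def)
  have ps: "prob_space (law g)" "sets (law g) = sets config_space" if "g \<in> holder_ball \<beta> R" for g
    using law[OF that] by (simp_all add: poisson_process_law_def)
  have alt: "g \<in> holder_ball \<beta> R" if "g \<in> ?\<G>" for g
    using that by (simp add: alternatives_def)
  note bm0 = bm[OF zero_in_holder_ball[OF R], folded P0_def]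
  interpret P0: boundary_model \<beta> R n "\<lambda>_. 0" P0
    by (rule bm0)
  note \<psi>0 = tests_integral_bounds[OF ps[OF zero_in_holder_ball[OF R]] \<psi>, folded P0_def]
  let ?N = "real (card F)"
  have N: "?N > 0"
    using F by (simp add: card_gt_0_iff)
  define D where "D f = subgraph (G f)" for f
  have cont: "continuous_on {0..1} (G f)" if "f \<in> F" for f
    by (rule continuous_on_holder_ball[OF \<beta> R alt[OF G[OF that]]])
  have D: "D f \<in> sets borel" if "f \<in> F" for f
    unfolding D_def by (rule sets_subgraph[OF cont[OF that]])
  have D_below: "D f \<subseteq> below (\<bar>G f 0\<bar> + R)" if "f \<in> F" for f
    using boundary_model.g_bounded[OF bm[OF alt[OF G[OF that]]]]
    by (force simp: D_def subgraph_def mem_Times_iff)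
  have vD: "void_event (D f) \<in> sets P0" if "f \<in> F" for f
    using sets_void_event[OF D[OF that]] by (simp add: P0.sets_P)
  \<comment> \<open>The likelihood ratio of the law with boundary \<open>G f\<close> against the
    null law; \<open>L'\<close> is that of the uniform mixture.\<close>
  define L where "L f \<omega> = exp (measure ?\<Lambda> (D f)) * indicator (void_event (D f)) \<omega>" for f \<omega>
  define L' where "L' \<omega> = (\<Sum>f\<in>F. L f \<omega>) / ?N" for \<omega>
  have L_int: "integrable P0 (L f)" if "f \<in> F" for f
    unfolding L_def using vD[OF that] by (intro integrable_mult_right integrable_real_indicator) (auto simp: P0.emeasure_eq_measure)
  have L_mult: "(LINT \<omega>|P0. L f \<omega> * L f' \<omega>) = exp (measure ?\<Lambda> (D f \<inter> D f'))"
    and L_mult_int: "integrable P0 (\<lambda>\<omega>. L f \<omega> * L f' \<omega>)" if f: "f \<in> F" "f' \<in> F" for f f'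
  proof -
    have U: "D f \<union> D f' \<in> sets borel" "D f \<union> D f' \<subseteq> below (max (\<bar>G f 0\<bar> + R) (\<bar>G f' 0\<bar> + R))"
      using D f D_below[OF f(1)] D_below[OF f(2)] by (auto simp: mem_Times_iff subset_iff le_max_iff_disj)
    have eq: "L f \<omega> * L f' \<omega> = exp (measure ?\<Lambda> (D f) + measure ?\<Lambda> (D f')) * indicator (void_event (D f \<union> D f')) \<omega>" for \<omega>
      unfolding L_def void_event_Int[symmetric] exp_add by (simp add: indicator_def)
    have v: "void_event (D f \<union> D f') \<in> sets P0"
      using sets_void_event[OF U(1)] by (simp add: P0.sets_P)
    show "integrable P0 (\<lambda>\<omega>. L f \<omega> * L f' \<omega>)"
      unfolding eq using v by (intro integrable_mult_right integrable_real_indicator) (auto simp: P0.emeasure_eq_measure)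
    \<comment> \<open>The two normalisations exceed the exponent of the joint void probability by
      exactly the intensity of the overlap.\<close>
    have "measure ?\<Lambda> (D f \<union> D f') + measure ?\<Lambda> (D f \<inter> D f') = measure ?\<Lambda> (D f) + measure ?\<Lambda> (D f')"
      using measure_Un3[of "D f" ?\<Lambda> "D f'"] D f P0.finite_intensity[OF D_below[OF f(1)]] P0.finite_intensity[OF D_below[OF f(2)]]
      by (simp add: fmeasurable_def sets_boundary_intensity)
    then have "exp (measure ?\<Lambda> (D f) + measure ?\<Lambda> (D f')) * exp (- measure ?\<Lambda> (D f \<union> D f')) = exp (measure ?\<Lambda> (D f \<inter> D f'))"
      unfolding exp_add[symmetric] by (simp add: algebra_simps)
    then show "(LINT \<omega>|P0. L f \<omega> * L f' \<omega>) = exp (measure ?\<Lambda> (D f \<inter> D f'))"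
      unfolding eq using v by (simp add: P0.void_probability[OF U])
  qed
  have L_mean: "(LINT \<omega>|P0. L f \<omega>) = 1" if "f \<in> F" for f
    using vD[OF that] by (simp add: L_def P0.void_probability[OF D D_below] that exp_minus)
  have L'_int: "integrable P0 L'"
    unfolding L'_def using L_int by (intro integrable_divide_zero integrable_sum) auto
  have L'_mean: "(LINT \<omega>|P0. L' \<omega>) = 1"
    unfolding L'_def using L_int L_mean N by simp
  have sq: "(L' \<omega>)\<^sup>2 = (\<Sum>f\<in>F. \<Sum>f'\<in>F. L f \<omega> * L f' \<omega>) / ?N\<^sup>2" for \<omega>
    by (simp add: L'_def power2_eq_square sum_product)
  have L'_sq_int: "integrable P0 (\<lambda>\<omega>. (L' \<omega>)\<^sup>2)"
    unfolding sq using L_mult_int by (intro integrable_divide_zero integrable_sum) auto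
  have "(LINT \<omega>|P0. (L' \<omega>)\<^sup>2) = (\<Sum>f\<in>F. \<Sum>f'\<in>F. exp (measure ?\<Lambda> (D f \<inter> D f'))) / ?N\<^sup>2"
    unfolding sq using L_mult_int L_mult by (simp add: integral_sum integrable_sum)
  also have "\<dots> \<le> 1 + e"
    using overlap N by (simp add: D_def divide_le_eq)
  finally have L'_sq: "(LINT \<omega>|P0. (L' \<omega>)\<^sup>2) \<le> 1 + e" .
  have dev_int: "integrable P0 (\<lambda>\<omega>. (L' \<omega> - 1)\<^sup>2)"
    unfolding power2_diff using L'_int L'_sq_int by simp
  have dev: "(LINT \<omega>|P0. (L' \<omega> - 1)\<^sup>2) \<le> e"
    unfolding power2_diff using L'_int L'_sq_int L'_sq L'_mean by (simp add: P0.prob_space)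
  have abs_int: "integrable P0 (\<lambda>\<omega>. \<bar>L' \<omega> - 1\<bar>)"
    using L'_int by simp
  \<comment> \<open>Cauchy-Schwarz in the form that a variance is nonnegative.\<close>
  have "(LINT \<omega>|P0. \<bar>L' \<omega> - 1\<bar>)\<^sup>2 \<le> (LINT \<omega>|P0. \<bar>L' \<omega> - 1\<bar>\<^sup>2)"
    using P0.variance_positive[of "\<lambda>\<omega>. \<bar>L' \<omega> - 1\<bar>"] P0.variance_eq[OF abs_int] dev_int by simp
  then have "(LINT \<omega>|P0. \<bar>L' \<omega> - 1\<bar>)\<^sup>2 \<le> e"
    using dev by simp
  then have abs_le: "(LINT \<omega>|P0. \<bar>L' \<omega> - 1\<bar>) \<le> sqrt e"
    by (rule real_le_rsqrt)
  let ?S = "SUP g\<in>?\<G>. LINT \<omega>|law g. 1 - \<psi> \<omega>"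
  have bdd: "bdd_above ((\<lambda>g. LINT \<omega>|law g. 1 - \<psi> \<omega>) ` ?\<G>)"
    using tests_integral_bounds(4)[OF ps \<psi>] alt by (intro bdd_aboveI2[where M=1]) blast
  have m\<psi>: "(\<lambda>\<omega>. 1 - \<psi> \<omega>) \<in> borel_measurable config_space"
    using \<psi> by (intro borel_measurable_diff measurable_const) (simp_all add: tests_def)
  have \<psi>01: "\<bar>1 - \<psi> \<omega>\<bar> \<le> 1" "0 \<le> 1 - \<psi> \<omega>" if "\<omega> \<in> space P0" for \<omega>
    using \<psi> that by (auto simp: tests_def P0.space_P)
  have m\<psi>': "(\<lambda>\<omega>. 1 - \<psi> \<omega>) \<in> borel_measurable P0"
    using m\<psi> by (simp cong: measurable_cong_sets[OF P0.sets_P])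
  have prod_int: "integrable P0 (\<lambda>\<omega>. X \<omega> * (1 - \<psi> \<omega>))" if "integrable P0 X" for X
    using that m\<psi>' \<psi>01(1)
    by (intro Bochner_Integration.integrable_bound[OF that] AE_I2) (auto simp: abs_mult intro: mult_left_le)
  \<comment> \<open>The mixture error is an average of errors under alternatives and is therefore at
    most their supremum.\<close>
  have "(LINT \<omega>|P0. L' \<omega> * (1 - \<psi> \<omega>)) = (\<Sum>f\<in>F. LINT \<omega>|P0. L f \<omega> * (1 - \<psi> \<omega>)) / ?N"
    unfolding L'_def using prod_int[OF L_int]
    by (simp add: sum_distrib_right integral_sum)
  also have "\<dots> = (\<Sum>f\<in>F. LINT \<omega>|law (G f). 1 - \<psi> \<omega>) / ?N"
    using integral_boundary_law[OF bm0 bm[OF alt[OF G]] nonneg m\<psi>] by (simp add: L_def D_def)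
  also have "\<dots> \<le> (\<Sum>f\<in>F. ?S) / ?N"
    using N by (intro divide_right_mono sum_mono cSUP_upper G bdd) auto
  also have "\<dots> = ?S"
    using N by simp
  finally have S: "(LINT \<omega>|P0. L' \<omega> * (1 - \<psi> \<omega>)) \<le> ?S" .
  \<comment> \<open>Replacing the mixture by the null law changes the expectation of
    \<open>1 - \<psi>\<close>, which takes values in the unit interval, by at most the mean of
    \<open>\<bar>L' - 1\<bar>\<close>.\<close>
  have "- (LINT \<omega>|P0. \<bar>L' \<omega> - 1\<bar>) = (LINT \<omega>|P0. - \<bar>L' \<omega> - 1\<bar>)"
    by simp
  also have "\<dots> \<le> (LINT \<omega>|P0. (L' \<omega> - 1) * (1 - \<psi> \<omega>))"
  proof (rule integral_mono)
    show "integrable P0 (\<lambda>\<omega>. (L' \<omega> - 1) * (1 - \<psi> \<omega>))"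
      using L'_int by (intro prod_int) simp
    show "- \<bar>L' \<omega> - 1\<bar> \<le> (L' \<omega> - 1) * (1 - \<psi> \<omega>)" if "\<omega> \<in> space P0" for \<omega>
    proof -
      have "\<bar>(L' \<omega> - 1) * (1 - \<psi> \<omega>)\<bar> \<le> \<bar>L' \<omega> - 1\<bar>"
        using \<psi>01[OF that] by (simp add: abs_mult mult_left_le)
      then show ?thesis
        by linarith
    qed
  qed (use abs_int in simp)
  also have "\<dots> = (LINT \<omega>|P0. L' \<omega> * (1 - \<psi> \<omega>)) - (LINT \<omega>|P0. 1 - \<psi> \<omega>)"
    unfolding left_diff_distrib using prod_int[OF L'_int] prod_int[of "\<lambda>_. 1"] by simp
  finally have "(LINT \<omega>|P0. L' \<omega> * (1 - \<psi> \<omega>)) \<ge> 1 - (LINT \<omega>|P0. \<psi> \<omega>) - sqrt e"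
    using abs_le \<psi>0(5) by linarith
  then show ?thesis
    using S by (simp add: testing_error_def P0_def)
qed

section \<open>Bump functions in the Hoelder ball\<close>

lemma powr_add_le:
  fixes a b \<beta> :: real
  assumes "0 \<le> a" "0 \<le> b" "0 < \<beta>" "\<beta> \<le> 1"
  shows "(a + b) powr \<beta> \<le> a powr \<beta> + b powr \<beta>"
proof (cases "a + b = 0")
  case False
  then have pos: "a + b > 0"
    using assms by linarith
  \<comment> \<open>On the unit interval \<open>t \<le> t powr \<beta>\<close> because
    \<open>\<beta> \<le> 1\<close>; adding the two ratios, which sum to 1, gives
    subadditivity.\<close>
  have ratio: "x / (a + b) \<le> x powr \<beta> / (a + b) powr \<beta>" if "0 \<le> x" "x \<le> a + b" for x
  proof -
    have "x / (a + b) = (x / (a + b)) powr 1"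
      using that pos by simp
    also have "\<dots> \<le> (x / (a + b)) powr \<beta>"
      using that pos assms by (intro powr_mono') (auto simp: divide_le_eq)
    finally show ?thesis
      using that pos by (simp add: powr_divide)
  qed
  have "1 = a / (a + b) + b / (a + b)"
    using pos by (simp add: add_divide_distrib[symmetric])
  also have "\<dots> \<le> a powr \<beta> / (a + b) powr \<beta> + b powr \<beta> / (a + b) powr \<beta>"
    using assms by (intro add_mono ratio) auto
  finally show ?thesis
    using pos by (simp add: add_divide_distrib[symmetric] le_divide_eq)
qed (use assms in auto)

lemma abs_powr_diff_le:
  fixes a b \<beta> :: real
  assumes "0 \<le> a" "0 \<le> b" "0 < \<beta>" "\<beta> \<le> 1"
  shows "\<bar>a powr \<beta> - b powr \<beta>\<bar> \<le> \<bar>a - b\<bar> powr \<beta>"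
  using powr_add_le[of b "a - b" \<beta>] powr_add_le[of a "b - a" \<beta>] assms
    powr_mono2[of \<beta> a b] powr_mono2[of \<beta> b a]
  by (cases "b \<le> a") auto

text \<open>All bumps are put into one function of the distance to the set \<open>S\<close> of
  centres. Taking this distance, its power \<open>\<beta>\<close> and the positive part each respect
  the Hoelder bound, so no case distinction by position relative to the bumps is needed. With
  \<open>w\<close> the cell width, a bump fills its cell.\<close>

definition bumps :: "real \<Rightarrow> real \<Rightarrow> real \<Rightarrow> real set \<Rightarrow> real \<Rightarrow> real" where
  "bumps \<beta> R w S x = R * max 0 ((w / 2) powr \<beta> - infdist x S powr \<beta>)"

lemma bumps_in_holder_ball:
  assumes "0 < \<beta>" "\<beta> \<le> 1" "0 < R"
  shows "bumps \<beta> R w S \<in> holder_ball \<beta> R"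
  unfolding holder_ball_def
proof (intro CollectI ballI)
  fix x y :: real
  have "\<bar>max 0 ((w / 2) powr \<beta> - infdist x S powr \<beta>) - max 0 ((w / 2) powr \<beta> - infdist y S powr \<beta>)\<bar>
      \<le> \<bar>infdist x S powr \<beta> - infdist y S powr \<beta>\<bar>"
    by linarith
  also have "\<dots> \<le> \<bar>infdist x S - infdist y S\<bar> powr \<beta>"
    using assms by (intro abs_powr_diff_le infdist_nonneg)
  also have "\<dots> \<le> \<bar>x - y\<bar> powr \<beta>"
    using infdist_triangle_abs[of x S y] assms by (intro powr_mono2) (auto simp: dist_real_def)
  finally have "R * \<bar>max 0 ((w / 2) powr \<beta> - infdist x S powr \<beta>) - max 0 ((w / 2) powr \<beta> - infdist y S powr \<beta>)\<bar>
      \<le> R * \<bar>x - y\<bar> powr \<beta>"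
    using assms by (intro mult_left_mono) auto
  then show "\<bar>bumps \<beta> R w S x - bumps \<beta> R w S y\<bar> \<le> R * \<bar>x - y\<bar> powr \<beta>"
    using assms by (simp add: bumps_def right_diff_distrib[symmetric] abs_mult)
qed

lemma bumps_nonneg: "0 < R \<Longrightarrow> 0 \<le> bumps \<beta> R w S x"
  by (simp add: bumps_def)

lemma bumps_ge:
  assumes "0 < \<beta>" "0 < R" "c \<in> S" "\<bar>x - c\<bar> \<le> w / 4"
  shows "R * ((w / 2) powr \<beta> - (w / 4) powr \<beta>) \<le> bumps \<beta> R w S x"
proof -
  have "infdist x S \<le> w / 4"
    using infdist_le[OF assms(3), of x] assms(4) by (simp add: dist_real_def)
  then have "infdist x S powr \<beta> \<le> (w / 4) powr \<beta>"
    using assms(1) by (intro powr_mono2 infdist_nonneg) auto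
  then show ?thesis
    using assms(2) unfolding bumps_def by (intro mult_left_mono) auto
qed

text \<open>A crude cover of one bump whose measure has the right order. It is open horizontally, so
  that boxes over centres at distance \<open>w\<close> are disjoint.\<close>

definition bump_box :: "real \<Rightarrow> real \<Rightarrow> real \<Rightarrow> real \<Rightarrow> (real \<times> real) set" where
  "bump_box \<beta> R w c = {c - w / 2<..<c + w / 2} \<times> {0..R * (w / 2) powr \<beta>}"

lemma subgraph_bumps:
  assumes "0 < \<beta>" "0 < R" "0 < w" "finite S" "S \<noteq> {}"
  shows "subgraph (bumps \<beta> R w S) \<subseteq> (\<Union>c\<in>S. bump_box \<beta> R w c)"
proof
  fix z assume z: "z \<in> subgraph (bumps \<beta> R w S)"
  then have v: "0 \<le> snd z" "snd z < R * max 0 ((w / 2) powr \<beta> - infdist (fst z) S powr \<beta>)"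
    by (auto simp: subgraph_def bumps_def)
  obtain c where c: "c \<in> S" "infdist (fst z) S = dist (fst z) c"
    using infdist_attains_inf[of S "fst z"] assms by (auto simp: finite_imp_closed)
  have pos: "0 < (w / 2) powr \<beta> - infdist (fst z) S powr \<beta>"
    using v assms by (auto simp: max_def split: if_splits)
  then have le: "snd z < R * ((w / 2) powr \<beta> - infdist (fst z) S powr \<beta>)"
    using v by simp
  have "R * ((w / 2) powr \<beta> - infdist (fst z) S powr \<beta>) \<le> R * (w / 2) powr \<beta>"
    using assms by (intro mult_left_mono) auto
  moreover have "\<bar>fst z - c\<bar> < w / 2"
  proof (rule ccontr)
    assume "\<not> \<bar>fst z - c\<bar> < w / 2"
    then have "(w / 2) powr \<beta> \<le> \<bar>fst z - c\<bar> powr \<beta>"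
      using assms by (intro powr_mono2) auto
    then show False
      using pos c by (simp add: dist_real_def)
  qed
  ultimately have "c - w / 2 < fst z" "fst z < c + w / 2" "snd z \<le> R * (w / 2) powr \<beta>"
    using le by linarith+
  then have "z \<in> bump_box \<beta> R w c"
    using v(1) by (simp add: bump_box_def mem_Times_iff)
  then show "z \<in> (\<Union>c\<in>S. bump_box \<beta> R w c)"
    using c(1) by blast
qed

lemma sets_bump_box: "bump_box \<beta> R w c \<in> sets borel"
  unfolding bump_box_def borel_prod[symmetric] by (intro pair_measureI) auto

lemma emeasure_bump_box_le:
  assumes "0 < R" "0 < w"
  shows "emeasure (boundary_intensity n (\<lambda>_. 0)) (bump_box \<beta> R w c) \<le> ennreal (real n * (R * (w / 2) powr \<beta> * w))"
proof -
  have "emeasure (boundary_intensity n (\<lambda>_. 0)) (bump_box \<beta> R w c)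
      = ennreal (real n) * (\<integral>\<^sup>+x\<in>{0..1}. emeasure lborel {y. 0 \<le> y \<and> (x, y) \<in> bump_box \<beta> R w c} \<partial>lborel)"
    by (intro emeasure_boundary_intensity sets_bump_box) simp
  also have "\<dots> \<le> ennreal (real n) * (\<integral>\<^sup>+x. ennreal (R * (w / 2) powr \<beta>) * indicator {c - w / 2..c + w / 2} x \<partial>lborel)"
  proof (intro mult_left_mono nn_integral_mono)
    fix x
    have "{y. 0 \<le> y \<and> (x, y) \<in> bump_box \<beta> R w c} = (if x \<in> {c - w / 2<..<c + w / 2} then {0..R * (w / 2) powr \<beta>} else {})"
      by (auto simp: bump_box_def)
    then show "emeasure lborel {y. 0 \<le> y \<and> (x, y) \<in> bump_box \<beta> R w c} * indicator {0..1} x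
        \<le> ennreal (R * (w / 2) powr \<beta>) * indicator {c - w / 2..c + w / 2} x"
      using assms by (auto simp: indicator_def)
  qed simp
  also have "\<dots> = ennreal (real n * (R * (w / 2) powr \<beta> * w))"
    using assms by (subst nn_integral_cmult_indicator) (simp_all add: ennreal_mult)
  finally show ?thesis .
qed

text \<open>The unit interval is cut into \<open>K\<close> blocks of \<open>M\<close> cells of equal width; a function \<open>f\<close> selects
  one cell from every block.\<close>

definition cell_center :: "nat \<Rightarrow> nat \<Rightarrow> nat \<Rightarrow> nat \<Rightarrow> real" where
  "cell_center K M i j = (real (i * M + j) + 1 / 2) / (real K * real M)"

section \<open>Cells, selections and their overlaps\<close>

context
  fixes K M :: nat and w :: real
  assumes K: "K \<ge> 1" and M: "M \<ge> 1" and w: "w = 1 / (real K * real M)"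
begin

lemma w_pos: "0 < w"
  using K M by (simp add: w)

lemma cell_center_eq: "cell_center K M i j = (real (i * M + j) + 1 / 2) * w"
  by (simp add: cell_center_def w)

lemma cell_center_bounds:
  assumes "i < K" "j < M"
  shows "w / 2 \<le> cell_center K M i j" "cell_center K M i j \<le> 1 - w / 2"
proof -
  have "Suc i * M \<le> K * M"
    using assms by (intro mult_right_mono) auto
  then have "i * M + j + 1 \<le> K * M"
    using assms by simp
  then have "real (i * M + j + 1) \<le> real (K * M)"
    by (rule of_nat_mono)
  then have "real (i * M + j + 1) * w \<le> real (K * M) * w"
    using w_pos by (intro mult_right_mono) auto
  moreover have "real (K * M) * w = 1"
    using K M by (simp add: w)
  ultimately show "cell_center K M i j \<le> 1 - w / 2"
    by (simp add: cell_center_eq algebra_simps)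
  have "0 \<le> real (i * M + j) * w"
    using w_pos by simp
  then show "w / 2 \<le> cell_center K M i j"
    by (simp add: cell_center_eq algebra_simps)
qed

text \<open>Centres are integer multiples of \<open>w\<close> up to a common shift, so closer than
  \<open>w\<close> means equal cell numbers \<open>i * M + j\<close>, from which division by
  \<open>M\<close> recovers block and position.\<close>

lemma cell_center_separated:
  assumes "j < M" "j' < M" "\<bar>cell_center K M i j - cell_center K M i' j'\<bar> < w"
  shows "i = i' \<and> j = j'"
proof -
  have "\<bar>real (i * M + j) - real (i' * M + j')\<bar> * w < 1 * w"
    using assms(3) w_pos unfolding cell_center_eq by (simp add: left_diff_distrib[symmetric] abs_mult)
  then have "\<bar>real (i * M + j) - real (i' * M + j')\<bar> < 1"
    using w_pos by (simp only: mult_less_cancel_right)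
  then have eq: "i * M + j = i' * M + j'"
    by linarith
  have "(i * M + j) div M = i" "(i' * M + j') div M = i'" "(i * M + j) mod M = j" "(i' * M + j') mod M = j'"
    using assms(1,2) by simp_all
  then show ?thesis
    using eq by metis
qed

abbreviation "selections \<equiv> PiE {..<K} (\<lambda>_. {..<M})"

definition centers :: "(nat \<Rightarrow> nat) \<Rightarrow> real set" where
  "centers f = (\<lambda>i. cell_center K M i (f i)) ` {..<K}"

lemma centers_finite: "finite (centers f)" "centers f \<noteq> {}"
  using K by (auto simp: centers_def lessThan_empty_iff)

text \<open>Boxes over different cells are disjoint, so the subgraphs meet only in blocks where both
  selections pick the same cell, and each such block costs at most one box of intensity
  \<open>a\<close>.\<close>

lemma overlap_measure_le:
  assumes \<beta>: "0 < \<beta>" and R: "0 < R" and f: "f \<in> selections" "f' \<in> selections"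
    and a: "real n * (R * (w / 2) powr \<beta> * w) \<le> a"
  shows "measure (boundary_intensity n (\<lambda>_. 0))
      (subgraph (bumps \<beta> R w (centers f)) \<inter> subgraph (bumps \<beta> R w (centers f')))
    \<le> (\<Sum>i<K. if f i = f' i then a else 0)"
proof -
  let ?\<Lambda> = "boundary_intensity n (\<lambda>_. 0)" and ?I = "{i. i < K \<and> f i = f' i}"
  let ?B = "\<lambda>i. bump_box \<beta> R w (cell_center K M i (f i))"
  have a0: "0 \<le> a"
    using R w_pos by (intro order_trans[OF _ a]) simp
  have "subgraph (bumps \<beta> R w (centers f)) \<inter> subgraph (bumps \<beta> R w (centers f')) \<subseteq> (\<Union>i\<in>?I. ?B i)"
  proof
    fix z assume "z \<in> subgraph (bumps \<beta> R w (centers f)) \<inter> subgraph (bumps \<beta> R w (centers f'))"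
    then have "z \<in> (\<Union>c\<in>centers f. bump_box \<beta> R w c)" "z \<in> (\<Union>c\<in>centers f'. bump_box \<beta> R w c)"
      using subgraph_bumps[OF \<beta> R w_pos centers_finite] by blast+
    then obtain i i' where i: "i < K" "z \<in> ?B i" "i' < K" "z \<in> bump_box \<beta> R w (cell_center K M i' (f' i'))"
      by (auto simp: centers_def)
    then have "\<bar>cell_center K M i (f i) - cell_center K M i' (f' i')\<bar> < w"
      by (auto simp: bump_box_def)
    then have "i = i' \<and> f i = f' i'"
      using f i by (intro cell_center_separated) (auto simp: PiE_iff)
    then show "z \<in> (\<Union>i\<in>?I. ?B i)"
      using i by auto
  qed
  then have "emeasure ?\<Lambda> (subgraph (bumps \<beta> R w (centers f)) \<inter> subgraph (bumps \<beta> R w (centers f')))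
      \<le> emeasure ?\<Lambda> (\<Union>i\<in>?I. ?B i)"
    by (intro emeasure_mono) (auto simp: sets_boundary_intensity sets_bump_box)
  also have "\<dots> \<le> (\<Sum>i\<in>?I. emeasure ?\<Lambda> (?B i))"
    by (intro emeasure_subadditive_finite) (auto simp: sets_boundary_intensity sets_bump_box)
  also have "\<dots> \<le> (\<Sum>i\<in>?I. ennreal a)"
    using emeasure_bump_box_le[OF R w_pos, of n \<beta>] ennreal_leI[OF a] by (intro sum_mono) (blast intro: order_trans)
  also have "\<dots> = ennreal (\<Sum>i\<in>?I. a)"
    by (rule sum_ennreal[OF a0])
  also have "(\<Sum>i\<in>?I. a) = (\<Sum>i<K. if f i = f' i then a else 0)"
    by (subst sum.inter_filter[symmetric]) (auto simp: lessThan_def intro!: sum.cong)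
  finally show ?thesis
    unfolding measure_def
    using a0 by (intro enn2real_leI) (auto intro!: sum_nonneg)
qed

text \<open>The blocks contribute independently to the overlap of two uniformly chosen selections.\<close>

lemma overlap_sum_le:
  assumes \<beta>: "0 < \<beta>" and R: "0 < R" and a: "real n * (R * (w / 2) powr \<beta> * w) \<le> a"
  shows "(\<Sum>f\<in>selections. \<Sum>f'\<in>selections. exp (measure (boundary_intensity n (\<lambda>_. 0))
      (subgraph (bumps \<beta> R w (centers f)) \<inter> subgraph (bumps \<beta> R w (centers f')))))
    \<le> exp ((exp a - 1) * real K / real M) * (real (card selections))\<^sup>2"
proof -
  let ?q = "\<lambda>k j. if k = j then exp a else (1 :: real)"
  have card: "card selections = M ^ K"
    by (simp add: card_PiE)
  \<comment> \<open>Summing over all selections factorises over the blocks; in each block one of the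
    \<open>M\<close> cells agrees with \<open>f\<close> and contributes \<open>exp a\<close>, and
    the others contribute 1.\<close>
  have inner: "(\<Sum>f'\<in>selections. \<Prod>i<K. ?q (f i) (f' i)) = (exp a + (real M - 1)) ^ K" if f: "f \<in> selections" for f
  proof -
    have "(\<Sum>f'\<in>selections. \<Prod>i<K. ?q (f i) (f' i)) = (\<Prod>i<K. \<Sum>j<M. ?q (f i) j)"
      by (rule prod_sum_PiE[symmetric]) auto
    also have "\<dots> = (\<Prod>i<K. exp a + (real M - 1))"
    proof (rule prod.cong[OF refl])
      fix i assume "i \<in> {..<K}"
      then have "f i \<in> {..<M}"
        using f by auto
      then have "(\<Sum>j<M. ?q (f i) j) = exp a + (\<Sum>j\<in>{..<M} - {f i}. ?q (f i) j)"
        by (subst sum.remove[of _ "f i"]) auto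
      also have "(\<Sum>j\<in>{..<M} - {f i}. ?q (f i) j) = (\<Sum>j\<in>{..<M} - {f i}. 1)"
        by (intro sum.cong) auto
      also have "\<dots> = real M - 1"
        using \<open>f i \<in> {..<M}\<close> M by (simp add: of_nat_diff)
      finally show "(\<Sum>j<M. ?q (f i) j) = exp a + (real M - 1)" .
    qed
    finally show ?thesis
      by simp
  qed
  have a0: "0 \<le> a"
    using R w_pos by (intro order_trans[OF _ a]) simp
  have "(\<Sum>f\<in>selections. \<Sum>f'\<in>selections. exp (measure (boundary_intensity n (\<lambda>_. 0))
      (subgraph (bumps \<beta> R w (centers f)) \<inter> subgraph (bumps \<beta> R w (centers f')))))
    \<le> (\<Sum>f\<in>selections. \<Sum>f'\<in>selections. \<Prod>i<K. ?q (f i) (f' i))"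
  proof (intro sum_mono)
    fix f f' assume f: "f \<in> selections" "f' \<in> selections"
    have "exp (\<Sum>i<K. if f i = f' i then a else 0) = (\<Prod>i<K. ?q (f i) (f' i))"
      by (simp add: exp_sum if_distrib cong: if_cong)
    moreover have "exp (measure (boundary_intensity n (\<lambda>_. 0))
        (subgraph (bumps \<beta> R w (centers f)) \<inter> subgraph (bumps \<beta> R w (centers f'))))
      \<le> exp (\<Sum>i<K. if f i = f' i then a else 0)"
      unfolding exp_le_cancel_iff by (rule overlap_measure_le[OF \<beta> R f a])
    ultimately show "exp (measure (boundary_intensity n (\<lambda>_. 0))
        (subgraph (bumps \<beta> R w (centers f)) \<inter> subgraph (bumps \<beta> R w (centers f')))) \<le> (\<Prod>i<K. ?q (f i) (f' i))"
      by (simp only:)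
  qed
  also have "\<dots> = real M ^ K * (exp a + (real M - 1)) ^ K"
    by (simp add: inner card)
  \<comment> \<open>The factor \<open>M\<close> is split off to match the number of selections; what
    remains is close to 1 and is bounded by an exponential.\<close>
  also have "exp a + (real M - 1) = real M * (1 + (exp a - 1) / real M)"
    using M by (simp add: field_simps)
  also have "real M ^ K * (real M * (1 + (exp a - 1) / real M)) ^ K = (1 + (exp a - 1) / real M) ^ K * (real M ^ K)\<^sup>2"
    by (simp add: power_mult_distrib power2_eq_square)
  also have "\<dots> \<le> exp ((exp a - 1) / real M) ^ K * (real M ^ K)\<^sup>2"
    using a0 by (intro mult_right_mono power_mono exp_ge_add_one_self) auto
  also have "exp ((exp a - 1) / real M) ^ K = exp ((exp a - 1) * real K / real M)"
    by (simp add: exp_of_nat_mult[symmetric] mult.commute)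
  finally show ?thesis
    by (simp add: card)
qed

text \<open>Only the middle half of each selected cell is kept, where the bump has at least the
  stated height. These intervals are disjoint and lie in the unit interval.\<close>

lemma Lp_integral_bumps_ge:
  assumes \<beta>: "0 < \<beta>" and R: "0 < R" and p: "p \<ge> 1" and "\<beta> \<le> 1" and f: "f \<in> selections"
  shows "real K * (w / 2) * (R * ((w / 2) powr \<beta> - (w / 4) powr \<beta>)) powr p
    \<le> (LBINT x:{0..1}. \<bar>bumps \<beta> R w (centers f) x\<bar> powr p)"
proof -
  let ?\<tau> = "R * ((w / 2) powr \<beta> - (w / 4) powr \<beta>)"
  let ?c = "\<lambda>i. cell_center K M i (f i)"
  let ?J = "\<lambda>i. {?c i - w / 4..?c i + w / 4}"
  let ?g = "bumps \<beta> R w (centers f)"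
  have \<tau>: "0 \<le> ?\<tau>"
    using R w_pos \<beta> by (auto intro!: mult_nonneg_nonneg powr_mono2)
  have fM: "f i < M" if "i < K" for i
    using f that by auto
  have int: "integrable lborel (\<lambda>x. indicator (?J i) x * ?\<tau> powr p)" for i
    by (intro integrable_mult_left integrable_real_indicator) (auto simp: emeasure_lborel_Icc_eq)
  have "(\<Sum>i<K. \<integral>x. indicator (?J i) x * ?\<tau> powr p \<partial>lborel) = (\<Sum>i<K. (w / 2) * ?\<tau> powr p)"
    using w_pos by (intro sum.cong) auto
  then have "real K * (w / 2) * ?\<tau> powr p = (\<integral>x. (\<Sum>i<K. indicator (?J i) x * ?\<tau> powr p) \<partial>lborel)"
    by (subst Bochner_Integration.integral_sum[OF int]) simp
  also have "\<dots> \<le> (\<integral>x. indicator {0..1} x *\<^sub>R (\<bar>?g x\<bar> powr p) \<partial>lborel)"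
  proof (rule integral_mono)
    show "integrable lborel (\<lambda>x. \<Sum>i<K. indicator (?J i) x * ?\<tau> powr p)"
      using int by (intro Bochner_Integration.integrable_sum)
    show "integrable lborel (\<lambda>x. indicator {0..1} x *\<^sub>R (\<bar>?g x\<bar> powr p))"
      using set_integrable_abs_powr[OF continuous_on_holder_ball[OF \<beta> R bumps_in_holder_ball[OF \<beta> \<open>\<beta> \<le> 1\<close> R]], of p w "centers f"] p
      by (simp add: set_integrable_def)
    fix x
    show "(\<Sum>i<K. indicator (?J i) x * ?\<tau> powr p) \<le> indicator {0..1} x *\<^sub>R (\<bar>?g x\<bar> powr p)"
    proof (cases "\<exists>i<K. x \<in> ?J i")
      case True
      then obtain i where i: "i < K" "x \<in> ?J i"
        by blast
      have other: "x \<notin> ?J i'" if "i' < K" "i' \<noteq> i" for i'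
      proof
        assume "x \<in> ?J i'"
        then have "\<bar>?c i - ?c i'\<bar> < w"
          using i(2) w_pos by auto
        then show False
          using cell_center_separated[OF fM[OF i(1)] fM[OF that(1)]] that(2) by auto
      qed
      have "(\<Sum>i<K. indicator (?J i) x * ?\<tau> powr p) = (\<Sum>i'\<in>{i}. indicator (?J i') x * ?\<tau> powr p)"
        using i other by (intro sum.mono_neutral_right) auto
      also have "\<dots> = ?\<tau> powr p"
        using i by simp
      also have "\<dots> \<le> \<bar>?g x\<bar> powr p"
      proof -
        have "?\<tau> \<le> ?g x"
        proof (rule bumps_ge[OF \<beta> R])
          show "?c i \<in> centers f"
            using i by (simp add: centers_def)
          show "\<bar>x - ?c i\<bar> \<le> w / 4"
            using i(2) unfolding atLeastAtMost_iff by linarith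
        qed
        then show ?thesis
          using \<tau> p by (intro powr_mono2) auto
      qed
      also have "x \<in> {0..1}"
        using cell_center_bounds[OF i(1) fM[OF i(1)]] i(2) w_pos by auto
      then have "\<bar>?g x\<bar> powr p = indicator {0..1} x *\<^sub>R (\<bar>?g x\<bar> powr p)"
        by simp
      finally show ?thesis .
    next
      case False
      then have zero: "(\<Sum>i<K. indicator (?J i) x * ?\<tau> powr p) = 0"
        by (intro sum.neutral) auto
      show ?thesis
        unfolding zero by simp
    qed
  qed
  finally show ?thesis
    by (simp add: set_lebesgue_integral_def)
qed

end

text \<open>\<open>K\<close> is the least number of bumps that certifies the required norm, and
  \<open>M\<close> then makes the cell width comparable to \<open>h\<close>. The second moment is
  governed by \<open>K / M\<close>, which is at most \<open>y\<^sup>2\<close>.\<close>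

lemma testing_error_ge:
  assumes \<beta>: "0 < \<beta>" "\<beta> \<le> 1" and R: "0 < R" and p: "p \<ge> 1" and \<rho>: "\<rho> > 0" and n: "n \<ge> 1"
    and h: "h = real n powr (- 1 / (\<beta> + 1))"
    and law: "\<And>g. g \<in> holder_ball \<beta> R \<Longrightarrow> poisson_process_law (boundary_intensity n g) (law g)"
    and C: "C = 4 / (R * ((1 / 4) powr \<beta> - (1 / 8) powr \<beta>)) powr p"
    and y: "y = sqrt h + C * (\<rho> / critical_rate \<beta> p n) powr p" "y \<le> 1"
    and \<psi>: "\<psi> \<in> tests"
  shows "1 - sqrt (exp ((exp R - 1) * y\<^sup>2) - 1) \<le> testing_error law (alternatives \<beta> R p \<rho>) \<psi>"
proof -
  have h01: "0 < h" "h \<le> 1"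
    using n \<beta> powr_mono[of "- 1 / (\<beta> + 1)" 0 "real n"] by (simp_all add: h)
  \<comment> \<open>With \<open>h \<le> 2 * w\<close> the height of a bump on the middle half of its
    cell is at least \<open>h powr \<beta> * \<tau>\<close>: the fractions \<open>1 / 4\<close> and
    \<open>1 / 8\<close> are \<open>w / 2\<close> and \<open>w / 4\<close> in units of
    \<open>2 * w\<close>.\<close>
  define \<tau> where "\<tau> = R * ((1 / 4) powr \<beta> - (1 / 8) powr \<beta>)"
  have \<tau>: "\<tau> > 0"
    using R \<beta> powr_less_mono2[of \<beta> "1 / 8" "1 / 4"] by (simp add: \<tau>_def)
  have C0: "C > 0"
    unfolding C \<tau>_def[symmetric] using \<tau> by simp
  \<comment> \<open>Solves \<open>t * (h / 4) * (h powr \<beta> * \<tau>) powr p = \<rho> powr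
    p\<close>, so that \<open>t\<close> middle halves of width at least \<open>h / 4\<close> carry
    the norm. The 4 in \<open>C\<close> is this 4.\<close>
  define t where "t = C * \<rho> powr p / h powr (\<beta> * p + 1)"
  define K where "K = nat \<lceil>t\<rceil>"
  define M where "M = nat \<lceil>1 / (h * real K)\<rceil>"
  define w where "w = 1 / (real K * real M)"
  have ceil: "nat \<lceil>x\<rceil> \<ge> 1" "x \<le> real (nat \<lceil>x\<rceil>)" "real (nat \<lceil>x\<rceil>) \<le> x + 1" if "x > 0" for x :: real
  proof -
    have "0 < \<lceil>x\<rceil>"
      using that by (simp add: zero_less_ceiling)
    then show "nat \<lceil>x\<rceil> \<ge> 1" "x \<le> real (nat \<lceil>x\<rceil>)" "real (nat \<lceil>x\<rceil>) \<le> x + 1"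
      using ceiling_correct[of x] by linarith+
  qed
  have t: "t > 0"
    using C0 \<rho> h01 by (simp add: t_def)
  have K: "K \<ge> 1" "t \<le> real K" "real K \<le> t + 1"
    unfolding K_def using ceil[OF t] by auto
  have "0 < 1 / (h * real K)"
    using h01 K by simp
  then have M: "M \<ge> 1" "1 / (h * real K) \<le> real M" "real M \<le> 1 / (h * real K) + 1"
    unfolding M_def using ceil by auto
  have "(\<rho> / critical_rate \<beta> p n) powr p = \<rho> powr p / h powr (\<beta> * p + 1 / 2)"
    using critical_rate_powr[OF \<beta>(1) p h] \<rho> by (simp add: powr_divide critical_rate_def)
  moreover have "h powr (\<beta> * p + 1) = h powr (\<beta> * p + 1 / 2) * sqrt h"
  proof -
    have "sqrt h = h powr (1 / 2)"
      using h01 by (simp add: powr_half_sqrt)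
    then show ?thesis
      unfolding \<open>sqrt h = h powr (1 / 2)\<close> powr_add[symmetric]
      by (intro arg_cong[where f="(powr) h"]) simp
  qed
  \<comment> \<open>This explains the form of \<open>y\<close>: its first summand pays for rounding
    \<open>t\<close> up to \<open>K\<close>.\<close>
  ultimately have ty: "sqrt h * (t + 1) = y"
    using h01 by (simp add: t_def y field_simps)
  have "sqrt h * real K \<le> y"
    unfolding ty[symmetric] using K h01 by (intro mult_left_mono) auto
  then have Ky: "real K * sqrt h \<le> y"
    by (simp add: mult.commute)
  \<comment> \<open>The assumption \<open>y \<le> 1\<close> gives \<open>K * h \<le> 1\<close>, so
    that rounding up \<open>1 / (h * K)\<close> at most doubles it and \<open>w\<close> stays
    between \<open>h / 2\<close> and \<open>h\<close>.\<close>
  have "real K * h = (real K * sqrt h) * sqrt h"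
    using h01 by simp
  also have "\<dots> \<le> 1 * 1"
    using Ky y(2) h01 by (intro mult_mono) auto
  finally have Kh: "real K * h \<le> 1"
    by simp
  have KM: "1 / h \<le> real K * real M" "real K * real M \<le> 2 / h"
  proof -
    have "real K * (1 / (h * real K)) \<le> real K * real M"
      using M by (intro mult_left_mono) auto
    then show "1 / h \<le> real K * real M"
      using K by simp
    have "real K * real M \<le> real K * (1 / (h * real K) + 1)"
      using M by (intro mult_left_mono) auto
    also have "\<dots> = 1 / h + real K"
      using K by (simp add: distrib_left)
    also have "real K \<le> 1 / h"
      using Kh h01 by (simp add: field_simps)
    finally show "real K * real M \<le> 2 / h"
      by simp
  qed
  have w: "0 < w" "w \<le> h" "h / 2 \<le> w"
    using KM h01 K M by (auto simp: w_def field_simps)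
  \<comment> \<open>Since \<open>w \<le> h\<close>, the bandwidth identity bounds the intensity of a
    box by \<open>R\<close>, whatever \<open>n\<close>. Hiding one bump thus has a bounded
    likelihood cost.\<close>
  have a: "real n * (R * (w / 2) powr \<beta> * w) \<le> R"
  proof -
    have "(w / 2) powr \<beta> * w \<le> h powr \<beta> * h"
      using w \<beta> by (intro mult_mono powr_mono2) auto
    then have "real n * R * ((w / 2) powr \<beta> * w) \<le> real n * R * (h powr \<beta> * h)"
      using R by (intro mult_left_mono) auto
    also have "\<dots> = R * (real n * h powr \<beta>) * h"
      by simp
    also have "\<dots> = R"
      using h01 by (simp add: bandwidth_identity[OF n \<beta>(1) h])
    finally show ?thesis
      by (simp add: mult.assoc)
  qed
  let ?F = "PiE {..<K} (\<lambda>_. {..<M})" and ?G = "\<lambda>f. bumps \<beta> R w (centers K M f)"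
  have norm: "?G f \<in> alternatives \<beta> R p \<rho>" if f: "f \<in> ?F" for f
  proof -
    have "\<rho> powr p = h powr (\<beta> * p + 1) * t / C"
      using C0 h01 by (simp add: t_def)
    also have "\<dots> \<le> h powr (\<beta> * p + 1) * real K / C"
      using K C0 by (intro divide_right_mono mult_left_mono) auto
    also have "\<dots> = real K * (h / 4) * (h powr \<beta> * \<tau>) powr p"
      using h01 \<tau> by (simp add: C \<tau>_def[symmetric] powr_mult powr_powr powr_add)
    also have "\<dots> \<le> real K * (w / 2) * (R * ((w / 2) powr \<beta> - (w / 4) powr \<beta>)) powr p"
    proof (rule mult_mono)
      have "h powr \<beta> * \<tau> \<le> (2 * w) powr \<beta> * \<tau>"
        using w h01 \<beta> \<tau> by (intro mult_right_mono powr_mono2) auto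
      also have "\<dots> = R * ((2 * w) powr \<beta> * (1 / 4) powr \<beta> - (2 * w) powr \<beta> * (1 / 8) powr \<beta>)"
        by (simp add: \<tau>_def algebra_simps)
      also have "\<dots> = R * ((w / 2) powr \<beta> - (w / 4) powr \<beta>)"
        using w by (simp add: powr_mult[symmetric])
      finally show "(h powr \<beta> * \<tau>) powr p \<le> (R * ((w / 2) powr \<beta> - (w / 4) powr \<beta>)) powr p"
        using \<tau> p by (intro powr_mono2) auto
      show "real K * (h / 4) \<le> real K * (w / 2)"
        using w by (intro mult_left_mono) auto
    qed (use w in auto)
    also have "\<dots> \<le> (LBINT x:{0..1}. \<bar>?G f x\<bar> powr p)"
      by (rule Lp_integral_bumps_ge[OF K(1) M(1) w_def \<beta>(1) R p \<beta>(2) f])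
    finally have "(\<rho> powr p) powr (1 / p) \<le> Lp_norm p (?G f)"
      unfolding Lp_norm_def using p by (intro powr_mono2) auto
    then have "\<rho> \<le> Lp_norm p (?G f)"
      using \<rho> p by (simp add: powr_powr)
    then show ?thesis
      by (simp add: alternatives_def bumps_in_holder_ball[OF \<beta> R])
  qed
  have KM_ratio: "real K / real M \<le> y\<^sup>2"
  proof -
    have "real K / real M \<le> real K / (1 / (h * real K))"
      using M K h01 by (intro divide_left_mono) auto
    also have "\<dots> = (real K * sqrt h)\<^sup>2"
      using h01 by (simp add: power_mult_distrib power2_eq_square)
    also have "\<dots> \<le> y\<^sup>2"
      using Ky h01 by (intro power_mono) auto
    finally show ?thesis .
  qed
  have "(\<Sum>f\<in>?F. \<Sum>f'\<in>?F. exp (measure (boundary_intensity n (\<lambda>_. 0)) (subgraph (?G f) \<inter> subgraph (?G f'))))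
      \<le> exp ((exp R - 1) * real K / real M) * (real (card ?F))\<^sup>2"
    by (rule overlap_sum_le[OF K(1) M(1) w_def \<beta>(1) R a])
  also have "\<dots> \<le> (1 + (exp ((exp R - 1) * y\<^sup>2) - 1)) * (real (card ?F))\<^sup>2"
  proof -
    have "(exp R - 1) * (real K / real M) \<le> (exp R - 1) * y\<^sup>2"
      using KM_ratio R by (intro mult_left_mono) auto
    then show ?thesis
      by (intro mult_right_mono) auto
  qed
  finally have overlap: "(\<Sum>f\<in>?F. \<Sum>f'\<in>?F. exp (measure (boundary_intensity n (\<lambda>_. 0)) (subgraph (?G f) \<inter> subgraph (?G f'))))
      \<le> (1 + (exp ((exp R - 1) * y\<^sup>2) - 1)) * (real (card ?F))\<^sup>2" .
  have F: "finite ?F" "?F \<noteq> {}"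
    using M by (auto simp: PiE_eq_empty_iff lessThan_empty_iff intro!: finite_PiE)
  show ?thesis
    by (rule testing_error_mixture_ge[OF \<beta>(1) R n law F norm bumps_nonneg[OF R] overlap \<psi>])
qed

text \<open>The lower bound is the same for all tests and so bounds the infimum; the constant test 1
  bounds it from above.\<close>

theorem testing_error_INF_tendsto:
  fixes law :: "nat \<Rightarrow> (real \<Rightarrow> real) \<Rightarrow> config measure"
  assumes \<beta>: "0 < \<beta>" "\<beta> \<le> 1" and R: "0 < R" and p: "p \<ge> 1"
    and r: "\<And>n. n \<ge> 1 \<Longrightarrow> r n > 0"
    and law: "\<And>n g. n \<ge> 1 \<Longrightarrow> g \<in> holder_ball \<beta> R \<Longrightarrow>
      poisson_process_law (boundary_intensity n g) (law n g)"
    and rate: "(\<lambda>n. r n / critical_rate \<beta> p n) \<longlonglongrightarrow> 0"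
  shows "(\<lambda>n. INF \<psi>\<in>tests. testing_error (law n) (alternatives \<beta> R p (r n)) \<psi>) \<longlonglongrightarrow> 1"
proof -
  define h where "h = (\<lambda>n. real n powr (- 1 / (\<beta> + 1)))"
  define C where "C = 4 / (R * ((1 / 4) powr \<beta> - (1 / 8) powr \<beta>)) powr p"
  define y where "y = (\<lambda>n. sqrt (h n) + C * (r n / critical_rate \<beta> p n) powr p)"
  let ?b = "\<lambda>n. 1 - sqrt (exp ((exp R - 1) * (y n)\<^sup>2) - 1)"
  have h0: "h \<longlonglongrightarrow> 0"
    unfolding h_def using \<beta>
    by (intro tendsto_neg_powr filterlim_real_sequentially) (simp add: divide_neg_pos)
  have "(\<lambda>n. (r n / critical_rate \<beta> p n) powr p) \<longlonglongrightarrow> 0"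
    using p by (intro tendsto_zero_powrI[OF rate tendsto_const])
       (auto intro!: eventually_sequentiallyI[of 1] simp: critical_rate_def less_imp_le[OF r])
  then have "y \<longlonglongrightarrow> sqrt 0 + C * 0"
    unfolding y_def by (intro tendsto_intros h0)
  then have y0: "y \<longlonglongrightarrow> 0"
    by simp
  have "?b \<longlonglongrightarrow> 1 - sqrt (exp ((exp R - 1) * 0\<^sup>2) - 1)"
    by (intro tendsto_intros y0)
  then have b: "?b \<longlonglongrightarrow> 1"
    by simp
  have "eventually (\<lambda>n. y n < 1) sequentially"
    using order_tendstoD(2)[OF y0, of 1] by simp
  then have small: "eventually (\<lambda>n. n \<ge> 1 \<and> y n \<le> 1) sequentially"
    using eventually_ge_at_top[of 1] by eventually_elim simp
  have one: "(\<lambda>_. 1) \<in> tests"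
    by (simp add: tests_def)
  show ?thesis
  proof (rule tendsto_sandwich[OF _ _ b tendsto_const])
    show "eventually (\<lambda>n. ?b n \<le> (INF \<psi>\<in>tests. testing_error (law n) (alternatives \<beta> R p (r n)) \<psi>)) sequentially"
      using small
    proof eventually_elim
      fix n assume n: "1 \<le> n \<and> y n \<le> 1"
      then have n1: "n \<ge> 1"
        by simp
      show "?b n \<le> (INF \<psi>\<in>tests. testing_error (law n) (alternatives \<beta> R p (r n)) \<psi>)"
      proof (rule cINF_greatest)
        show "tests \<noteq> {}"
          using one by blast
        show "?b n \<le> testing_error (law n) (alternatives \<beta> R p (r n)) \<psi>" if "\<psi> \<in> tests" for \<psi>
          by (rule testing_error_ge[OF \<beta> R p r[OF n1] n1 _ law[OF n1] C_def _ _ that])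
             (use n in \<open>simp_all add: h_def y_def\<close>)
      qed
    qed
    show "eventually (\<lambda>n. (INF \<psi>\<in>tests. testing_error (law n) (alternatives \<beta> R p (r n)) \<psi>) \<le> 1) sequentially"
      using small
    proof eventually_elim
      fix n assume n: "1 \<le> n \<and> y n \<le> 1"
      then have n1: "n \<ge> 1"
        by simp
      have ps: "prob_space (law n (\<lambda>_. 0))"
        using law[OF n1 zero_in_holder_ball[OF R]] by (simp add: poisson_process_law_def)
      have "alternatives \<beta> R p (r n) \<noteq> {}"
        using alternatives_nonempty[OF R p r[OF n1], of \<beta>] by blast
      \<comment> \<open>Always rejecting has first error 1 and second error 0 under every
        alternative.\<close>
      then have "testing_error (law n) (alternatives \<beta> R p (r n)) (\<lambda>_. 1) = 1"
        using prob_space.prob_space[OF ps] by (simp add: testing_error_def cSUP_const)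
      \<comment> \<open>A real infimum lies below its members only if the set is bounded below; the
        uniform lower bound provides this.\<close>
      moreover have "bdd_below (testing_error (law n) (alternatives \<beta> R p (r n)) ` tests)"
        using testing_error_ge[OF \<beta> R p r[OF n1] n1 _ law[OF n1] C_def, of "h n" "y n"] n
        by (intro bdd_belowI2[where m="?b n"]) (simp add: h_def y_def)
      ultimately show "(INF \<psi>\<in>tests. testing_error (law n) (alternatives \<beta> R p (r n)) \<psi>) \<le> 1"
        using cINF_lower[OF _ one] by metis
    qed
  qed
qed

theorem theorem3p1:
  fixes \<beta> R p :: real
    and r :: "nat \<Rightarrow> real"
    and law :: "nat \<Rightarrow> (real \<Rightarrow> real) \<Rightarrow> config measure"
  assumes "0 < \<beta>" and "\<beta> \<le> 1" and "R > 0" and "p \<ge> 1"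
    and "\<And>n. n \<ge> 1 \<Longrightarrow> r n > 0"
    and "\<And>n g. n \<ge> 1 \<Longrightarrow> g \<in> holder_ball \<beta> R \<Longrightarrow>
           poisson_process_law (boundary_intensity n g) (law n g)"
  shows "(filterlim (\<lambda>n. r n / critical_rate \<beta> p n) at_top sequentially \<longrightarrow>
           (\<forall>n\<ge>1. plugin_test n \<beta> R p (r n) \<in> tests) \<and>
           (\<lambda>n. testing_error (law n) (alternatives \<beta> R p (r n)) (plugin_test n \<beta> R p (r n)))
             \<longlonglongrightarrow> 0) \<and>
         ((\<lambda>n. r n / critical_rate \<beta> p n) \<longlonglongrightarrow> 0 \<longrightarrow>
           (\<lambda>n. INF \<psi>\<in>tests. testing_error (law n) (alternatives \<beta> R p (r n)) \<psi>)
             \<longlonglongrightarrow> 1)"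
proof (intro conjI impI allI)
  show "plugin_test n \<beta> R p (r n) \<in> tests" for n
    by (rule plugin_test_in_tests[OF assms(1,3,4)])
next
  assume "filterlim (\<lambda>n. r n / critical_rate \<beta> p n) at_top sequentially"
  from plugin_test_consistent[where law=law and r=r, OF assms(1,3,4) _ _ this] assms(5,6)
  show "(\<lambda>n. testing_error (law n) (alternatives \<beta> R p (r n)) (plugin_test n \<beta> R p (r n))) \<longlonglongrightarrow> 0"
    by blast
next
  assume "(\<lambda>n. r n / critical_rate \<beta> p n) \<longlonglongrightarrow> 0"
  from testing_error_INF_tendsto[where law=law and r=r, OF assms(1-4) _ _ this] assms(5,6)
  show "(\<lambda>n. INF \<psi>\<in>tests. testing_error (law n) (alternatives \<beta> R p (r n)) \<psi>) \<longlonglongrightarrow> 1"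
    by blast
qed

end
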